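(* Let $p\in\mathbb{R}$ be exponentially transcendental (in the real exponential field $\langle \mathbb{R};+,\cdot,\exp\rangle$), let $\bar y=(y_1,\dots,y_n)\in(\mathbb{R}_{>0})^n$, and suppose $\bar y$ is multiplicatively independent. Then \[\operatorname{td}(\bar y,\bar y^{\,p}/p)\ge n,\] where $\bar y^{\,p}=(y_1^{p},\dots,y_n^{p})$.
   Context: For subsets $X,Y$ of a field, $\operatorname{td}(X/Y)$ denotes the transcendence degree of the field extension $\mathbb{Q}(X,Y)/\mathbb{Q}(Y)$. A tuple $\bar y$ is multiplicatively independent if whenever $m_1,\dots,m_n\in\mathbb{Z}$ and $\prod_i y_i^{m_i}=1$, all $m_i=0$. An exponential field is a field $F$ of characteristic zero with a homomorphism $\exp$ from $(F,+)$ to $(F^\times,\cdot)$. An element $x\in F$ is exponentially algebraic in $F$ if there are $k\in\mathbb{N}$, $\bar x=(x_1,\dots,x_k)\in F^k$ with $x=x_1$, and exponential polynomials $f_1,\dots,f_k\in\mathbb{Z}[X_1,\dots,X_k,e^{X_1},\dots,e^{X_k}]$ such that $f_i(\bar x,\exp(\bar x))=0$ for all $i$ and the Jacobian determinant $\det\big(\partial f_i/\partial X_j\big)_{i,j}$ (with $\partial e^{X_j}/\partial X_j=e^{X_j}$) is nonzero at $\bar x$. Otherwise $x$ is exponentially transcendental in $F$. *)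

theory Defs
  imports Complex_Main "HOL-Library.Poly_Mapping" "HOL-Library.Extended_Nat"
    "Jordan_Normal_Form.Determinant"
begin

(* Multivariate polynomials with variables from 'v and coefficients from 'c are represented
   as ('v \<Rightarrow>\<^sub>0 nat) \<Rightarrow>\<^sub>0 'c: finitely supported maps from monomials (exponent vectors)
   to coefficients, with the ring structure provided by Poly_Mapping. *)
type_synonym ('v, 'c) mpolynomial = "('v \<Rightarrow>\<^sub>0 nat) \<Rightarrow>\<^sub>0 'c"

definition mpoly_var :: "'v \<Rightarrow> ('v, 'c::comm_ring_1) mpolynomial" where
  "mpoly_var v = Poly_Mapping.single (Poly_Mapping.single v 1) 1"

definition mpoly_vars :: "('v, 'c::zero) mpolynomial \<Rightarrow> 'v set" where
  "mpoly_vars P = (\<Union>m\<in>Poly_Mapping.keys P. Poly_Mapping.keys m)"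

(* \<phi> embeds the coefficients into the ring in which the variables take the values a. *)
definition mpoly_eval ::
  "('c::zero \<Rightarrow> 'a::comm_ring_1) \<Rightarrow> ('v \<Rightarrow> 'a) \<Rightarrow> ('v, 'c) mpolynomial \<Rightarrow> 'a" where
  "mpoly_eval \<phi> a P =
     (\<Sum>m\<in>Poly_Mapping.keys P. \<phi> (Poly_Mapping.lookup P m) *
        (\<Prod>v\<in>Poly_Mapping.keys m. a v ^ Poly_Mapping.lookup m v))"

(* Subtraction of exponents is truncated, but where v does not occur in m
   the coefficient of the corresponding summand is 0. *)
definition mpoly_pderiv :: "'v \<Rightarrow> ('v, 'c::comm_ring_1) mpolynomial \<Rightarrow> ('v, 'c) mpolynomial" where
  "mpoly_pderiv v P =
     (\<Sum>m\<in>Poly_Mapping.keys P. Poly_Mapping.single (m - Poly_Mapping.single v 1)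
        (of_nat (Poly_Mapping.lookup m v) * Poly_Mapping.lookup P m))"


definition is_subfield :: "'a::field set \<Rightarrow> bool" where
  "is_subfield K \<longleftrightarrow> 0 \<in> K \<and> 1 \<in> K \<and>
     (\<forall>a\<in>K. \<forall>b\<in>K. a + b \<in> K \<and> a * b \<in> K) \<and> (\<forall>a\<in>K. - a \<in> K \<and> inverse a \<in> K)"

(* In characteristic zero the least subfield containing S is \<rat>(S). *)
definition rat_adjoin :: "'a::field_char_0 set \<Rightarrow> 'a set" where
  "rat_adjoin S = \<Inter> {K. is_subfield K \<and> S \<subseteq> K}"

(* The elements of B themselves index the variables: no nonzero polynomial over K
   vanishes when every variable b \<in> B is replaced by b. *)
definition alg_indep_over :: "'a::field set \<Rightarrow> 'a set \<Rightarrow> bool" where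
  "alg_indep_over K B \<longleftrightarrow>
     (\<forall>P :: ('a, 'a) mpolynomial.
        (\<forall>m. Poly_Mapping.lookup P m \<in> K) \<and> mpoly_vars P \<subseteq> B \<and>
        mpoly_eval (\<lambda>c. c) (\<lambda>b. b) P = 0 \<longrightarrow> P = 0)"

(* The largest size of a subset of L that is algebraically independent over K. The value is
   \<infinity> exactly if there are such subsets of every finite size. *)
definition transcendence_degree :: "'a::field set \<Rightarrow> 'a set \<Rightarrow> enat" where
  "transcendence_degree L K = (SUP B\<in>{B. B \<subseteq> L \<and> finite B \<and> alg_indep_over K B}. enat (card B))"

definition td :: "'a::field_char_0 set \<Rightarrow> 'a set \<Rightarrow> enat" where
  "td X Y = transcendence_degree (rat_adjoin (X \<union> Y)) (rat_adjoin Y)"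


definition mult_indep :: "nat \<Rightarrow> (nat \<Rightarrow> 'a::field) \<Rightarrow> bool" where
  "mult_indep n y \<longleftrightarrow>
     (\<forall>m :: nat \<Rightarrow> int. (\<Prod>i<n. y i powi m i) = 1 \<longrightarrow> (\<forall>i<n. m i = 0))"


(* XVar j stands for X_j and EVar j for e^{X_j}; indices start at 0. *)
datatype exp_var = XVar nat | EVar nat

type_synonym exp_polynomial = "(exp_var, int) mpolynomial"

definition exp_polynomials :: "nat \<Rightarrow> exp_polynomial set" where
  "exp_polynomials k = {f. mpoly_vars f \<subseteq> XVar ` {..<k} \<union> EVar ` {..<k}}"

(* The partial derivative with respect to X_j, by the chain rule, where e^{X_j} is its own
   derivative. *)
definition exp_pderiv :: "nat \<Rightarrow> exp_polynomial \<Rightarrow> exp_polynomial" where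
  "exp_pderiv j f = mpoly_pderiv (XVar j) f + mpoly_var (EVar j) * mpoly_pderiv (EVar j) f"

locale exponential_field =
  fixes E :: "'a::field_char_0 \<Rightarrow> 'a"
  assumes E_add: "E (x + y) = E x * E y"
    and E_nonzero: "E x \<noteq> 0"
begin

definition exp_eval :: "(nat \<Rightarrow> 'a) \<Rightarrow> exp_polynomial \<Rightarrow> 'a" where
  "exp_eval xs f = mpoly_eval of_int (case_exp_var xs (\<lambda>j. E (xs j))) f"

definition exp_algebraic :: "'a \<Rightarrow> bool" where
  "exp_algebraic x \<longleftrightarrow>
     (\<exists>k>0. \<exists>(xs :: nat \<Rightarrow> 'a) (f :: nat \<Rightarrow> exp_polynomial).
        x = xs 0 \<and>
        (\<forall>i<k. f i \<in> exp_polynomials k \<and> exp_eval xs (f i) = 0) \<and>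
        det (mat k k (\<lambda>(i, j). exp_eval xs (exp_pderiv j (f i)))) \<noteq> 0)"

definition exp_transcendental :: "'a \<Rightarrow> bool" where
  "exp_transcendental x \<longleftrightarrow> \<not> exp_algebraic x"

end

global_interpretation real_exp: exponential_field "exp :: real \<Rightarrow> real"
  by unfold_locales (simp_all add: exp_add)

end

theory Submission
  imports Defs "HOL-Computational_Algebra.Polynomial" "HOL-Computational_Algebra.Polynomial_FPS"
    "HOL-Computational_Algebra.Formal_Laurent_Series"
begin

text \<open>
  If \<open>p\<close> is exponentially transcendental, there is an exponential derivation \<open>\<delta>\<close> of the reals with
  \<open>\<delta> p = 1\<close>. By linear duality it suffices to find, at each point whose first coordinate is \<open>p\<close>, a vector
  with first coordinate \<open>1\<close> tangent to all exponential-polynomial relations holding there. If there were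
  none, the remaining coordinates could be moved one by one to rational values along analytic flows
  preserving these relations, until a nonsingular system witnessed that \<open>p\<close> is exponentially algebraic.

  Let \<open>C\<close> be the field of constants of \<open>\<delta>\<close>. Ax's theorem says that real-linear relations between the
  forms \<open>d(exp z) / exp z - dz\<close> over \<open>C\<close> come from rational linear relations of the \<open>z\<close> modulo \<open>C\<close>: Lie derivation
  along \<open>\<delta>\<close> makes the coefficients constant, and a residue computation finishes the argument. If the
  transcendence degree were below \<open>n\<close>, the forms \<open>d(exp (p * a i)) / exp (p * a i) - p * d(exp (a i)) / exp (a i)\<close>,
  where \<open>a i = ln (y i)\<close>, would be dependent over \<open>C(p)\<close>, and comparing powers of \<open>p\<close> in the resulting
  relation contradicts the rational independence of the \<open>a i\<close>.
\<close>

section \<open>Subrings, derivations and linear algebra over a subfield\<close>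

text \<open>Differential forms never appear as objects: a form over \<open>C\<close> is replaced by
  its values at all derivations over \<open>C\<close>, so that a relation between forms is one
  between functions of \<open>D\<close>, and finite linear duality passes between spans and
  relations. Coordinates are moved along a flow, not along a curve cut out by a chosen finite
  system, because the flow keeps every relation that holds at its starting point. Determined
  coordinates therefore stay determined by the relations that determined them. Residues need a field
  of rational functions in one variable below \<real>. A subfield \<open>K\<close> containing
  \<open>C\<close> and maximal with \<open>t\<close> transcendental over it provides one: \<real> is
  then algebraic over \<open>K(t)\<close>. Norm and trace of a finite extension of
  \<open>K(t)\<close> carry orders and residues down, so no place has to be extended. Ax's
  conclusion says that the sum of the \<open>f j\<close> tensor \<open>z j\<close> vanishes in the
  tensor product, over the rationals, of \<real> with the quotient of \<real> by \<open>C\<close>.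
  It is stated by applying rational functionals \<phi> to the second factor.\<close>

definition is_subring :: "'a::ring_1 set \<Rightarrow> bool" where
  "is_subring A \<longleftrightarrow> 0 \<in> A \<and> 1 \<in> A \<and> (\<forall>a\<in>A. \<forall>b\<in>A. a + b \<in> A \<and> a * b \<in> A) \<and> (\<forall>a\<in>A. - a \<in> A)"

lemma subring_closed:
  assumes "is_subring A"
  shows "0 \<in> A" "1 \<in> A" "a \<in> A \<Longrightarrow> b \<in> A \<Longrightarrow> a + b \<in> A" "a \<in> A \<Longrightarrow> b \<in> A \<Longrightarrow> a * b \<in> A"
    "a \<in> A \<Longrightarrow> - a \<in> A" "a \<in> A \<Longrightarrow> b \<in> A \<Longrightarrow> a - b \<in> A"
  using assms unfolding is_subring_def by auto (metis add_uminus_conv_diff)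

lemma subring_power: "is_subring A \<Longrightarrow> a \<in> A \<Longrightarrow> a ^ n \<in> A"
  by (induction n) (auto simp: subring_closed)

lemma subring_sum: "is_subring A \<Longrightarrow> (\<And>i. i \<in> I \<Longrightarrow> f i \<in> A) \<Longrightarrow> sum f I \<in> A"
  by (induction I rule: infinite_finite_induct) (auto simp: subring_closed)

lemma subring_prod:
  "is_subring A \<Longrightarrow> (\<And>i. i \<in> I \<Longrightarrow> f i \<in> A) \<Longrightarrow> prod f I \<in> (A :: 'a::comm_ring_1 set)"
  by (induction I rule: infinite_finite_induct) (auto simp: subring_closed)

lemma subring_of_nat: "is_subring A \<Longrightarrow> of_nat n \<in> A"
  by (induction n) (auto simp: subring_closed)

lemma subring_of_int: "is_subring A \<Longrightarrow> of_int k \<in> A"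
  by (cases k) (auto simp: subring_closed subring_of_nat intro: subring_closed(5) simp del: of_nat_Suc)

lemma subfield_subring: "is_subfield K \<Longrightarrow> is_subring K"
  by (auto simp: is_subfield_def is_subring_def)

lemma subfield_inverse: "is_subfield K \<Longrightarrow> a \<in> K \<Longrightarrow> inverse a \<in> K"
  by (auto simp: is_subfield_def)

lemma subfield_divide: "is_subfield K \<Longrightarrow> a \<in> K \<Longrightarrow> b \<in> K \<Longrightarrow> a / b \<in> K"
  by (simp add: divide_inverse subfield_inverse subring_closed(4) subfield_subring)

lemma is_subfield_UNIV: "is_subfield UNIV"
  by (simp add: is_subfield_def)

lemma is_subfield_fractions:
  fixes A :: "'a::field set"
  assumes "is_subring A"
  shows "is_subfield {a / b |a b. a \<in> A \<and> b \<in> A \<and> b \<noteq> 0}" (is "is_subfield ?K")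
proof -
  note A = subring_closed[OF assms]
  have I: "a / b \<in> ?K" if "a \<in> A" "b \<in> A" "b \<noteq> 0" for a b using that by blast
  have E: "\<exists>a b. x = a / b \<and> a \<in> A \<and> b \<in> A \<and> b \<noteq> 0" if "x \<in> ?K" for x using that by blast
  have "0 \<in> ?K" "1 \<in> ?K" using I[of 0 1] I[of 1 1] A(1,2) by simp_all
  moreover have "x + y \<in> ?K \<and> x * y \<in> ?K" if xy: "x \<in> ?K" "y \<in> ?K" for x y
  proof -
    obtain a b c d where *: "x = a / b" "y = c / d" "a \<in> A" "b \<in> A" "b \<noteq> 0" "c \<in> A" "d \<in> A" "d \<noteq> 0"
      using E[OF xy(1)] E[OF xy(2)] by metis
    have "x + y = (a * d + c * b) / (b * d)" "x * y = (a * c) / (b * d)"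
      using * by (simp_all add: add_frac_eq)
    then show ?thesis
      using I[of "a * d + c * b" "b * d"] I[of "a * c" "b * d"] A(3,4) * by simp
  qed
  moreover have "- x \<in> ?K \<and> inverse x \<in> ?K" if x: "x \<in> ?K" for x
  proof -
    obtain a b where *: "x = a / b" "a \<in> A" "b \<in> A" "b \<noteq> 0" using E[OF x] by metis
    then show ?thesis
      using I[of "- a" b] I[of b a] I[of 0 1] A(1,2,5) by (cases "a = 0") simp_all
  qed
  ultimately show ?thesis unfolding is_subfield_def by (intro conjI ballI) simp_all
qed

lemma common_denominator:
  fixes A :: "'a::field set" and N :: nat
  assumes A: "is_subring A" and "\<And>j. j < N \<Longrightarrow> \<exists>a\<in>A. \<exists>b\<in>A. b \<noteq> 0 \<and> v j = a / b"
  shows "\<exists>b\<in>A. b \<noteq> 0 \<and> (\<forall>j<N. v j * b \<in> A)"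
  using assms(2)
proof (induction N)
  case 0
  then show ?case using subring_closed(2)[OF A] by (intro bexI[of _ 1]) auto
next
  case (Suc N)
  then obtain b where b: "b \<in> A" "b \<noteq> 0" "\<And>j. j < N \<Longrightarrow> v j * b \<in> A" by auto
  obtain a c where ac: "a \<in> A" "c \<in> A" "c \<noteq> 0" "v N = a / c" using Suc.prems by blast
  have "v j * (b * c) \<in> A" if "j < Suc N" for j
  proof (cases "j = N")
    case True
    then have eq: "v j * (b * c) = a * b" using ac by simp
    show ?thesis unfolding eq using ac b subring_closed(4)[OF A] by blast
  next
    case False
    then have "v j * b * c \<in> A" using that ac b subring_closed(4)[OF A] by simp
    then show ?thesis by (simp add: mult.assoc)
  qed
  then show ?case using b ac subring_closed(4)[OF A] by (intro bexI[of _ "b * c"]) auto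
qed

definition poly_over :: "'a::zero set \<Rightarrow> 'a poly set" where
  "poly_over A = {q. \<forall>i. coeff q i \<in> A}"

lemma is_subring_poly_over:
  assumes "is_subring (A :: 'a::comm_ring_1 set)" shows "is_subring (poly_over A)"
proof -
  note A = subring_closed[OF assms]
  have "p * q \<in> poly_over A" if "p \<in> poly_over A" "q \<in> poly_over A" for p q
    using that A by (auto simp: poly_over_def coeff_mult intro!: subring_sum assms)
  then show ?thesis
    using A by (auto simp: is_subring_def poly_over_def one_pCons coeff_pCons split: nat.splits)
qed

lemma poly_over_pderiv:
  "is_subring A \<Longrightarrow> q \<in> poly_over A \<Longrightarrow> pderiv q \<in> poly_over (A :: 'a::idom set)"
  by (auto simp: poly_over_def coeff_pderiv subring_closed subring_of_nat simp del: of_nat_Suc)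

lemma poly_over_pCons: "a \<in> A \<Longrightarrow> q \<in> poly_over A \<Longrightarrow> pCons a q \<in> poly_over A"
  by (auto simp: poly_over_def coeff_pCons split: nat.splits)

lemma poly_over_const: "0 \<in> A \<Longrightarrow> a \<in> A \<Longrightarrow> [:a:] \<in> poly_over A"
  by (auto simp: poly_over_def coeff_pCons split: nat.splits)

lemma poly_in_subring:
  "is_subring A \<Longrightarrow> q \<in> poly_over A \<Longrightarrow> z \<in> A \<Longrightarrow> poly q z \<in> (A :: 'a::comm_ring_1 set)"
  unfolding poly_altdef poly_over_def by (auto intro!: subring_sum subring_closed(4) subring_power)

definition transcendental_over :: "'a::comm_ring_1 set \<Rightarrow> 'a \<Rightarrow> bool" where
  "transcendental_over K z \<longleftrightarrow> (\<forall>q\<in>poly_over K. poly q z = 0 \<longrightarrow> q = 0)"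

section \<open>Derivations of a field and their constants\<close>

definition derivation :: "('a::ring_1 \<Rightarrow> 'a) \<Rightarrow> bool" where
  "derivation D \<longleftrightarrow> (\<forall>a b. D (a + b) = D a + D b) \<and> (\<forall>a b. D (a * b) = D a * b + a * D b)"

definition derivations_over :: "'a::ring_1 set \<Rightarrow> ('a \<Rightarrow> 'a) set" where
  "derivations_over C = {D. derivation D \<and> (\<forall>c\<in>C. D c = 0)}"

context
  fixes D :: "'a::field \<Rightarrow> 'a"
  assumes D: "derivation D"
begin

lemma derivation_add: "D (a + b) = D a + D b" using D by (simp add: derivation_def)
lemma derivation_mult: "D (a * b) = D a * b + a * D b" using D by (simp add: derivation_def)

lemma derivation_0: "D 0 = 0" using derivation_add[of 0 0] by (metis add_0_right add_cancel_right_right)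
lemma derivation_1: "D 1 = 0" using derivation_mult[of 1 1] by (metis add_cancel_right_right
    mult_1 mult_1_right)
lemma derivation_minus: "D (- a) = - D a"
  using derivation_add[of a "- a"] derivation_0 by (simp add: eq_neg_iff_add_eq_0 add.commute)
lemma derivation_diff: "D (a - b) = D a - D b"
  using derivation_add[of a "- b"] derivation_minus by simp
lemma derivation_sum: "D (sum f I) = (\<Sum>i\<in>I. D (f i))"
  by (induction I rule: infinite_finite_induct) (auto simp: derivation_0 derivation_add)

lemma derivation_inverse: "a \<noteq> 0 \<Longrightarrow> D (inverse a) = - D a / a\<^sup>2"
  using derivation_mult[of a "inverse a"] derivation_1
  by (simp add: field_simps power2_eq_square eq_neg_iff_add_eq_0)

lemma derivation_divide: "b \<noteq> 0 \<Longrightarrow> D (a / b) = (D a * b - a * D b) / b\<^sup>2"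
  by (simp add: divide_inverse derivation_mult derivation_inverse)
     (simp add: field_simps power2_eq_square)

lemma derivation_of_nat: "D (of_nat n) = 0"
  by (induction n) (auto simp: derivation_0 derivation_1 derivation_add)

lemma derivation_of_int: "D (of_int n) = 0"
  by (cases n) (auto simp: derivation_of_nat derivation_minus simp del: of_nat_Suc)


lemma derivation_poly: "D (poly q z) = poly (map_poly D q) z + poly (pderiv q) z * D z"
proof (induction q)
  case (pCons a q)
  have "map_poly D (pCons a q) = pCons (D a) (map_poly D q)"
    by (rule map_poly_pCons) (simp add: derivation_0)
  with pCons show ?case
    by (simp add: derivation_add derivation_mult pderiv_pCons algebra_simps)
qed (simp add: derivation_0)

lemma is_subfield_constants: "is_subfield {c. D c = 0}"
proof -
  have "D (inverse c) = 0" if "D c = 0" for c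
    using derivation_inverse[of c] that by (cases "c = 0") (auto simp: derivation_0)
  then show ?thesis
    by (auto simp: is_subfield_def derivation_add derivation_mult derivation_0 derivation_1
        derivation_minus)
qed

end

text \<open>Differentiating \<open>poly q z = 0\<close> gives
  \<open>poly (pderiv q) z * D z = 0\<close>. Either \<open>D z = 0\<close>, or
  \<open>pderiv q\<close> is an equation for \<open>z\<close> of smaller degree, nonzero because the
  characteristic is zero; so induction on the degree stands in for a minimal polynomial.\<close>

lemma derivation_algebraic:
  fixes D :: "'a::field_char_0 \<Rightarrow> 'a"
  assumes "D \<in> derivations_over K" "is_subring K" "\<not> transcendental_over K z"
  shows "D z = 0"
proof -
  have D: "derivation D" and K: "\<And>c. c \<in> K \<Longrightarrow> D c = 0"
    using assms by (auto simp: derivations_over_def)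
  obtain q where q: "q \<in> poly_over K" "poly q z = 0" "q \<noteq> 0"
    using assms by (auto simp: transcendental_over_def)
  then show ?thesis
  proof (induction "degree q" arbitrary: q rule: less_induct)
    case less
    have deg: "degree q \<noteq> 0"
    proof
      assume "degree q = 0"
      then obtain a where "q = [:a:]" by (rule degree_eq_zeroE)
      then show False using less.prems by simp
    qed
    have "map_poly D q = 0"
      using less.prems(1) K by (intro poly_eqI) (simp add: poly_over_def coeff_map_poly
          derivation_0[OF D])
    then have "poly (pderiv q) z * D z = 0"
      using derivation_poly[OF D, of q z] less.prems(2) derivation_0[OF D] by simp
    moreover have "pderiv q \<noteq> 0" using deg by (simp add: pderiv_eq_0_iff)
    moreover have "degree (pderiv q) < degree q" using deg by (simp add: degree_pderiv)
    ultimately show ?case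
      using less.hyps[of "pderiv q"] poly_over_pderiv[OF assms(2) less.prems(1)] by auto
  qed
qed

text \<open>A vector outside a finite-dimensional subspace is detected by a functional that kills
  the subspace, with everything defined over \<open>K\<close>. Only the first \<open>N\<close>
  coordinates count; members of \<open>W\<close> may be arbitrary beyond them. This is the duality
  that turns a missing solution into a relation, and a missing relation into a solution.\<close>

lemma in_subspace_or_separated:
  fixes K :: "'a::field set" and W :: "(nat \<Rightarrow> 'a) set"
  assumes K: "is_subfield K"
    and "\<And>w i. w \<in> W \<Longrightarrow> i < N \<Longrightarrow> w i \<in> K" "\<And>i. i < N \<Longrightarrow> e i \<in> K"
    and "(\<lambda>_. 0) \<in> W" "\<And>u w. u \<in> W \<Longrightarrow> w \<in> W \<Longrightarrow> (\<lambda>i. u i + w i) \<in> W"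
    and "\<And>c w. c \<in> K \<Longrightarrow> w \<in> W \<Longrightarrow> (\<lambda>i. c * w i) \<in> W"
  shows "(\<exists>w\<in>W. \<forall>i<N. w i = e i) \<or>
    (\<exists>v. (\<forall>i. v i \<in> K) \<and> (\<forall>w\<in>W. (\<Sum>i<N. w i * v i) = 0) \<and> (\<Sum>i<N. e i * v i) = 1)"
  using assms(2-)
proof (induction N arbitrary: W e)
  case (Suc N)
  note Kc = subring_closed[OF subfield_subring[OF K]]
  show ?case
  proof (cases "\<forall>w\<in>W. w N = 0")
    case True
    show ?thesis
    proof (cases "e N = 0")
      case eN: True
      from Suc.IH[of W e] Suc.prems consider "\<exists>w\<in>W. \<forall>i<N. w i = e i"
        | v where "\<forall>i. v i \<in> K" "\<forall>w\<in>W. (\<Sum>i<N. w i * v i) = 0" "(\<Sum>i<N. e i * v i) = 1"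
        by (auto simp: less_Suc_eq)
      then show ?thesis
      proof cases
        case 1 then show ?thesis using True eN by (auto simp: less_Suc_eq)
      next
        case 2 then show ?thesis using True eN by (auto intro!: exI[of _ v])
      qed
    next
      case False
      let ?v = "\<lambda>i. if i = N then inverse (e N) else 0"
      have "\<forall>i. ?v i \<in> K" using Suc.prems(2)[of N] K Kc(1) by (auto simp: subfield_inverse)
      moreover have "(\<Sum>i<Suc N. f i * ?v i) = f N * inverse (e N)" for f by simp
      ultimately show ?thesis using True False by (intro disjI2 exI[of _ ?v]) simp
    qed
  next
    case False
    then obtain w where w: "w \<in> W" "w N \<noteq> 0" by blast
    \<comment> \<open>A pivot: subtracting multiples of \<open>w0\<close> clears the last
      coordinate, both of the members of \<open>W\<close> (giving \<open>W0\<close>) and of the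
      target \<open>e\<close> (giving \<open>e0\<close>).\<close>
    define w0 where "w0 = (\<lambda>i. inverse (w N) * w i)"
    have w0: "w0 \<in> W" "w0 N = 1"
      using w Suc.prems(1,5) K by (auto simp: w0_def subfield_inverse)
    define W0 where "W0 = {w\<in>W. w N = 0}"
    define e0 where "e0 = (\<lambda>i. e i - e N * w0 i)"
    have "(\<exists>w\<in>W0. \<forall>i<N. w i = e0 i) \<or>
      (\<exists>v. (\<forall>i. v i \<in> K) \<and> (\<forall>w\<in>W0. (\<Sum>i<N. w i * v i) = 0) \<and> (\<Sum>i<N. e0 i * v i) = 1)"
      by (rule Suc.IH) (use Suc.prems w0 Kc in \<open>auto simp: W0_def e0_def\<close>)
    then consider u where "u \<in> W0" "\<forall>i<N. u i = e0 i"
      | v where "\<forall>i. v i \<in> K" "\<forall>w\<in>W0. (\<Sum>i<N. w i * v i) = 0" "(\<Sum>i<N. e0 i * v i) = 1"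
      by blast
    then show ?thesis
    proof cases
      case 1
      have "(\<lambda>i. u i + e N * w0 i) \<in> W"
        using 1(1) w0(1) Suc.prems(2) by (intro Suc.prems(4,5)) (auto simp: W0_def)
      moreover have "\<forall>i<Suc N. u i + e N * w0 i = e i"
      proof (intro allI impI)
        fix i assume "i < Suc N"
        then show "u i + e N * w0 i = e i"
          using 1 w0(2) by (cases "i = N") (auto simp: W0_def e0_def)
      qed
      ultimately show ?thesis by (intro disjI1 bexI)
    next
      case 2
      \<comment> \<open>The last entry of the functional is forced: it has to kill the pivot, whose
        last coordinate is 1.\<close>
      let ?s = "\<Sum>i<N. w0 i * v i"
      let ?v = "\<lambda>i. if i = N then - ?s else v i"
      have s: "?s \<in> K"
        using Suc.prems(1) w0 2 by (intro subring_sum subfield_subring K Kc(4)) auto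
      have sum: "(\<Sum>i<Suc N. f i * ?v i) = (\<Sum>i<N. f i * v i) - f N * ?s" for f
        by simp
      have "(\<Sum>i<Suc N. u i * ?v i) = 0" if "u \<in> W" for u
      proof -
        have "(\<lambda>i. u i + (- u N) * w0 i) \<in> W0"
          unfolding W0_def using that w0 Suc.prems(1)[of u N]
          by (intro CollectI conjI Suc.prems(4,5) Kc(5)) simp_all
        then have "(\<Sum>i<N. (u i + (- u N) * w0 i) * v i) = 0" using 2(2) by simp
        then have "(\<Sum>i<N. u i * v i) - u N * ?s = 0"
          by (simp add: algebra_simps sum.distrib sum_distrib_left sum_subtractf)
        then show ?thesis by (simp only: sum)
      qed
      moreover have "(\<Sum>i<Suc N. e i * ?v i) = 1"
      proof -
        have "(\<Sum>i<N. e0 i * v i) = (\<Sum>i<N. e i * v i) - e N * ?s"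
          by (simp add: e0_def algebra_simps sum_distrib_left sum_subtractf)
        then show ?thesis using 2(3) by (simp only: sum)
      qed
      moreover have "\<forall>i. ?v i \<in> K" using 2 s Kc(5) by auto
      ultimately show ?thesis by (intro disjI2 exI[of _ ?v] conjI ballI)
    qed
  qed
next
  case 0
  then show ?case by (intro disjI1 bexI[of _ "\<lambda>_. 0"]) simp_all
qed

section \<open>Multivariate and exponential polynomials\<close>

lemma poly_mapping_sum_single:
  "(P :: 'k \<Rightarrow>\<^sub>0 'b::comm_monoid_add) = (\<Sum>m\<in>Poly_Mapping.keys P. Poly_Mapping.single m
      (Poly_Mapping.lookup P m))"
  by (rule poly_mapping_eqI)
     (auto simp: lookup_sum lookup_single when_def in_keys_iff sum.delta' intro!: sum.neutral)

lemma mpoly_induct [case_names single add]: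
  fixes P :: "'k \<Rightarrow>\<^sub>0 'b::comm_monoid_add"
  assumes "\<And>m c. Q (Poly_Mapping.single m c)" "\<And>P P'. Q P \<Longrightarrow> Q P' \<Longrightarrow> Q (P + P')"
  shows "Q P"
proof -
  have "Q (\<Sum>m\<in>M. Poly_Mapping.single m (Poly_Mapping.lookup P m))" for M
    using assms(1)[of undefined 0] by (induction M rule: infinite_finite_induct) (auto intro: assms)
  then show ?thesis using poly_mapping_sum_single[of P] by metis
qed

lemma single_single_power: "Poly_Mapping.single (Poly_Mapping.single v n) 1 = (mpoly_var v :: ('v,
    'c::comm_ring_1) mpolynomial) ^ n"
proof (induction n)
  case (Suc n)
  have "mpoly_var v ^ Suc n = mpoly_var v * Poly_Mapping.single (Poly_Mapping.single v n) (1 :: 'c)"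
    by (simp add: Suc)
  then show ?case by (simp add: mpoly_var_def mult_single flip: single_add)
qed simp

lemma mpoly_var_induct [consumes 1, case_names const var add mult]:
  fixes P :: "('v, 'c::comm_ring_1) mpolynomial"
  assumes "mpoly_vars P \<subseteq> V"
    and const: "\<And>c. Q (Poly_Mapping.single 0 c)" and var: "\<And>v. v \<in> V \<Longrightarrow> Q (mpoly_var v)"
    and add: "\<And>P P'. Q P \<Longrightarrow> Q P' \<Longrightarrow> Q (P + P')" and mult: "\<And>P P'. Q P \<Longrightarrow> Q P' \<Longrightarrow> Q (P * P')"
  shows "Q P"
proof -
  have power: "Q (mpoly_var v ^ n)" if "v \<in> V" for v n
    using const[of 1] by (induction n) (auto intro: mult var that)
  have Q1: "Q (Poly_Mapping.single (\<Sum>v\<in>A. Poly_Mapping.single v (Poly_Mapping.lookup m v)) 1)"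
    if "A \<subseteq> V" for m A
    using that
  proof (induction A rule: infinite_finite_induct)
    case (insert v A)
    have "Poly_Mapping.single (\<Sum>v\<in>insert v A. Poly_Mapping.single v (Poly_Mapping.lookup m v)) (1::'c)
       = mpoly_var v ^ Poly_Mapping.lookup m v *
         Poly_Mapping.single (\<Sum>v\<in>A. Poly_Mapping.single v (Poly_Mapping.lookup m v)) 1"
      using insert.hyps by (simp add: mult_single flip: single_single_power)
    then show ?case using insert by (auto intro!: mult power)
  qed (use const[of 1] in auto)
  have "Q (Poly_Mapping.single m c)" if "Poly_Mapping.keys m \<subseteq> V" for m c
  proof -
    have "Poly_Mapping.single m c = Poly_Mapping.single 0 c * Poly_Mapping.single m 1"
      by (simp add: mult_single)
    then show ?thesis
      using Q1[OF that, of m] const[of c] mult by (metis poly_mapping_sum_single)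
  qed
  then have "Q (\<Sum>m\<in>M. Poly_Mapping.single m (Poly_Mapping.lookup P m))" if "M \<subseteq> Poly_Mapping.keys
      P" for M
    using that assms(1) const[of 0] unfolding mpoly_vars_def
    by (induction M rule: infinite_finite_induct) (auto intro!: add)
  then show ?thesis using poly_mapping_sum_single[of P] by (metis subset_refl)
qed

lemma mpoly_vars_single: "mpoly_vars (Poly_Mapping.single m c) \<subseteq> Poly_Mapping.keys m"
  by (auto simp: mpoly_vars_def)

lemma mpoly_vars_add: "mpoly_vars (P + P') \<subseteq> mpoly_vars P \<union> mpoly_vars P'"
  using keys_add[of P P'] by (auto simp: mpoly_vars_def)

lemma mpoly_vars_mult: "mpoly_vars (P * P') \<subseteq> mpoly_vars P \<union> mpoly_vars P'"
proof
  fix v assume "v \<in> mpoly_vars (P * P')"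
  then obtain a b where "a \<in> Poly_Mapping.keys P" "b \<in> Poly_Mapping.keys P'" "v \<in>
      Poly_Mapping.keys (a + b)"
    using keys_mult[of P P'] by (auto simp: mpoly_vars_def)
  then show "v \<in> mpoly_vars P \<union> mpoly_vars P'"
    using keys_add[of a b] by (auto simp: mpoly_vars_def)
qed

lemma mpoly_vars_var: "mpoly_vars (mpoly_var v :: ('v, 'c::comm_ring_1) mpolynomial) \<subseteq> {v}"
  unfolding mpoly_var_def by (rule order_trans[OF mpoly_vars_single]) simp

lemma mpoly_vars_sum: "(\<And>i. i \<in> I \<Longrightarrow> mpoly_vars (f i) \<subseteq> V) \<Longrightarrow> mpoly_vars (sum f I) \<subseteq> V"
  by (induction I rule: infinite_finite_induct)
     (auto simp: mpoly_vars_def[of 0] intro!: order_trans[OF mpoly_vars_add])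

definition monomial_eval :: "('v \<Rightarrow> 'a::comm_ring_1) \<Rightarrow> ('v \<Rightarrow>\<^sub>0 nat) \<Rightarrow> 'a" where
  "monomial_eval a m = (\<Prod>v\<in>Poly_Mapping.keys m. a v ^ Poly_Mapping.lookup m v)"

lemma monomial_eval_superset:
  "finite S \<Longrightarrow> Poly_Mapping.keys m \<subseteq> S \<Longrightarrow> monomial_eval a m = (\<Prod>v\<in>S. a v ^ Poly_Mapping.lookup m v)"
  unfolding monomial_eval_def by (rule prod.mono_neutral_left) (auto simp: in_keys_iff)

lemma monomial_eval_add: "monomial_eval a (m + m') = monomial_eval a m * monomial_eval a m'"
proof -
  let ?S = "Poly_Mapping.keys m \<union> Poly_Mapping.keys m'"
  show ?thesis
    using keys_add[of m m']
    by (simp add: monomial_eval_superset[of ?S] lookup_add power_add prod.distrib)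
qed

lemma mpoly_eval_superset:
  assumes "finite S" "Poly_Mapping.keys P \<subseteq> S" "\<phi> 0 = 0"
  shows "mpoly_eval \<phi> a P = (\<Sum>m\<in>S. \<phi> (Poly_Mapping.lookup P m) * monomial_eval a m)"
  unfolding mpoly_eval_def monomial_eval_def
  by (rule sum.mono_neutral_left) (use assms in \<open>auto simp: in_keys_iff\<close>)

lemma mpoly_eval_single: "\<phi> 0 = 0 \<Longrightarrow> mpoly_eval \<phi> a (Poly_Mapping.single m c) = \<phi> c * monomial_eval a m"
  by (subst mpoly_eval_superset[of "{m}"]) auto

lemma mpoly_eval_const: "\<phi> 0 = 0 \<Longrightarrow> mpoly_eval \<phi> a (Poly_Mapping.single 0 c) = \<phi> c"
  by (simp add: mpoly_eval_single monomial_eval_def)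

lemma mpoly_eval_var: "\<phi> 0 = 0 \<Longrightarrow> \<phi> 1 = 1 \<Longrightarrow> mpoly_eval \<phi> a (mpoly_var v) = a v"
  by (simp add: mpoly_var_def mpoly_eval_single monomial_eval_def)

lemma mpoly_eval_add:
  assumes "\<phi> 0 = 0" "\<And>x y. \<phi> (x + y) = \<phi> x + \<phi> y"
  shows "mpoly_eval \<phi> a (P + P') = mpoly_eval \<phi> a P + mpoly_eval \<phi> a P'"
proof -
  let ?S = "Poly_Mapping.keys P \<union> Poly_Mapping.keys P'"
  show ?thesis
    using keys_add[of P P']
    by (simp add: mpoly_eval_superset[of ?S] assms lookup_add sum.distrib algebra_simps)
qed

lemma mpoly_eval_mult:
  fixes \<phi> :: "'c::comm_ring_1 \<Rightarrow> 'a::comm_ring_1"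
  assumes "\<phi> 0 = 0" "\<And>x y. \<phi> (x + y) = \<phi> x + \<phi> y" "\<And>x y. \<phi> (x * y) = \<phi> x * \<phi> y"
  shows "mpoly_eval \<phi> a (P * P') = mpoly_eval \<phi> a P * mpoly_eval \<phi> a P'"
proof (induction P rule: mpoly_induct)
  case (single m c)
  show ?case
    by (induction P' rule: mpoly_induct)
       (simp_all add: mult_single mpoly_eval_single assms monomial_eval_add mpoly_eval_add
           distrib_left algebra_simps)
qed (simp add: mpoly_eval_add assms distrib_right)

lemma mpoly_pderiv_superset:
  assumes "finite S" "Poly_Mapping.keys P \<subseteq> S"
  shows "mpoly_pderiv v P = (\<Sum>m\<in>S. Poly_Mapping.single (m - Poly_Mapping.single v 1)
        (of_nat (Poly_Mapping.lookup m v) * Poly_Mapping.lookup P m))"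
  unfolding mpoly_pderiv_def by (rule sum.mono_neutral_left) (use assms in \<open>auto simp: in_keys_iff\<close>)

lemma mpoly_pderiv_single: "mpoly_pderiv v (Poly_Mapping.single m c) =
    Poly_Mapping.single (m - Poly_Mapping.single v 1) (of_nat (Poly_Mapping.lookup m v) * c)"
  by (subst mpoly_pderiv_superset[of "{m}"]) auto

lemma mpoly_pderiv_add: "mpoly_pderiv v (P + P') = mpoly_pderiv v P + mpoly_pderiv v P'"
proof -
  let ?S = "Poly_Mapping.keys P \<union> Poly_Mapping.keys P'"
  show ?thesis
    using keys_add[of P P']
    by (simp add: mpoly_pderiv_superset[of ?S] lookup_add sum.distrib distrib_left single_add)
qed

lemma mpoly_pderiv_const: "mpoly_pderiv v (Poly_Mapping.single 0 c) = 0"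
  by (simp add: mpoly_pderiv_single)

lemma mpoly_pderiv_var: "mpoly_pderiv v (mpoly_var w) = (if v = w then 1 else 0)"
  by (auto simp: mpoly_var_def mpoly_pderiv_single lookup_single when_def)

lemma mpoly_pderiv_mult: "mpoly_pderiv v (P * P') = mpoly_pderiv v P * P' + P * mpoly_pderiv v P'"
proof -
  have *: "Poly_Mapping.single (m + m' - Poly_Mapping.single v 1) (of_nat (Poly_Mapping.lookup m
      v) * c) =
      Poly_Mapping.single (m - Poly_Mapping.single v 1 + m') (of_nat (Poly_Mapping.lookup m v) *
          (c :: 'b))"
    for m m' :: "'a \<Rightarrow>\<^sub>0 nat" and c
  proof (cases "Poly_Mapping.lookup m v = 0")
    case False
    then have "m + m' - Poly_Mapping.single v 1 = m - Poly_Mapping.single v 1 + m'"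
      by (intro poly_mapping_eqI) (auto simp: lookup_add lookup_minus lookup_single when_def)
    then show ?thesis by simp
  qed simp
  have **: "mpoly_pderiv v (Poly_Mapping.single m c * Poly_Mapping.single m' c') =
      mpoly_pderiv v (Poly_Mapping.single m c) * Poly_Mapping.single m' c' +
      Poly_Mapping.single m c * mpoly_pderiv v (Poly_Mapping.single m' c')" for m m' and c c' :: 'b
    using *[of m m' "c * c'"] *[of m' m "c * c'"]
    by (simp add: mult_single mpoly_pderiv_single lookup_add distrib_right distrib_left single_add
        ac_simps)
  show ?thesis
  proof (induction P rule: mpoly_induct)
    case (single m c)
    show ?case
      by (induction P' rule: mpoly_induct) (simp_all add: ** mpoly_pderiv_add algebra_simps)
  qed (simp add: mpoly_pderiv_add algebra_simps)
qed

lemma mpoly_vars_pderiv: "mpoly_vars (mpoly_pderiv v P) \<subseteq> mpoly_vars P"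
proof -
  have "Poly_Mapping.keys (m - Poly_Mapping.single v 1) \<subseteq> Poly_Mapping.keys m" for m :: "'a \<Rightarrow>\<^sub>0 nat"
    by (auto simp: in_keys_iff lookup_minus)
  then show ?thesis
    unfolding mpoly_pderiv_def
    by (intro mpoly_vars_sum order_trans[OF mpoly_vars_single]) (auto simp: mpoly_vars_def)
qed

section \<open>Exponential polynomials in a fixed number of variables\<close>

lemma exp_polynomials_closed:
  "Poly_Mapping.single 0 c \<in> exp_polynomials N"
  "j < N \<Longrightarrow> mpoly_var (XVar j) \<in> exp_polynomials N"
  "j < N \<Longrightarrow> mpoly_var (EVar j) \<in> exp_polynomials N"
  "f \<in> exp_polynomials N \<Longrightarrow> g \<in> exp_polynomials N \<Longrightarrow> f + g \<in> exp_polynomials N"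
  "f \<in> exp_polynomials N \<Longrightarrow> g \<in> exp_polynomials N \<Longrightarrow> f * g \<in> exp_polynomials N"
  "(\<And>i. i \<in> I \<Longrightarrow> F i \<in> exp_polynomials N) \<Longrightarrow> sum F I \<in> exp_polynomials N"
proof -
  let ?V = "XVar ` {..<N} \<union> EVar ` {..<N}"
  show "Poly_Mapping.single 0 c \<in> exp_polynomials N"
    by (simp add: exp_polynomials_def mpoly_vars_def)
  show "mpoly_var (XVar j) \<in> exp_polynomials N" "mpoly_var (EVar j) \<in> exp_polynomials N" if "j < N"
    unfolding exp_polynomials_def mem_Collect_eq
    by (rule order_trans[OF mpoly_vars_var], use that in simp)+
  show "f + g \<in> exp_polynomials N" "f * g \<in> exp_polynomials N"
    if "f \<in> exp_polynomials N" "g \<in> exp_polynomials N"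
    using that unfolding exp_polynomials_def mem_Collect_eq
    using mpoly_vars_add[of f g] mpoly_vars_mult[of f g] by (meson Un_least order_trans)+
  show "sum F I \<in> exp_polynomials N" if "\<And>i. i \<in> I \<Longrightarrow> F i \<in> exp_polynomials N"
    using that unfolding exp_polynomials_def mem_Collect_eq by (rule mpoly_vars_sum)
qed

lemma exp_polynomials_pderiv:
  "j < N \<Longrightarrow> f \<in> exp_polynomials N \<Longrightarrow> exp_pderiv j f \<in> exp_polynomials N"
  unfolding exp_pderiv_def
  using order_trans[OF mpoly_vars_pderiv, of f]
  by (intro exp_polynomials_closed) (simp_all add: exp_polynomials_def)

lemma exp_polynomials_induct [consumes 1, case_names const XVar EVar add mult]:
  assumes "f \<in> exp_polynomials N" "\<And>c. Q (Poly_Mapping.single 0 c)"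
    "\<And>j. j < N \<Longrightarrow> Q (mpoly_var (XVar j))" "\<And>j. j < N \<Longrightarrow> Q (mpoly_var (EVar j))"
    "\<And>f g. Q f \<Longrightarrow> Q g \<Longrightarrow> Q (f + g)" "\<And>f g. Q f \<Longrightarrow> Q g \<Longrightarrow> Q (f * g)"
  shows "Q f"
  using assms(1) unfolding exp_polynomials_def mem_Collect_eq
  by (induction rule: mpoly_var_induct) (use assms in auto)

lemma exp_pderiv_add: "exp_pderiv j (f + g) = exp_pderiv j f + exp_pderiv j g"
  by (simp add: exp_pderiv_def mpoly_pderiv_add algebra_simps)

lemma exp_pderiv_mult: "exp_pderiv j (f * g) = exp_pderiv j f * g + f * exp_pderiv j g"
  by (simp add: exp_pderiv_def mpoly_pderiv_mult algebra_simps)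

lemma exp_pderiv_const: "exp_pderiv j (Poly_Mapping.single 0 c) = 0"
  by (simp add: exp_pderiv_def mpoly_pderiv_const)

lemma exp_pderiv_var:
  "exp_pderiv j (mpoly_var (XVar i)) = (if i = j then 1 else 0)"
  "exp_pderiv j (mpoly_var (EVar i)) = (if i = j then mpoly_var (EVar i) else 0)"
  by (auto simp: exp_pderiv_def mpoly_pderiv_var)

context exponential_field
begin

lemma exp_eval_add: "exp_eval x (f + g) = exp_eval x f + exp_eval x g"
  by (simp add: exp_eval_def mpoly_eval_add)

lemma exp_eval_mult: "exp_eval x (f * g) = exp_eval x f * exp_eval x g"
  by (simp add: exp_eval_def mpoly_eval_mult)

lemma exp_eval_const: "exp_eval x (Poly_Mapping.single 0 c) = of_int c"
  by (simp add: exp_eval_def mpoly_eval_const)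

lemma exp_eval_0: "exp_eval x 0 = 0"
  using exp_eval_const[of x 0] by simp

lemma exp_eval_1: "exp_eval x 1 = 1"
  using exp_eval_const[of x 1] by simp

lemma exp_eval_var:
  "exp_eval x (mpoly_var (XVar j)) = x j" "exp_eval x (mpoly_var (EVar j)) = E (x j)"
  by (simp_all add: exp_eval_def mpoly_eval_var)

lemma exp_eval_sum: "exp_eval x (sum F I) = (\<Sum>i\<in>I. exp_eval x (F i))"
  by (induction I rule: infinite_finite_induct) (auto simp: exp_eval_0 exp_eval_add)

lemmas exp_eval_simps = exp_eval_add exp_eval_mult exp_eval_const exp_eval_0 exp_eval_1
    exp_eval_var exp_eval_sum

end

section \<open>Extension of derivations\<close>

text \<open>A partial derivation is represented by its graph: a subring of the dual numbers
  \<open>a + b\<epsilon>\<close> meeting the ideal generated by \<open>\<epsilon>\<close> only in \<open>0\<close>.\<close>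
definition derivation_graph :: "('a::idom \<times> 'a) set \<Rightarrow> bool" where
  "derivation_graph G \<longleftrightarrow> (0, 0) \<in> G \<and> (1, 0) \<in> G \<and>
     (\<forall>a a' b b'. (a, a') \<in> G \<longrightarrow> (b, b') \<in> G \<longrightarrow>
        (a + b, a' + b') \<in> G \<and> (a * b, a * b' + b * a') \<in> G) \<and>
     (\<forall>a a'. (a, a') \<in> G \<longrightarrow> (- a, - a') \<in> G) \<and> (\<forall>b. (0, b) \<in> G \<longrightarrow> b = 0)"

context
  fixes G :: "('a::field_char_0 \<times> 'a) set"
  assumes G: "derivation_graph G"
begin

lemma graph_closed:
  "(0, 0) \<in> G" "(1, 0) \<in> G"
  "(a, a') \<in> G \<Longrightarrow> (b, b') \<in> G \<Longrightarrow> (a + b, a' + b') \<in> G"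
  "(a, a') \<in> G \<Longrightarrow> (b, b') \<in> G \<Longrightarrow> (a * b, a * b' + b * a') \<in> G"
  "(a, a') \<in> G \<Longrightarrow> (- a, - a') \<in> G"
  "(a, a') \<in> G \<Longrightarrow> (b, b') \<in> G \<Longrightarrow> (a - b, a' - b') \<in> G"
  "(0, b) \<in> G \<Longrightarrow> b = 0"
proof -
  show *: "(0, 0) \<in> G" "(1, 0) \<in> G" "(a, a') \<in> G \<Longrightarrow> (b, b') \<in> G \<Longrightarrow> (a + b, a' + b') \<in> G"
   "(a, a') \<in> G \<Longrightarrow> (b, b') \<in> G \<Longrightarrow> (a * b, a * b' + b * a') \<in> G"
   "(a, a') \<in> G \<Longrightarrow> (- a, - a') \<in> G" "(0, b) \<in> G \<Longrightarrow> b = 0" for a a' b b'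
    using G unfolding derivation_graph_def by fast+
  show "(a - b, a' - b') \<in> G" if "(a, a') \<in> G" "(b, b') \<in> G"
    using *(3)[OF that(1) *(5)[OF that(2)]] by simp
qed

lemma graph_sum: "(\<And>i. i \<in> I \<Longrightarrow> (f i, g i) \<in> G) \<Longrightarrow> (sum f I, sum g I) \<in> G"
  by (induction I rule: infinite_finite_induct) (auto simp: graph_closed)

lemma graph_of_nat: "(of_nat n, 0) \<in> G"
  by (induction n) (use graph_closed(1) graph_closed(3)[OF graph_closed(2)] in auto)

text \<open>A pair consists of a polynomial and the polynomial obtained by differentiating its
  coefficients. Since \<open>(0, b)\<close> lies in \<open>G\<close> only for \<open>b = 0\<close>,
  the first component determines the second.\<close>

definition graph_polys :: "('a poly \<times> 'a poly) set" where
  "graph_polys = {(P, Q). \<forall>i. (coeff P i, coeff Q i) \<in> G}"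

lemma graph_polys_const: "(a, a') \<in> G \<Longrightarrow> ([:a:], [:a':]) \<in> graph_polys"
  by (auto simp: graph_polys_def coeff_pCons graph_closed split: nat.splits)

lemma graph_polys_monom: "(a, a') \<in> G \<Longrightarrow> (monom a k, monom a' k) \<in> graph_polys"
  by (auto simp: graph_polys_def graph_closed)

lemma graph_polys_add: "(P, Q) \<in> graph_polys \<Longrightarrow> (R, S) \<in> graph_polys \<Longrightarrow> (P + R, Q + S) \<in> graph_polys"
  by (auto simp: graph_polys_def graph_closed)

lemma graph_polys_minus: "(P, Q) \<in> graph_polys \<Longrightarrow> (- P, - Q) \<in> graph_polys"
  by (auto simp: graph_polys_def graph_closed)

lemma graph_polys_mult:
  assumes "(P, Q) \<in> graph_polys" "(R, S) \<in> graph_polys"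
  shows "(P * R, P * S + R * Q) \<in> graph_polys"
proof -
  have "(\<Sum>i\<le>n. coeff R i * coeff Q (n - i)) = (\<Sum>i\<le>n. coeff R (n - i) * coeff Q i)" for n
    by (rule sum.reindex_bij_witness[of _ "\<lambda>i. n - i" "\<lambda>i. n - i"]) auto
  then show ?thesis
    using assms unfolding graph_polys_def
    by (auto simp: coeff_mult simp flip: sum.distrib intro!: graph_sum graph_closed)
qed

lemma graph_polys_pderiv: "(P, Q) \<in> graph_polys \<Longrightarrow> (pderiv P, pderiv Q) \<in> graph_polys"
  using graph_closed(4)[OF graph_of_nat]
  by (fastforce simp: graph_polys_def coeff_pderiv simp del: of_nat_Suc)

text \<open>The second component is the value that the chain rule forces at \<open>poly P z\<close>
  once \<open>z\<close> is sent to \<open>w\<close>.\<close>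

definition adjoin_graph :: "'a \<Rightarrow> 'a \<Rightarrow> ('a \<times> 'a) set" where
  "adjoin_graph z w = (\<lambda>(P, Q). (poly P z, poly Q z + poly (pderiv P) z * w)) ` graph_polys"

lemma subset_adjoin_graph: "insert (z, w) G \<subseteq> adjoin_graph z w"
proof -
  have "(a, a') \<in> adjoin_graph z w" if "(a, a') \<in> G" for a a'
    using graph_polys_const[OF that] by (force simp: adjoin_graph_def pderiv_pCons)
  moreover have "(z, w) \<in> adjoin_graph z w"
    using graph_polys_monom[OF graph_closed(2), of 1]
    by (force simp: adjoin_graph_def pderiv_monom poly_monom)
  ultimately show ?thesis by auto
qed

text \<open>The ring operations are respected by the product rule for pairs. The only obstruction is
  that one element might receive two values, and by subtraction this reduces to representations of
  0.\<close>

lemma derivation_graph_adjoin: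
  assumes "\<And>P Q. (P, Q) \<in> graph_polys \<Longrightarrow> poly P z = 0 \<Longrightarrow> poly Q z + poly (pderiv P) z * w = 0"
  shows "derivation_graph (adjoin_graph z w)"
proof -
  have I: "(poly P z, poly Q z + poly (pderiv P) z * w) \<in> adjoin_graph z w" if "(P, Q) \<in>
      graph_polys" for P Q
    using that by (force simp: adjoin_graph_def)
  have "\<exists>P Q. (P, Q) \<in> graph_polys \<and> a = poly P z \<and> a' = poly Q z + poly (pderiv P) z * w"
    if "(a, a') \<in> adjoin_graph z w" for a a' using that by (auto simp: adjoin_graph_def)
  note E = this
  have "(a + b, a' + b') \<in> adjoin_graph z w \<and> (a * b, a * b' + b * a') \<in> adjoin_graph z w"
    if ab: "(a, a') \<in> adjoin_graph z w" "(b, b') \<in> adjoin_graph z w" for a a' b b'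
  proof -
    obtain P Q R S where *: "(P, Q) \<in> graph_polys" "a = poly P z" "a' = poly Q z + poly (pderiv P)
        z * w"
      "(R, S) \<in> graph_polys" "b = poly R z" "b' = poly S z + poly (pderiv R) z * w"
      using E[OF ab(1)] E[OF ab(2)] by blast
    then show ?thesis
      using I[OF graph_polys_add[OF *(1,4)]] I[OF graph_polys_mult[OF *(1,4)]]
      by (simp add: pderiv_add pderiv_mult algebra_simps)
  qed
  moreover have "(- a, - a') \<in> adjoin_graph z w" if a: "(a, a') \<in> adjoin_graph z w" for a a'
    using E[OF a] I[OF graph_polys_minus] by (force simp: pderiv_minus algebra_simps)
  moreover have "b = 0" if "(0, b) \<in> adjoin_graph z w" for b
    using E[OF that] assms by metis
  ultimately show ?thesis
    using subset_adjoin_graph[of z w] graph_closed(1,2) unfolding derivation_graph_def by (intro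
        conjI allI impI) auto
qed

text \<open>If \<open>z\<close> satisfies no equation over the domain of \<open>G\<close>, its value
  is free and 0 is taken. Otherwise an equation of least degree determines the value, and every
  other equation is compatible with it because it can be reduced by the least one.\<close>

lemma exists_adjoin: "\<exists>w. derivation_graph (adjoin_graph z w)"
proof (cases "\<exists>P Q. (P, Q) \<in> graph_polys \<and> P \<noteq> 0 \<and> poly P z = 0")
  case False
  have "derivation_graph (adjoin_graph z 0)"
  proof (rule derivation_graph_adjoin)
    fix P Q assume PQ: "(P, Q) \<in> graph_polys" "poly P z = 0"
    then have "P = 0" using False by blast
    then have "Q = 0"
      using PQ(1) graph_closed(7) by (auto simp: graph_polys_def intro: poly_eqI)
    then show "poly Q z + poly (pderiv P) z * 0 = 0" by simp
  qed
  then show ?thesis by blast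
next
  case True
  define d where "d = (LEAST d. \<exists>P Q. (P, Q) \<in> graph_polys \<and> P \<noteq> 0 \<and> poly P z = 0 \<and> degree P = d)"
  have "\<exists>d P Q. (P, Q) \<in> graph_polys \<and> P \<noteq> 0 \<and> poly P z = 0 \<and> degree P = d" using True by blast
  from LeastI_ex[OF this] obtain P0 Q0 where P0: "(P0, Q0) \<in> graph_polys" "P0 \<noteq> 0" "poly P0 z = 0"
      "degree P0 = d"
    unfolding d_def by blast
  have min: "d \<le> degree P" if "(P, Q) \<in> graph_polys" "P \<noteq> 0" "poly P z = 0" for P Q
    unfolding d_def by (rule Least_le) (use that in blast)
  have d: "d > 0"
  proof (rule ccontr)
    assume "\<not> d > 0"
    then obtain a where "P0 = [:a:]" using P0(4) by (auto elim: degree_eq_zeroE)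
    then show False using P0(2,3) by simp
  qed
  \<comment> \<open>In characteristic zero the derivative is a nonzero polynomial of smaller degree,
    so minimality forbids that it vanish at \<open>z\<close>.\<close>
  have nz: "poly (pderiv P0) z \<noteq> 0"
    using min[OF graph_polys_pderiv[OF P0(1)]] d P0(4) by (auto simp: pderiv_eq_0_iff degree_pderiv)
  define w where "w = - poly Q0 z / poly (pderiv P0) z"
  have w: "poly Q0 z + poly (pderiv P0) z * w = 0" using nz by (simp add: w_def)
  have "derivation_graph (adjoin_graph z w)"
  proof (rule derivation_graph_adjoin)
    fix P Q assume "(P, Q) \<in> graph_polys" "poly P z = 0"
    then show "poly Q z + poly (pderiv P) z * w = 0"
    proof (induction "degree P" arbitrary: P Q rule: less_induct)
      case less
      show ?case
      proof (cases "P = 0")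
        case True
        then have "Q = 0"
          using less.prems(1) graph_closed(7) by (auto simp: graph_polys_def intro: poly_eqI)
        with True show ?thesis by simp
      next
        case False
        note dP = min[OF less.prems(1) False less.prems(2)]
        define k where "k = degree P - d"
        define a a' b b' where "a = lead_coeff P0" and "a' = coeff Q0 d"
          and "b = lead_coeff P" and "b' = coeff Q (degree P)"
        have G': "(a, a') \<in> G" "(b, b') \<in> G"
          using P0 less.prems(1) by (auto simp: graph_polys_def a_def a'_def b_def b'_def)
        \<comment> \<open>Pseudo-division: the domain of \<open>G\<close> is only a ring, so
          \<open>P\<close> is multiplied by the leading coefficient \<open>a\<close> of
          \<open>P0\<close> before a multiple of \<open>P0\<close> is subtracted. \<open>Q1\<close>
          is the companion of \<open>P1\<close> given by the product rule.\<close>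
        define P1 Q1 where "P1 = [:a:] * P + - (monom b k * P0)"
          and "Q1 = ([:a:] * Q + P * [:a':]) + - (monom b k * Q0 + P0 * monom b' k)"
        have 1: "(P1, Q1) \<in> graph_polys" unfolding P1_def Q1_def
          by (intro graph_polys_add graph_polys_mult graph_polys_minus graph_polys_const
              graph_polys_monom G' P0 less.prems)
        have 2: "poly P1 z = 0" using less.prems(2) P0(3) by (simp add: P1_def)
        have 3: "poly Q1 z + poly (pderiv P1) z * w = a * (poly Q z + poly (pderiv P) z * w)"
        proof -
          have "poly Q1 z + poly (pderiv P1) z * w =
             a * (poly Q z + poly (pderiv P) z * w) - poly (monom b k) z * (poly Q0 z + poly
                 (pderiv P0) z * w)
              + poly P z * (a') - poly P0 z * (poly (monom b' k) z + poly (pderiv (monom b k)) z * w)"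
            unfolding P1_def Q1_def by (simp add: pderiv_add pderiv_diff pderiv_minus pderiv_mult
                pderiv_smult algebra_simps)
          then show ?thesis using less.prems(2) P0(3) w by simp
        qed
        have a: "a \<noteq> 0" using P0(2) by (simp add: a_def)
        have "P1 = 0 \<or> degree P1 < degree P"
        proof -
          have "degree P1 \<le> degree P"
          proof -
            have "degree (monom b k * P0) \<le> k + d"
              using degree_mult_le[of "monom b k" P0] degree_monom_le[of b k] P0(4) by linarith
            then show ?thesis
              using dP unfolding P1_def k_def by (intro degree_add_le) (auto simp: degree_smult_le)
          qed
          moreover have "coeff P1 (degree P) = 0"
            using dP P0(4) by (simp add: P1_def coeff_monom_mult k_def a_def b_def)
          ultimately show ?thesis
            by (metis le_neq_implies_less leading_coeff_0_iff)
        qed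
        then have "poly Q1 z + poly (pderiv P1) z * w = 0"
        proof
          assume "P1 = 0"
          then have "Q1 = 0"
            using 1 graph_closed(7) by (auto simp: graph_polys_def intro: poly_eqI)
          with \<open>P1 = 0\<close> show ?thesis by simp
        qed (use less.hyps 1 2 in blast)
        then show ?thesis using 3 a by simp
      qed
    qed
  qed
  then show ?thesis by blast
qed

end

lemma derivation_graph_Union:
  fixes \<C> :: "('a::field_char_0 \<times> 'a) set set"
  assumes "subset.chain {G. derivation_graph G} \<C>" "\<C> \<noteq> {}"
  shows "derivation_graph (\<Union>\<C>)"
proof -
  have G: "derivation_graph G" if "G \<in> \<C>" for G using assms that by (auto simp: subset_chain_def)
  have both: "\<exists>G\<in>\<C>. x \<in> G \<and> y \<in> G" if xy: "x \<in> \<Union>\<C>" "y \<in> \<Union>\<C>" for x y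
  proof -
    obtain X Y where "X \<in> \<C>" "x \<in> X" "Y \<in> \<C>" "y \<in> Y" using xy by blast
    moreover from this have "X \<subseteq> Y \<or> Y \<subseteq> X" using assms(1) by (simp add: subset_chain_def)
    ultimately show ?thesis by blast
  qed
  have "(a + b, a' + b') \<in> \<Union>\<C> \<and> (a * b, a * b' + b * a') \<in> \<Union>\<C>"
    if ab: "(a, a') \<in> \<Union>\<C>" "(b, b') \<in> \<Union>\<C>" for a b a' b'
  proof -
    obtain X where "X \<in> \<C>" "(a, a') \<in> X" "(b, b') \<in> X" using both[OF ab] by blast
    then show ?thesis using graph_closed(3,4)[OF G] by (meson UnionI)
  qed
  moreover have "(- a, - a') \<in> \<Union>\<C>" if "(a, a') \<in> \<Union>\<C>" for a a'
    using that graph_closed(5)[OF G] by (meson UnionE UnionI)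
  moreover have "(0, 0) \<in> \<Union>\<C>" "(1, 0) \<in> \<Union>\<C>"
    using assms(2) graph_closed(1,2)[OF G] by blast+
  moreover have "b = 0" if "(0, b) \<in> \<Union>\<C>" for b
    using that graph_closed(7)[OF G] by (meson UnionE)
  ultimately show ?thesis unfolding derivation_graph_def by (intro conjI allI impI) simp_all
qed

text \<open>Formal differentiation on \<open>K[t]\<close> is well defined because \<open>t\<close>
  is transcendental. A maximal partial derivation above it, given by Zorn's lemma, is defined
  everywhere, since \<open>exists_adjoin\<close> would enlarge it otherwise.\<close>

theorem exists_derivation:
  fixes K :: "'a::field_char_0 set"
  assumes K: "is_subring K" and t: "transcendental_over K t"
  shows "\<exists>D\<in>derivations_over K. D t = 1"
proof -
  define G0 where "G0 = (\<lambda>P. (poly P t, poly (pderiv P) t)) ` poly_over K"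
  note PK = subring_closed[OF is_subring_poly_over[OF K]]
  have I: "(poly P t, poly (pderiv P) t) \<in> G0" if "P \<in> poly_over K" for P using that by (auto
      simp: G0_def)
  have E: "\<exists>P\<in>poly_over K. a = poly P t \<and> a' = poly (pderiv P) t" if "(a, a') \<in> G0" for a a'
    using that by (auto simp: G0_def)
  have G0: "derivation_graph G0"
  proof -
    have "(a + b, a' + b') \<in> G0 \<and> (a * b, a * b' + b * a') \<in> G0"
      if ab: "(a, a') \<in> G0" "(b, b') \<in> G0" for a a' b b'
    proof -
      obtain P R where "P \<in> poly_over K" "a = poly P t" "a' = poly (pderiv P) t"
        "R \<in> poly_over K" "b = poly R t" "b' = poly (pderiv R) t"
        using E[OF ab(1)] E[OF ab(2)] by blast
      then show ?thesis using I[of "P + R"] I[of "P * R"] PK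
        by (simp add: pderiv_add pderiv_mult)
    qed
    moreover have "(- a, - a') \<in> G0" if "(a, a') \<in> G0" for a a'
      using E[OF that] I PK(5) by (force simp: pderiv_minus)
    moreover have "b = 0" if "(0, b) \<in> G0" for b
      using E[OF that] t by (auto simp: transcendental_over_def)
    ultimately show ?thesis using I[OF PK(1)] I[OF PK(2)] unfolding derivation_graph_def by (intro
        conjI allI impI) auto
  qed
  have "\<exists>M\<in>{G. derivation_graph G \<and> G0 \<subseteq> G}. \<forall>X\<in>{G. derivation_graph G \<and> G0 \<subseteq> G}. M \<subseteq> X \<longrightarrow> X = M"
  proof (rule subset_Zorn_nonempty)
    show "{G. derivation_graph G \<and> G0 \<subseteq> G} \<noteq> {}" using G0 by blast
    fix \<C> assume "\<C> \<noteq> {}" and C: "subset.chain {G. derivation_graph G \<and> G0 \<subseteq> G} \<C>"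
    have "derivation_graph (\<Union>\<C>)"
      using C by (intro derivation_graph_Union \<open>\<C> \<noteq> {}\<close>) (auto simp: subset_chain_def)
    moreover have "G0 \<subseteq> \<Union>\<C>" using C \<open>\<C> \<noteq> {}\<close> unfolding subset_chain_def by fast
    ultimately show "\<Union>\<C> \<in> {G. derivation_graph G \<and> G0 \<subseteq> G}" by simp
  qed
  then obtain M where M: "derivation_graph M" "G0 \<subseteq> M"
    and M': "\<forall>X\<in>{G. derivation_graph G \<and> G0 \<subseteq> G}. M \<subseteq> X \<longrightarrow> X = M" by blast
  then have max: "X = M" if "derivation_graph X" "M \<subseteq> X" for X
    using that by blast
  have total: "\<exists>w. (z, w) \<in> M" for z
  proof -
    obtain w where "derivation_graph (adjoin_graph M z w)" using exists_adjoin[OF M(1)] by blast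
    then show ?thesis using max[of "adjoin_graph M z w"] subset_adjoin_graph[OF M(1), of z w] by auto
  qed
  define D where "D z = (SOME w. (z, w) \<in> M)" for z
  have D: "(z, D z) \<in> M" for z unfolding D_def by (rule someI_ex[OF total])
  have unique: "D z = w" if "(z, w) \<in> M" for z w
    using graph_closed(7)[OF M(1)] graph_closed(6)[OF M(1) D[of z] that] by force
  have "derivation D"
    unfolding derivation_def
    using unique graph_closed(3,4)[OF M(1) D D] by (auto simp: algebra_simps)
  moreover have "D c = 0" if "c \<in> K" for c
    using I[OF poly_over_const[OF subring_closed(1)[OF K] that]] M(2) by (intro unique) (auto
        simp: pderiv_pCons)
  moreover have "D t = 1"
    using I[OF poly_over_pCons[OF subring_closed(1)[OF K] poly_over_const[OF
        subring_closed(1,2)[OF K]]]] M(2)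
    by (intro unique) (auto simp: pderiv_pCons)
  ultimately show ?thesis by (auto simp: derivations_over_def)
qed

section \<open>Flows of exponential-polynomial vector fields\<close>

text \<open>\<open>d\<close> bounds the degree and \<open>c\<close> the sum of the absolute values of the coefficients.\<close>
inductive poly_bound :: "nat \<Rightarrow> nat \<Rightarrow> real \<Rightarrow> exp_polynomial \<Rightarrow> bool" for N where
  const: "poly_bound N 0 \<bar>of_int c\<bar> (Poly_Mapping.single 0 c)"
| XVar: "j < N \<Longrightarrow> poly_bound N 1 1 (mpoly_var (XVar j))"
| EVar: "j < N \<Longrightarrow> poly_bound N 1 1 (mpoly_var (EVar j))"
| add: "poly_bound N d c f \<Longrightarrow> poly_bound N d c' g \<Longrightarrow> poly_bound N d (c + c') (f + g)"
| mult: "poly_bound N d c f \<Longrightarrow> poly_bound N d' c' g \<Longrightarrow> poly_bound N (d + d') (c * c') (f * g)"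
| mono: "poly_bound N d c f \<Longrightarrow> d \<le> d' \<Longrightarrow> c \<le> c' \<Longrightarrow> poly_bound N d' c' f"

lemma poly_bound_nonneg: "poly_bound N d c f \<Longrightarrow> 0 \<le> c"
  by (induction rule: poly_bound.induct) auto

lemma exists_poly_bound:
  assumes "f \<in> exp_polynomials N" shows "\<exists>d c. poly_bound N d c f"
  using assms
proof (induction rule: exp_polynomials_induct)
  case (add f g)
  then obtain d c d' c' where "poly_bound N d c f" "poly_bound N d' c' g" by blast
  then have "poly_bound N (max d d') c f" "poly_bound N (max d d') c' g"
    by (auto intro: poly_bound.mono)
  then show ?case using poly_bound.add by blast
next
  case (mult f g)
  then show ?case by (elim exE) (rule exI, rule exI, rule poly_bound.mult)
qed (rule exI, rule exI, rule poly_bound.const poly_bound.XVar poly_bound.EVar, assumption?)+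

lemma poly_bound_eval:
  assumes "poly_bound N d c f" "1 \<le> R" "\<And>j. j < N \<Longrightarrow> \<bar>x j\<bar> \<le> R" "\<And>j. j < N \<Longrightarrow> exp (x j) \<le> R"
  shows "\<bar>real_exp.exp_eval x f\<bar> \<le> c * R ^ d"
  using assms(1)
proof (induction rule: poly_bound.induct)
  case (add d c f c' g)
  then show ?case by (simp add: real_exp.exp_eval_add distrib_right)
next
  case (mult d c f d' c' g)
  then have "\<bar>real_exp.exp_eval x f\<bar> * \<bar>real_exp.exp_eval x g\<bar> \<le> (c * R ^ d) * (c' * R ^ d')"
    using assms(2) by (intro mult_mono) (auto simp: poly_bound_nonneg)
  then show ?case by (simp add: real_exp.exp_eval_mult abs_mult power_add mult_ac)
next
  case (mono d c f d' c')
  then have "c * R ^ d \<le> c' * R ^ d'"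
    using assms(2) poly_bound_nonneg[OF mono(1)] by (intro mult_mono power_increasing) auto
  then show ?case using mono by linarith
qed (use assms in \<open>auto simp: real_exp.exp_eval_simps\<close>)

definition vector_field :: "nat \<Rightarrow> (nat \<Rightarrow> exp_polynomial) \<Rightarrow> exp_polynomial \<Rightarrow> exp_polynomial" where
  "vector_field N g f = (\<Sum>j<N. g j * exp_pderiv j f)"

lemma vector_field_add: "vector_field N g (f + h) = vector_field N g f + vector_field N g h"
  by (simp add: vector_field_def exp_pderiv_add distrib_left sum.distrib)

lemma vector_field_mult: "vector_field N g (f * h) = vector_field N g f * h + f * vector_field N g h"
  by (simp add: vector_field_def exp_pderiv_mult algebra_simps sum.distrib sum_distrib_left
      sum_distrib_right)

lemma vector_field_const: "vector_field N g (Poly_Mapping.single 0 c) = 0"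
  by (simp add: vector_field_def exp_pderiv_const)

lemma vector_field_var:
  assumes "j < N"
  shows "vector_field N g (mpoly_var (XVar j)) = g j"
    "vector_field N g (mpoly_var (EVar j)) = g j * mpoly_var (EVar j)"
  using assms unfolding vector_field_def exp_pderiv_var
  by (simp_all add: if_distrib[of "\<lambda>t. _ * t"] sum.delta cong: if_cong)

text \<open>By the product rule a term of degree \<open>d\<close> yields \<open>d\<close> terms,
  each with one variable replaced by its image under the field; hence the factor
  \<open>d * G\<close> and the increase of the degree by \<open>e\<close>.\<close>

lemma poly_bound_vector_field:
  assumes "\<And>j. j < N \<Longrightarrow> poly_bound N e G (vector_field N g (mpoly_var (XVar j)))"
    and "\<And>j. j < N \<Longrightarrow> poly_bound N e G (vector_field N g (mpoly_var (EVar j)))"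
    and "0 \<le> G" "poly_bound N d c f"
  shows "poly_bound N (d + e) (real d * G * c) (vector_field N g f)"
  using assms(4)
proof (induction rule: poly_bound.induct)
  case (const c)
  have "poly_bound N (0 + e) 0 (Poly_Mapping.single 0 0)"
    by (rule poly_bound.mono[OF poly_bound.const]) auto
  then show ?case by (simp add: vector_field_const)
next
  case (XVar j)
  show ?case by (rule poly_bound.mono[OF assms(1)[OF XVar]]) auto
next
  case (EVar j)
  show ?case by (rule poly_bound.mono[OF assms(2)[OF EVar]]) auto
next
  case (add d c f c' h)
  show ?case
    using poly_bound.add[OF add.IH] by (simp add: vector_field_add distrib_left)
next
  case (mult d c f d' c' h)
  have "poly_bound N (d + d' + e) (real d * G * c * c') (vector_field N g f * h)"
    using poly_bound.mult[OF mult.IH(1) mult.hyps(2)] by (simp add: ac_simps)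
  moreover have "poly_bound N (d + d' + e) (c * (real d' * G * c')) (f * vector_field N g h)"
    using poly_bound.mult[OF mult.hyps(1) mult.IH(2)] by (simp add: ac_simps)
  ultimately show ?case
    using poly_bound.add by (fastforce simp: vector_field_mult algebra_simps)
next
  case (mono d c f d' c')
  have "real d * G * c \<le> real d' * G * c'"
    using mono.hyps assms(3) poly_bound_nonneg[OF mono.hyps(1)] by (intro mult_mono) auto
  then show ?case using mono.hyps by (intro poly_bound.mono[OF mono.IH]) auto
qed

text \<open>After \<open>n\<close> steps the degree bound is at most
  \<open>(n + 1) * (d + e)\<close>, so the next step costs a factor proportional to
  \<open>n + 1\<close>. These factors multiply to the factorial that the denominator of a Taylor
  coefficient cancels.\<close>

lemma poly_bound_vector_field_iterate:
  assumes "\<And>j. j < N \<Longrightarrow> poly_bound N e G (vector_field N g (mpoly_var (XVar j)))"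
    and "\<And>j. j < N \<Longrightarrow> poly_bound N e G (vector_field N g (mpoly_var (EVar j)))"
    and "0 \<le> G" "poly_bound N d c f"
  shows "poly_bound N (d + n * e) (c * (G * real (d + e)) ^ n * fact n) ((vector_field N g ^^ n) f)"
proof (induction n)
  case (Suc n)
  let ?c = "c * (G * real (d + e)) ^ n * fact n"
  have c: "0 \<le> c" using assms(4) by (rule poly_bound_nonneg)
  have "d + n * e \<le> Suc n * (d + e)" by (simp add: distrib_left)
  then have "real (d + n * e) \<le> real (Suc n) * real (d + e)"
    by (metis of_nat_le_iff of_nat_mult)
  then have "real (d + n * e) * (G * ?c) \<le> (real (Suc n) * real (d + e)) * (G * ?c)"
    using c assms(3) by (intro mult_right_mono) auto
  then have "real (d + n * e) * G * ?c \<le> c * (G * real (d + e)) ^ Suc n * fact (Suc n)"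
    by (simp add: mult_ac)
  then show ?case
    using poly_bound.mono[OF poly_bound_vector_field[OF assms(1-3) Suc], of "d + Suc n * e"]
    by (simp add: ac_simps)
qed (use assms in simp)

context
  fixes N :: nat and g :: "nat \<Rightarrow> exp_polynomial" and x :: "nat \<Rightarrow> real"
  assumes g: "\<And>j. j < N \<Longrightarrow> g j \<in> exp_polynomials N"
begin

abbreviation \<xi> where "\<xi> \<equiv> vector_field N g"
abbreviation ev where "ev \<equiv> real_exp.exp_eval"

lemma vector_field_in: "f \<in> exp_polynomials N \<Longrightarrow> \<xi> f \<in> exp_polynomials N"
  unfolding vector_field_def by (intro exp_polynomials_closed exp_polynomials_pderiv g) auto

text \<open>The Taylor coefficients at \<open>0\<close> of \<open>f\<close> along the integral curve of \<open>\<xi>\<close> through \<open>x\<close>.\<close>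
definition flow_coeff :: "exp_polynomial \<Rightarrow> nat \<Rightarrow> real" where
  "flow_coeff f n = ev x ((\<xi> ^^ n) f) / fact n"

lemma flow_coeff_vector_field: "flow_coeff (\<xi> f) n = real (Suc n) * flow_coeff f (Suc n)"
  by (simp add: flow_coeff_def funpow_swap1 del: of_nat_Suc)

lemma flow_coeff_add: "flow_coeff (f + h) n = flow_coeff f n + flow_coeff h n"
proof -
  have "(\<xi> ^^ n) (f + h) = (\<xi> ^^ n) f + (\<xi> ^^ n) h"
    by (induction n) (auto simp: vector_field_add)
  then show ?thesis by (simp add: flow_coeff_def real_exp.exp_eval_add add_divide_distrib)
qed

text \<open>The field acts as a derivation, so formal Taylor series along it are multiplicative:
  both sides obey the same product rule, and the induction on the index runs with \<open>f\<close>
  and \<open>h\<close> arbitrary.\<close>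

lemma flow_coeff_mult: "flow_coeff (f * h) n = (\<Sum>i\<le>n. flow_coeff f i * flow_coeff h (n - i))"
proof -
  let ?F = "\<lambda>f. Abs_fps (flow_coeff f)"
  have deriv: "fps_deriv (?F f) = ?F (\<xi> f)" for f
    by (rule fps_ext) (simp add: flow_coeff_vector_field)
  have "fps_nth (?F (f * h)) n = fps_nth (?F f * ?F h) n"
  proof (induction n arbitrary: f h)
    case 0
    show ?case by (simp add: flow_coeff_def real_exp.exp_eval_mult)
  next
    case (Suc n)
    have "real (Suc n) * fps_nth (?F (f * h)) (Suc n) = fps_nth (?F (\<xi> f * h + f * \<xi> h)) n"
      by (simp flip: vector_field_mult flow_coeff_vector_field del: of_nat_Suc)
    also have "\<dots> = fps_nth (?F (\<xi> f * h)) n + fps_nth (?F (f * \<xi> h)) n"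
      by (simp add: flow_coeff_add)
    also have "\<dots> = fps_nth (?F (\<xi> f) * ?F h + ?F f * ?F (\<xi> h)) n"
      by (simp only: Suc.IH fps_add_nth)
    also have "\<dots> = fps_nth (fps_deriv (?F f * ?F h)) n"
      by (simp only: fps_deriv_mult deriv add.commute)
    also have "\<dots> = real (Suc n) * fps_nth (?F f * ?F h) (Suc n)"
      by (simp only: fps_deriv_nth Suc_eq_plus1)
    finally show ?case by simp
  qed
  then show ?thesis by (simp add: fps_mult_nth atLeast0AtMost)
qed

text \<open>Estimating \<open>f\<close> directly would give a radius that shrinks with its degree.
  Only the variables are estimated; sums and Cauchy products of series that converge absolutely at
  \<open>r\<close> do so at the same \<open>r\<close>, and one radius serves all
  \<open>f\<close>.\<close>

lemma exists_flow_radius: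
  "\<exists>r>0. \<forall>f\<in>exp_polynomials N. summable (\<lambda>n. \<bar>flow_coeff f n\<bar> * r ^ n)"
proof -
  define V where "V = (\<lambda>j. mpoly_var (XVar j)) ` {..<N} \<union> (\<lambda>j. mpoly_var (EVar j) ::
      exp_polynomial) ` {..<N}"
  have V: "f \<in> exp_polynomials N" if "f \<in> V" for f
    using that by (auto simp: V_def exp_polynomials_closed)
  have "\<forall>f\<in>V. \<exists>d c. poly_bound N d c (\<xi> f)" using exists_poly_bound vector_field_in V by blast
  then obtain d c where dc: "\<And>f. f \<in> V \<Longrightarrow> poly_bound N (d f) (c f) (\<xi> f)" by metis
  define e G where "e = Max (insert 0 (d ` V))" and "G = Max (insert 0 (c ` V))"
  have fin: "finite V" by (simp add: V_def)
  have eG: "poly_bound N e G (\<xi> f)" if "f \<in> V" for f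
    by (rule poly_bound.mono[OF dc[OF that]]) (use fin that in \<open>auto simp: e_def G_def\<close>)
  have "0 \<le> G" using fin by (simp add: G_def)
  define R where "R = Max (insert 1 ((\<lambda>j. max \<bar>x j\<bar> (exp (x j))) ` {..<N}))"
  have R: "1 \<le> R" by (simp add: R_def)
  have RX: "\<bar>x j\<bar> \<le> R" "exp (x j) \<le> R" if "j < N" for j
  proof -
    have "max \<bar>x j\<bar> (exp (x j)) \<le> R" unfolding R_def by (rule Max_ge) (use that in auto)
    then show "\<bar>x j\<bar> \<le> R" "exp (x j) \<le> R" by auto
  qed
  \<comment> \<open>Apart from the factorial, each application of the field costs
    \<open>G * real (1 + e)\<close> in the coefficients and \<open>e\<close> more powers of
    \<open>R\<close>; the 1 is the degree of a variable. In \<open>r\<close>, the added 1 covers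
    \<open>B = 0\<close>, and the 2 makes the terms decay like powers of
    \<open>1 / 2\<close>.\<close>
  define B where "B = G * real (1 + e) * R ^ e"
  define r where "r = 1 / (2 * (B + 1))"
  have B: "0 \<le> B" using \<open>0 \<le> G\<close> R by (simp add: B_def)
  have r: "0 < r" "B * r \<le> 1 / 2" using B by (auto simp: r_def field_simps)
  have bound: "\<bar>flow_coeff f n\<bar> \<le> R * B ^ n" if "f \<in> V" for f n
  proof -
    have "poly_bound N 1 1 f" using that by (auto simp: V_def intro: poly_bound.intros)
    then have "poly_bound N (1 + n * e) (1 * (G * real (1 + e)) ^ n * fact n) ((\<xi> ^^ n) f)"
      by (intro poly_bound_vector_field_iterate eG \<open>0 \<le> G\<close>) (auto simp: V_def)
    from poly_bound_eval[OF this R RX]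
    have "\<bar>ev x ((\<xi> ^^ n) f)\<bar> \<le> (G * real (1 + e)) ^ n * fact n * R ^ (1 + n * e)" by simp
    also have "\<dots> = R * B ^ n * fact n"
      by (simp add: B_def power_mult_distrib power_add power_mult[of R e n] mult.commute[of n e]
          mult_ac)
    finally show ?thesis by (simp add: flow_coeff_def divide_le_eq)
  qed
  have "summable (\<lambda>n. \<bar>flow_coeff f n\<bar> * r ^ n)" if "f \<in> V" for f
  proof (rule summable_comparison_test'[of "\<lambda>n. R * (1 / 2) ^ n"])
    show "summable (\<lambda>n. R * (1 / 2 :: real) ^ n)" by (intro summable_mult summable_geometric) simp
    fix n
    have "\<bar>flow_coeff f n\<bar> * r ^ n \<le> (R * B ^ n) * r ^ n"
      using bound[OF that] r by (intro mult_right_mono) auto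
    also have "\<dots> = R * (B * r) ^ n" by (simp add: power_mult_distrib)
    also have "\<dots> \<le> R * (1 / 2) ^ n"
      using B r R by (intro mult_left_mono power_mono) auto
    finally show "norm (\<bar>flow_coeff f n\<bar> * r ^ n) \<le> R * (1 / 2) ^ n" using r by simp
  qed
  note sV = this
  have "summable (\<lambda>n. \<bar>flow_coeff f n\<bar> * r ^ n)" if "f \<in> exp_polynomials N" for f
    using that
  proof (induction rule: exp_polynomials_induct)
    case (const c)
    have "(\<xi> ^^ Suc n) (Poly_Mapping.single 0 c) = 0" for n
    proof -
      have "(\<xi> ^^ n) 0 = 0" for n by (induction n) (auto simp: vector_field_const[of _ _ 0, simplified])
      then show ?thesis by (simp add: funpow_swap1 vector_field_const)
    qed
    then have "flow_coeff (Poly_Mapping.single 0 c) n = 0" if "n > 0" for n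
      using that by (cases n) (auto simp: flow_coeff_def real_exp.exp_eval_0)
    then show ?case by (intro summable_finite[of "{0}"]) auto
  next
    case (add f h)
    show ?case
    proof (rule summable_comparison_test'[OF summable_add[OF add]])
      fix n
      have "\<bar>flow_coeff (f + h) n\<bar> * r ^ n \<le> (\<bar>flow_coeff f n\<bar> + \<bar>flow_coeff h n\<bar>) * r ^ n"
        unfolding flow_coeff_add using r by (intro mult_right_mono) auto
      then show "norm (\<bar>flow_coeff (f + h) n\<bar> * r ^ n) \<le> \<bar>flow_coeff f n\<bar> * r ^ n + \<bar>flow_coeff h
          n\<bar> * r ^ n"
        using r by (simp add: distrib_right)
    qed
  next
    case (mult f h)
    let ?a = "\<lambda>f n. \<bar>flow_coeff f n\<bar> * r ^ n"
    have *: "summable (\<lambda>k. \<Sum>i\<le>k. ?a f i * ?a h (k - i))"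
      using mult r by (intro summable_Cauchy_product) auto
    show ?case
    proof (rule summable_comparison_test'[OF *])
      fix n
      have "\<bar>flow_coeff (f * h) n\<bar> * r ^ n \<le> (\<Sum>i\<le>n. \<bar>flow_coeff f i * flow_coeff h (n - i)\<bar>) * r ^ n"
        unfolding flow_coeff_mult using r by (intro mult_right_mono sum_abs) auto
      also have "\<dots> = (\<Sum>i\<le>n. ?a f i * ?a h (n - i))"
        unfolding sum_distrib_right
      proof (rule sum.cong[OF refl])
        fix i assume "i \<in> {..n}"
        then have "r ^ n = r ^ i * r ^ (n - i)" by (simp flip: power_add)
        then show "\<bar>flow_coeff f i * flow_coeff h (n - i)\<bar> * r ^ n = ?a f i * ?a h (n - i)"
          by (simp add: abs_mult mult_ac)
      qed
      finally show "norm (\<bar>flow_coeff (f * h) n\<bar> * r ^ n) \<le> (\<Sum>i\<le>n. ?a f i * ?a h (n - i))"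
        using r by simp
    qed
  qed (auto intro!: sV simp: V_def)
  then show ?thesis using r by blast
qed

definition flow :: "exp_polynomial \<Rightarrow> real \<Rightarrow> real" where
  "flow f s = suminf (\<lambda>n. flow_coeff f n * s ^ n)"

text \<open>At each small \<open>s\<close> the sum of the Taylor series is a ring homomorphism on
  exponential polynomials, hence evaluation at a point \<open>X s\<close>, provided that its values
  on \<open>XVar j\<close> and \<open>EVar j\<close> are related by \<open>exp\<close>. If all
  iterated derivatives of \<open>f\<close> vanish at \<open>x\<close>, its series is 0.\<close>

lemma exists_flow:
  "\<exists>r>0. \<exists>X. (\<forall>j. X 0 j = x j) \<and> (\<forall>s f. \<bar>s\<bar> < r \<longrightarrow> f \<in> exp_polynomials N \<longrightarrow>
      ((\<lambda>s. ev (X s) f) has_real_derivative ev (X s) (\<xi> f)) (at s) \<and>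
      ((\<forall>n. ev x ((\<xi> ^^ n) f) = 0) \<longrightarrow> ev (X s) f = 0))"
proof -
  obtain r where r: "r > 0" "\<forall>f\<in>exp_polynomials N. summable (\<lambda>n. \<bar>flow_coeff f n\<bar> * r ^ n)"
    using exists_flow_radius by (elim exE conjE)
  have abs: "summable (\<lambda>n. norm (flow_coeff f n * s ^ n))" if "f \<in> exp_polynomials N" "\<bar>s\<bar> \<le> r" for f s
  proof (rule summable_comparison_test'[OF bspec[OF r(2) that(1)]])
    fix n
    show "norm (norm (flow_coeff f n * s ^ n)) \<le> \<bar>flow_coeff f n\<bar> * r ^ n"
      using that by (auto simp: abs_mult power_abs intro!: mult_left_mono power_mono)
  qed
  note sm = summable_norm_cancel[OF abs]
  have deriv: "(flow f has_real_derivative flow (\<xi> f) s) (at s)"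
    if "f \<in> exp_polynomials N" "\<bar>s\<bar> < r" for f s
  proof -
    have "diffs (flow_coeff f) = flow_coeff (\<xi> f)"
      by (auto simp: diffs_def flow_coeff_vector_field simp del: of_nat_Suc)
    then show ?thesis
      using termdiffs_strong[OF sm[OF that(1), of r], of s] that r(1) unfolding flow_def by simp
  qed
  have add: "flow (f + h) s = flow f s + flow h s"
    if "f \<in> exp_polynomials N" "h \<in> exp_polynomials N" "\<bar>s\<bar> < r" for f h s
    unfolding flow_def using that
    by (subst suminf_add) (auto intro: sm simp: flow_coeff_add distrib_right)
  have mult: "flow (f * h) s = flow f s * flow h s"
    if "f \<in> exp_polynomials N" "h \<in> exp_polynomials N" "\<bar>s\<bar> < r" for f h s
  proof -
    have "flow f s * flow h s = suminf (\<lambda>k. \<Sum>i\<le>k. (flow_coeff f i * s ^ i) * (flow_coeff h (k - i)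
        * s ^ (k - i)))"
      unfolding flow_def using that by (intro Cauchy_product abs) auto
    also have "(\<lambda>k. \<Sum>i\<le>k. (flow_coeff f i * s ^ i) * (flow_coeff h (k - i) * s ^ (k - i))) =
        (\<lambda>k. flow_coeff (f * h) k * s ^ k)"
      unfolding flow_coeff_mult sum_distrib_right
    proof (intro ext sum.cong refl)
      fix k i :: nat assume "i \<in> {..k}"
      then have "s ^ k = s ^ i * s ^ (k - i)" by (simp flip: power_add)
      then show "(flow_coeff f i * s ^ i) * (flow_coeff h (k - i) * s ^ (k - i)) =
          flow_coeff f i * flow_coeff h (k - i) * s ^ k" by (simp add: mult_ac)
    qed
    finally show ?thesis by (simp add: flow_def)
  qed
  have flow_0: "flow f 0 = ev x f" for f
    unfolding flow_def using powser_zero[of "flow_coeff f"] by (simp add: flow_coeff_def)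
  have const: "flow (Poly_Mapping.single 0 c) s = of_int c" if "\<bar>s\<bar> < r" for c s
  proof -
    have *: "(\<xi> ^^ n) 0 = 0" for n by (induction n) (auto simp: vector_field_const[of _ _ 0,
        simplified])
    have "flow_coeff (Poly_Mapping.single 0 c) (Suc n) = 0" for n
      using * by (simp add: flow_coeff_def funpow_swap1 vector_field_const real_exp.exp_eval_0)
    then have "flow_coeff (Poly_Mapping.single 0 c) n = (if n = 0 then of_int c else 0)" for n
      by (cases n) (auto simp: flow_coeff_def real_exp.exp_eval_const)
    then have "(\<lambda>n. flow_coeff (Poly_Mapping.single 0 c) n * s ^ n) = (\<lambda>n. if n = 0 then of_int c
        else 0)"
      by auto
    then show ?thesis unfolding flow_def
      using suminf_finite[of "{0::nat}" "\<lambda>n. if n = 0 then real_of_int c else 0"] by simp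
  qed
  define X where "X s j = (if j < N then flow (mpoly_var (XVar j)) s else x j)" for s j
  have EX: "flow (mpoly_var (EVar j)) s = exp (flow (mpoly_var (XVar j)) s)" if j: "j < N" and s:
      "\<bar>s\<bar> < r" for j s
  proof -
    let ?E = "mpoly_var (EVar j) :: exp_polynomial" and ?X = "mpoly_var (XVar j) :: exp_polynomial"
    \<comment> \<open>The series of \<open>EVar j\<close> and the exponential of the series of
      \<open>XVar j\<close> solve the same linear differential equation with the same initial value,
      so their quotient is constant.\<close>
    define q where "q s = flow ?E s * exp (- flow ?X s)" for s
    have vars: "?E \<in> exp_polynomials N" "?X \<in> exp_polynomials N" using j by (auto simp:
        exp_polynomials_closed)
    have "(q has_real_derivative 0) (at s)" if s: "\<bar>s\<bar> < r" for s
    proof -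
      have "(q has_real_derivative flow (\<xi> ?E) s * exp (- flow ?X s) +
          (exp (- flow ?X s) * (- flow (\<xi> ?X) s)) * flow ?E s) (at s)"
        unfolding q_def by (intro derivative_intros deriv vars s DERIV_mult[THEN DERIV_cong] refl)
            (auto intro!: derivative_eq_intros deriv vars s)
      moreover have "flow (\<xi> ?E) s = flow (\<xi> ?X) s * flow ?E s"
        using j s vars by (simp add: vector_field_var mult g)
      ultimately show ?thesis by (simp add: mult_ac)
    qed
    then have "q s = q 0"
      using s r(1) by (intro DERIV_isconst3[of "- r" r]) auto
    also have "q 0 = 1" by (simp add: q_def flow_0 real_exp.exp_eval_var flip: exp_add)
    finally show ?thesis by (simp add: q_def exp_minus field_simps)
  qed
  have evX: "ev (X s) f = flow f s" if "f \<in> exp_polynomials N" "\<bar>s\<bar> < r" for f s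
  proof -
    have "f \<in> exp_polynomials N \<and> ev (X s) f = flow f s"
      using that(1)
      by (induction rule: exp_polynomials_induct)
         (use that(2) in \<open>auto simp: real_exp.exp_eval_simps const add mult EX X_def
             exp_polynomials_closed\<close>)
    then show ?thesis by blast
  qed
  have "((\<lambda>s. ev (X s) f) has_real_derivative ev (X s) (\<xi> f)) (at s)"
    if "f \<in> exp_polynomials N" "\<bar>s\<bar> < r" for f s
  proof -
    have "eventually (\<lambda>s. ev (X s) f = flow f s) (nhds s)"
    proof -
      have "eventually (\<lambda>s. s \<in> {- r<..<r}) (nhds s)"
        using that by (intro eventually_nhds_in_open) auto
      then show ?thesis by eventually_elim (auto intro!: evX that)
    qed
    then show ?thesis
      using deriv[OF that] evX[OF vector_field_in[OF that(1)] that(2)]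
      by (subst DERIV_cong_ev[OF refl _ refl]) auto
  qed
  moreover have "ev (X s) f = 0" if "f \<in> exp_polynomials N" "\<bar>s\<bar> < r" "\<forall>n. ev x ((\<xi> ^^ n) f) = 0"
      for f s
    using that by (simp add: evX flow_def flow_coeff_def)
  moreover have "X 0 j = x j" for j by (simp add: X_def flow_0 real_exp.exp_eval_var)
  ultimately show ?thesis using r(1) by blast
qed

end

section \<open>Tangent vectors at an exponentially transcendental coordinate\<close>

text \<open>Some relation has a nonzero multiple of the \<open>k\<close>-th unit covector as its
  gradient: to first order the relations holding at \<open>x\<close> leave coordinate
  \<open>k\<close> no freedom.\<close>

definition determined :: "nat \<Rightarrow> (nat \<Rightarrow> real) \<Rightarrow> nat \<Rightarrow> bool" where
  "determined N x k \<longleftrightarrow> (\<exists>f\<in>exp_polynomials N. real_exp.exp_eval x f = 0 \<and>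
     (\<forall>j<N. j \<noteq> k \<longrightarrow> real_exp.exp_eval x (exp_pderiv j f) = 0) \<and>
     real_exp.exp_eval x (exp_pderiv k f) \<noteq> 0)"

lemma exp_eval_vector_field: "real_exp.exp_eval x (vector_field N g f) =
    (\<Sum>j<N. real_exp.exp_eval x (g j) * real_exp.exp_eval x (exp_pderiv j f))"
  by (simp add: vector_field_def real_exp.exp_eval_sum real_exp.exp_eval_mult)

lemma exp_values_subring: "is_subring (real_exp.exp_eval x ` exp_polynomials N)"
proof -
  let ?ev = "real_exp.exp_eval x"
  have c: "of_int c \<in> ?ev ` exp_polynomials N" for c
    using exp_polynomials_closed(1)[of c N] real_exp.exp_eval_const[of x c] by (metis imageI)
  have a: "?ev f + ?ev g \<in> ?ev ` exp_polynomials N" "?ev f * ?ev g \<in> ?ev ` exp_polynomials N"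
    if "f \<in> exp_polynomials N" "g \<in> exp_polynomials N" for f g
    using exp_polynomials_closed(4,5)[OF that] real_exp.exp_eval_add[of x f g]
        real_exp.exp_eval_mult[of x f g]
    by (metis imageI)+
  have m: "- ?ev f \<in> ?ev ` exp_polynomials N" if "f \<in> exp_polynomials N" for f
    using exp_polynomials_closed(5)[OF exp_polynomials_closed(1)[of "-1"] that]
      real_exp.exp_eval_mult[of x "Poly_Mapping.single 0 (-1)" f] real_exp.exp_eval_const[of x "-1"]
    by (auto simp: image_iff intro!: bexI)
  show ?thesis
    unfolding is_subring_def using c[of 0] c[of 1] a m by auto
qed

text \<open>Duality over the fraction field of the values at \<open>x\<close>. Gradients of
  relations, divided by values, form a subspace over it: multiplying a relation by \<open>a\<close>
  multiplies its gradient at \<open>x\<close> by the value of \<open>a\<close>, because the relation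
  vanishes there. A vector separating the unit covector from this subspace is tangent to all
  relations, and clearing denominators makes its entries values of exponential polynomials, as a
  vector field requires.\<close>

lemma not_determined:
  assumes "k < N" "\<not> determined N x k"
  shows "\<exists>g. (\<forall>j<N. g j \<in> exp_polynomials N) \<and> real_exp.exp_eval x (g k) \<noteq> 0 \<and>
    (\<forall>f\<in>exp_polynomials N. real_exp.exp_eval x f = 0 \<longrightarrow>
       (\<Sum>j<N. real_exp.exp_eval x (g j) * real_exp.exp_eval x (exp_pderiv j f)) = 0)"
proof -
  let ?ev = "real_exp.exp_eval x" and ?P = "exp_polynomials N"
  note A = exp_values_subring[of x N]
  let ?K = "{a / b |a b. a \<in> ?ev ` ?P \<and> b \<in> ?ev ` ?P \<and> b \<noteq> 0}"
  define W where "W = {w. \<exists>f\<in>?P. \<exists>b\<in>?P. ?ev f = 0 \<and> ?ev b \<noteq> 0 \<and> w = (\<lambda>j. ?ev (exp_pderiv j f) / ?ev b)}"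
  have I: "(\<lambda>j. ?ev (exp_pderiv j f) / ?ev b) \<in> W" if "f \<in> ?P" "b \<in> ?P" "?ev f = 0" "?ev b \<noteq> 0" for f b
    using that unfolding W_def by blast
  have E: "\<exists>f\<in>?P. \<exists>b\<in>?P. ?ev f = 0 \<and> ?ev b \<noteq> 0 \<and> w = (\<lambda>j. ?ev (exp_pderiv j f) / ?ev b)" if "w \<in>
      W" for w
    using that unfolding W_def by blast
  have "(\<exists>w\<in>W. \<forall>i<N. w i = (if i = k then 1 else 0)) \<or>
    (\<exists>v. (\<forall>i. v i \<in> ?K) \<and> (\<forall>w\<in>W. (\<Sum>i<N. w i * v i) = 0) \<and> (\<Sum>i<N. (if i = k then 1 else 0) * v i) = 1)"
  proof (rule in_subspace_or_separated)
    show K: "is_subfield ?K" by (rule is_subfield_fractions[OF A])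
    show "w i \<in> ?K" if "w \<in> W" "i < N" for w i
      using E[OF that(1)] exp_polynomials_pderiv[OF that(2)] by force
    show "(if i = k then 1 else 0) \<in> ?K" for i
      using subring_closed(1,2)[OF subfield_subring[OF K]] by simp
    show "(\<lambda>_. 0) \<in> W"
      using I[OF exp_polynomials_closed(1)[of 0] exp_polynomials_closed(1)[of 1]]
      by (simp add: real_exp.exp_eval_simps exp_pderiv_const[of _ 0, simplified])
    show "(\<lambda>i. u i + w i) \<in> W" if uw: "u \<in> W" "w \<in> W" for u w
    proof -
      obtain f b where 1: "f \<in> ?P" "b \<in> ?P" "?ev f = 0" "?ev b \<noteq> 0" "u = (\<lambda>j. ?ev (exp_pderiv j f)
          / ?ev b)"
        using E[OF uw(1)] by blast
      obtain h c where 2: "h \<in> ?P" "c \<in> ?P" "?ev h = 0" "?ev c \<noteq> 0" "w = (\<lambda>j. ?ev (exp_pderiv j h)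
          / ?ev c)"
        using E[OF uw(2)] by blast
      have "(\<lambda>j. ?ev (exp_pderiv j (f * c + h * b)) / ?ev (b * c)) \<in> W"
        using 1 2 by (intro I exp_polynomials_closed) (auto simp: real_exp.exp_eval_simps)
      also have "(\<lambda>j. ?ev (exp_pderiv j (f * c + h * b)) / ?ev (b * c)) = (\<lambda>i. u i + w i)"
        using 1 2 by (auto simp: exp_pderiv_add exp_pderiv_mult real_exp.exp_eval_simps
            add_frac_eq mult_ac)
      finally show ?thesis .
    qed
    show "(\<lambda>i. c * w i) \<in> W" if cw: "c \<in> ?K" "w \<in> W" for c w
    proof -
      obtain f b where 1: "f \<in> ?P" "b \<in> ?P" "?ev f = 0" "?ev b \<noteq> 0" "w = (\<lambda>j. ?ev (exp_pderiv j f)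
          / ?ev b)"
        using E[OF cw(2)] by blast
      obtain a d where 2: "a \<in> ?P" "d \<in> ?P" "?ev d \<noteq> 0" "c = ?ev a / ?ev d"
        using cw(1) by blast
      have "(\<lambda>j. ?ev (exp_pderiv j (f * a)) / ?ev (b * d)) \<in> W"
        using 1 2 by (intro I exp_polynomials_closed) (auto simp: real_exp.exp_eval_simps)
      also have "(\<lambda>j. ?ev (exp_pderiv j (f * a)) / ?ev (b * d)) = (\<lambda>i. c * w i)"
        using 1 2 by (auto simp: exp_pderiv_mult real_exp.exp_eval_simps mult_ac)
      finally show ?thesis .
    qed
  qed
  then show ?thesis
  proof
    assume "\<exists>w\<in>W. \<forall>i<N. w i = (if i = k then 1 else 0)"
    then obtain w where w: "w \<in> W" "\<And>i. i < N \<Longrightarrow> w i = (if i = k then 1 else 0)" by blast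
    obtain f b where fb: "f \<in> ?P" "b \<in> ?P" "?ev f = 0" "?ev b \<noteq> 0" "w = (\<lambda>j. ?ev (exp_pderiv j f)
        / ?ev b)"
      using E[OF w(1)] by blast
    have "determined N x k"
      unfolding determined_def
    proof (intro bexI[of _ f] conjI allI impI)
      show "?ev (exp_pderiv j f) = 0" if "j < N" "j \<noteq> k" for j using w(2)[OF that(1)] that fb by simp
      show "?ev (exp_pderiv k f) \<noteq> 0" using w(2)[OF assms(1)] fb by auto
    qed (use fb in auto)
    then show ?thesis using assms by blast
  next
    assume "\<exists>v. (\<forall>i. v i \<in> ?K) \<and> (\<forall>w\<in>W. (\<Sum>i<N. w i * v i) = 0) \<and> (\<Sum>i<N. (if i = k then 1 else 0) *
        v i) = 1"
    then obtain v where v: "\<And>i. v i \<in> ?K" "\<And>w. w \<in> W \<Longrightarrow> (\<Sum>i<N. w i * v i) = 0"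
      "(\<Sum>i<N. (if i = k then 1 else 0) * v i) = 1" by blast
    have vk: "v k = 1" using v(3) assms(1) by (simp add: if_distrib[of "\<lambda>t. t * _"] sum.delta
        cong: if_cong)
    have "\<exists>a\<in>?ev ` ?P. \<exists>b\<in>?ev ` ?P. b \<noteq> 0 \<and> v j = a / b" for j using v(1)[of j] by blast
    then obtain b where b: "b \<in> ?ev ` ?P" "b \<noteq> 0" "\<And>j. j < N \<Longrightarrow> v j * b \<in> ?ev ` ?P"
      using common_denominator[OF A, of N v] by metis
    then have "\<forall>j. \<exists>g. j < N \<longrightarrow> g \<in> ?P \<and> ?ev g = v j * b" by (metis imageE)
    then obtain g where g: "\<And>j. j < N \<Longrightarrow> g j \<in> ?P \<and> ?ev (g j) = v j * b" by metis
    have "(\<Sum>j<N. ?ev (g j) * ?ev (exp_pderiv j f)) = 0" if "f \<in> ?P" "?ev f = 0" for f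
    proof -
      have "(\<lambda>j. ?ev (exp_pderiv j f) / ?ev 1) \<in> W"
        using that exp_polynomials_closed(1)[of 1 N] by (intro I) (auto simp: real_exp.exp_eval_1)
      then have "(\<Sum>j<N. ?ev (exp_pderiv j f) * v j) = 0"
        using v(2) by (fastforce simp: real_exp.exp_eval_1)
      then have "0 = b * (\<Sum>j<N. ?ev (exp_pderiv j f) * v j)" by simp
      also have "\<dots> = (\<Sum>j<N. ?ev (g j) * ?ev (exp_pderiv j f))"
        using g by (auto simp: sum_distrib_left intro!: sum.cong)
      finally show ?thesis by simp
    qed
    moreover have "?ev (g k) \<noteq> 0" using g[OF assms(1)] vk b(2) by simp
    ultimately show ?thesis using g by blast
  qed
qed

text \<open>The relations that determine the single coordinates have a diagonal Jacobian with
  nonzero diagonal.\<close>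

lemma exp_algebraic_of_all_determined:
  assumes "0 < N" "\<And>k. k < N \<Longrightarrow> determined N x k"
  shows "real_exp.exp_algebraic (x 0)"
proof -
  have "\<forall>k. \<exists>f. k < N \<longrightarrow> f \<in> exp_polynomials N \<and> real_exp.exp_eval x f = 0 \<and>
     (\<forall>j<N. j \<noteq> k \<longrightarrow> real_exp.exp_eval x (exp_pderiv j f) = 0) \<and> real_exp.exp_eval x (exp_pderiv k
         f) \<noteq> 0"
    using assms(2) unfolding determined_def by blast
  then obtain f where f: "\<And>k. k < N \<Longrightarrow> f k \<in> exp_polynomials N \<and> real_exp.exp_eval x (f k) = 0 \<and>
     (\<forall>j<N. j \<noteq> k \<longrightarrow> real_exp.exp_eval x (exp_pderiv j (f k)) = 0) \<and> real_exp.exp_eval x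
         (exp_pderiv k (f k)) \<noteq> 0"
    by metis
  let ?M = "mat N N (\<lambda>(i, j). real_exp.exp_eval x (exp_pderiv j (f i)))"
  have "upper_triangular ?M" using f by (auto simp: upper_triangular_def)
  then have "det ?M = prod_list (diag_mat ?M)" by (rule det_upper_triangular[of _ N]) simp
  also have "\<dots> \<noteq> 0" using f by (auto simp: prod_list_zero_iff diag_mat_def)
  finally show ?thesis
    unfolding real_exp.exp_algebraic_def using assms(1) f by (intro exI[of _ N] conjI exI[of _ x]
        exI[of _ f]) auto
qed

text \<open>An undetermined coordinate can be moved to a rational value along a flow that preserves
  all exponential-polynomial relations and fixes the determined coordinates.\<close>
lemma exp_algebraic_of_determined:
  assumes "0 < N" "determined N x 0"
  shows "real_exp.exp_algebraic (x 0)"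
  using assms(2)
proof (induction "card {k. k < N \<and> \<not> determined N x k}" arbitrary: x rule: less_induct)
  case less
  show ?case
  proof (cases "\<forall>k<N. determined N x k")
    case True
    then show ?thesis using exp_algebraic_of_all_determined[OF assms(1)] by blast
  next
    case False
    then obtain k where k: "k < N" "\<not> determined N x k" by blast
    from not_determined[OF this] obtain g where g: "\<And>j. j < N \<Longrightarrow> g j \<in> exp_polynomials N"
      "real_exp.exp_eval x (g k) \<noteq> 0" "\<And>f. f \<in> exp_polynomials N \<Longrightarrow> real_exp.exp_eval x f = 0 \<Longrightarrow>
       (\<Sum>j<N. real_exp.exp_eval x (g j) * real_exp.exp_eval x (exp_pderiv j f)) = 0" by blast
    let ?\<xi> = "vector_field N g" and ?P = "exp_polynomials N"
    have "\<exists>r>0. \<exists>X. (\<forall>j. X 0 j = x j) \<and> (\<forall>s f. \<bar>s\<bar> < r \<longrightarrow> f \<in> ?P \<longrightarrow>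
        ((\<lambda>s. real_exp.exp_eval (X s) f) has_real_derivative real_exp.exp_eval (X s) (?\<xi> f)) (at s) \<and>
        ((\<forall>n. real_exp.exp_eval x ((?\<xi> ^^ n) f) = 0) \<longrightarrow> real_exp.exp_eval (X s) f = 0))"
      using exists_flow[where N = N and g = g and x = x, OF g(1)] .
    then obtain r X where r: "r > 0" and X0: "\<forall>j. X 0 j = x j"
      and X': "\<forall>s f. \<bar>s\<bar> < r \<longrightarrow> f \<in> ?P \<longrightarrow>
        ((\<lambda>s. real_exp.exp_eval (X s) f) has_real_derivative real_exp.exp_eval (X s) (?\<xi> f)) (at s) \<and>
        ((\<forall>n. real_exp.exp_eval x ((?\<xi> ^^ n) f) = 0) \<longrightarrow> real_exp.exp_eval (X s) f = 0)"
      by (elim exE conjE)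
    note X = X'[rule_format, THEN conjunct1] X'[rule_format, THEN conjunct2, THEN mp]
    have X0': "X 0 = x" using X0 by auto
    \<comment> \<open>By tangency the derivative of a relation along the field is again a relation
      at \<open>x\<close>. So all iterated derivatives vanish at \<open>x\<close>, and the relation
      holds along the flow.\<close>
    have relation: "real_exp.exp_eval (X s) f = 0" if "\<bar>s\<bar> < r" "f \<in> ?P" "real_exp.exp_eval x f =
        0" for s f
    proof -
      have "(?\<xi> ^^ n) f \<in> ?P \<and> real_exp.exp_eval x ((?\<xi> ^^ n) f) = 0" for n
      proof (induction n)
        case (Suc n)
        then show ?case
          using g(3)[of "(?\<xi> ^^ n) f"] vector_field_in[where N = N and g = g, OF g(1)]
          by (simp add: exp_eval_vector_field)
      qed (use that in simp)
      then show ?thesis using X(2) that by blast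
    qed
    \<comment> \<open>Pairing the tangent vector with a gradient concentrated at \<open>j\<close>
      leaves a single term.\<close>
    have g_determined: "real_exp.exp_eval x (g j) = 0" if j: "j < N" "determined N x j" for j
    proof -
      obtain f where f: "f \<in> ?P" "real_exp.exp_eval x f = 0" "\<And>i. i < N \<Longrightarrow> i \<noteq> j \<Longrightarrow>
          real_exp.exp_eval x (exp_pderiv i f) = 0"
        "real_exp.exp_eval x (exp_pderiv j f) \<noteq> 0" using j(2) unfolding determined_def by blast
      have "(\<Sum>i<N. real_exp.exp_eval x (g i) * real_exp.exp_eval x (exp_pderiv i f)) =
          (\<Sum>i<N. if i = j then real_exp.exp_eval x (g j) * real_exp.exp_eval x (exp_pderiv j f) else 0)"
        using f(3) by (intro sum.cong) auto
      then show ?thesis using g(3)[OF f(1,2)] f(4) j(1) by simp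
    qed
    \<comment> \<open>Since \<open>g 0\<close> vanishes at \<open>x\<close>, it is itself a relation
      that persists; so the velocity of coordinate 0 is 0 at every time.\<close>
    have fixed: "X s 0 = x 0" if s: "\<bar>s\<bar> < r" for s
    proof -
      have "((\<lambda>s. X s 0) has_real_derivative 0) (at t)" if t: "\<bar>t\<bar> < r" for t
        using X(1)[OF t exp_polynomials_closed(2)[OF assms(1)]]
          relation[OF t g(1)[OF assms(1)] g_determined[OF assms(1) less.prems]]
        by (simp add: real_exp.exp_eval_var vector_field_var[OF assms(1)])
      then have "X s 0 = X 0 0"
        using r s by (intro DERIV_isconst3[of "- r" r s 0 "\<lambda>s. X s 0"]) auto
      then show ?thesis by (simp add: X0)
    qed
    have cont: "isCont (\<lambda>s. real_exp.exp_eval (X s) f) s" if "\<bar>s\<bar> < r" "f \<in> ?P" for s f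
      using X(1)[OF that] by (rule DERIV_isCont)
    \<comment> \<open>The same \<open>f\<close> works near 0: its vanishing partial derivatives are
      relations and persist, and the one at \<open>j\<close> stays nonzero by continuity.\<close>
    have stays: "\<forall>\<^sub>F s in nhds 0. determined N (X s) j" if j: "j < N" "determined N x j" for j
    proof -
      obtain f where f: "f \<in> ?P" "real_exp.exp_eval x f = 0" "\<And>i. i < N \<Longrightarrow> i \<noteq> j \<Longrightarrow>
          real_exp.exp_eval x (exp_pderiv i f) = 0"
        "real_exp.exp_eval x (exp_pderiv j f) \<noteq> 0" using j(2) unfolding determined_def by blast
      have "\<forall>\<^sub>F s in nhds 0. s \<in> {- r<..<r}" using r by (intro eventually_nhds_in_open) auto
      moreover have "\<forall>\<^sub>F s in nhds 0. real_exp.exp_eval (X s) (exp_pderiv j f) \<noteq> 0"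
      proof (rule tendsto_imp_eventually_ne)
        have "isCont (\<lambda>s. real_exp.exp_eval (X s) (exp_pderiv j f)) 0"
          using r f(1) j(1) by (intro cont exp_polynomials_pderiv) auto
        then show "((\<lambda>s. real_exp.exp_eval (X s) (exp_pderiv j f)) \<longlongrightarrow> real_exp.exp_eval (X 0)
            (exp_pderiv j f)) (nhds 0)"
          unfolding isCont_def by (rule tendsto_at_iff_tendsto_nhds[THEN iffD1])
        show "real_exp.exp_eval (X 0) (exp_pderiv j f) \<noteq> 0" using f X0' by simp
      qed
      ultimately show ?thesis
      proof eventually_elim
        case (elim s)
        then have "\<bar>s\<bar> < r" by auto
        then show ?case
          unfolding determined_def using f elim exp_polynomials_pderiv
          by (intro bexI[of _ f]) (auto intro!: relation)
      qed
    qed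
    have "\<forall>\<^sub>F s in nhds 0. \<forall>j\<in>{j. j < N \<and> determined N x j}. determined N (X s) j"
      using stays by (intro eventually_ball_finite) auto
    then obtain d where d: "d > 0" "\<And>s j. \<bar>s\<bar> < d \<Longrightarrow> j < N \<Longrightarrow> determined N x j \<Longrightarrow> determined N (X s) j"
      unfolding eventually_nhds_metric by (auto simp: dist_real_def)
    \<comment> \<open>Coordinate \<open>k\<close> starts with nonzero velocity, so by the
      intermediate value theorem it meets a rational number at arbitrarily small times.\<close>
    have "\<exists>s. \<bar>s\<bar> < min d r \<and> X s k \<in> \<rat>"
    proof -
      let ?h = "\<lambda>s. X s k"
      have h: "(?h has_real_derivative real_exp.exp_eval x (g k)) (at 0)"
        using X(1)[OF _ exp_polynomials_closed(2)[OF k(1)], of 0] r X0'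
        by (simp add: real_exp.exp_eval_var vector_field_var[OF k(1)])
      have hc: "isCont ?h s" if "\<bar>s\<bar> < r" for s
        using cont[OF that exp_polynomials_closed(2)[OF k(1)]] by (simp add: real_exp.exp_eval_var)
      obtain e where e: "e > 0" "(\<forall>t>0. t < e \<longrightarrow> ?h 0 < ?h t) \<or> (\<forall>t>0. t < e \<longrightarrow> ?h t < ?h 0)"
        using DERIV_pos_inc_right[OF h] DERIV_neg_dec_right[OF h] g(2) by (metis add_0
            linorder_neqE_linordered_idom)
      define t where "t = min e (min d r) / 2"
      have t: "0 < t" "t < e" "t < d" "t < r" using e(1) d(1) r by (auto simp: t_def)
      have c: "\<forall>s. 0 \<le> s \<and> s \<le> t \<longrightarrow> isCont ?h s" using hc t by auto
      have "\<exists>s\<ge>0. s \<le> t \<and> X s k \<in> \<rat>"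
      proof (cases "?h 0 < ?h t")
        case True
        then obtain q where "q \<in> \<rat>" "?h 0 < q" "q < ?h t" using Rats_dense_in_real by blast
        then show ?thesis using IVT[of ?h 0 q t] c t by auto
      next
        case False
        then have "?h t < ?h 0" using e(2) t by blast
        then obtain q where "q \<in> \<rat>" "?h t < q" "q < ?h 0" using Rats_dense_in_real by blast
        then show ?thesis using IVT2[of ?h t q 0] c t by auto
      qed
      then show ?thesis using t by (metis abs_of_nonneg le_less_trans min_less_iff_conj)
    qed
    then obtain s where s: "\<bar>s\<bar> < d" "\<bar>s\<bar> < r" "X s k \<in> \<rat>" by auto
    have kdet: "determined N (X s) k"
    proof -
      obtain a b where ab: "b > 0" "X s k = of_int a / of_int b"
        using s(3) by (auto elim!: Rats_cases')
      let ?f = "Poly_Mapping.single 0 b * mpoly_var (XVar k) + Poly_Mapping.single 0 (- a)"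
      have "?f \<in> ?P" using k by (intro exp_polynomials_closed)
      then show ?thesis
        unfolding determined_def using ab
        by (intro bexI[of _ ?f])
           (auto simp: exp_pderiv_add exp_pderiv_mult exp_pderiv_const exp_pderiv_var
               real_exp.exp_eval_simps)
    qed
    have "{j. j < N \<and> \<not> determined N (X s) j} \<subset> {j. j < N \<and> \<not> determined N x j}"
      using d(2)[OF s(1)] kdet k by blast
    then have "card {j. j < N \<and> \<not> determined N (X s) j} < card {j. j < N \<and> \<not> determined N x j}"
      by (intro psubset_card_mono) auto
    then have "real_exp.exp_algebraic (X s 0)"
      using d(2)[OF s(1) assms(1) less.prems] by (intro less.hyps)
    then show ?thesis using fixed[OF s(2)] by simp
  qed
qed

lemma exp_transcendental_tangent_vector:
  assumes "real_exp.exp_transcendental (x 0)" "0 < N"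
  shows "\<exists>v. v 0 = 1 \<and> (\<forall>f\<in>exp_polynomials N. real_exp.exp_eval x f = 0 \<longrightarrow>
       (\<Sum>j<N. v j * real_exp.exp_eval x (exp_pderiv j f)) = 0)"
proof -
  have "\<not> determined N x 0"
    using assms exp_algebraic_of_determined unfolding real_exp.exp_transcendental_def by blast
  from not_determined[OF assms(2) this] obtain g where g: "real_exp.exp_eval x (g 0) \<noteq> 0"
    "\<And>f. f \<in> exp_polynomials N \<Longrightarrow> real_exp.exp_eval x f = 0 \<Longrightarrow>
       (\<Sum>j<N. real_exp.exp_eval x (g j) * real_exp.exp_eval x (exp_pderiv j f)) = 0" by blast
  show ?thesis
    using g by (intro exI[of _ "\<lambda>j. real_exp.exp_eval x (g j) / real_exp.exp_eval x (g 0)"])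
      (simp flip: sum_divide_distrib)
qed

section \<open>Exponential derivations\<close>

text \<open>A basis of the span, together with \<open>x\<close>, is independent, so the functional
  can be prescribed on it. It is used over \<real> for formal symbols \<open>d a\<close>, and over
  the rationals for \<real> itself.\<close>

lemma (in vector_space) exists_separating_functional:
  assumes "x \<notin> span S"
  shows "\<exists>f :: 'b \<Rightarrow> 'a. (\<forall>a b. f (a + b) = f a + f b) \<and> (\<forall>c a. f (scale c a) = c * f a) \<and>
    (\<forall>s\<in>S. f s = 0) \<and> f x = 1"
proof -
  interpret K: vector_space "(*) :: 'a \<Rightarrow> 'a \<Rightarrow> 'a"
    by unfold_locales (simp_all add: algebra_simps)
  interpret vector_space_pair scale "(*) :: 'a \<Rightarrow> 'a \<Rightarrow> 'a" ..
  obtain B where B: "B \<subseteq> S" "independent B" "S \<subseteq> span B" using maximal_independent_subset by blast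
  have "x \<notin> span B" using assms span_mono[OF B(1)] by blast
  then have "independent (insert x B)" using B(2) by (simp add: independent_insertI)
  from linear_independent_extend[OF this, of "\<lambda>b. if b = x then 1 else 0"]
  obtain f where f: "Vector_Spaces.linear scale (*) f" "\<And>b. b \<in> insert x B \<Longrightarrow> f b = (if b = x then
      1 else 0)" by blast
  interpret f: Vector_Spaces.linear scale "(*)" f by (rule f(1))
  have "f s = 0" if "s \<in> S" for s
  proof (rule f.eq_0_on_span[of B])
    show "f b = 0" if "b \<in> B" for b
      using f(2)[of b] that \<open>x \<notin> span B\<close> span_base by auto
    show "s \<in> span B" using B(3) that by blast
  qed
  then show ?thesis using f(2)[of x] f.add f.scale by (intro exI[of _ f]) auto
qed

definition pm_scale :: "real \<Rightarrow> (real \<Rightarrow>\<^sub>0 real) \<Rightarrow> (real \<Rightarrow>\<^sub>0 real)" where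
  "pm_scale c = Poly_Mapping.map ((*) c)"

lemma lookup_pm_scale: "Poly_Mapping.lookup (pm_scale c f) a = c * Poly_Mapping.lookup f a"
  by (simp add: pm_scale_def Poly_Mapping.map.rep_eq when_def)

interpretation pm: vector_space pm_scale
  by unfold_locales (auto intro!: poly_mapping_eqI simp: lookup_pm_scale lookup_add algebra_simps)

text \<open>The free real vector space on symbols \<open>d a\<close>, with the relations that make \<open>d\<close> an exponential
  derivation.\<close>
definition der_relation :: "nat \<Rightarrow> real \<times> real \<Rightarrow> (real \<Rightarrow>\<^sub>0 real)" where
  "der_relation i = (\<lambda>(a, b).
     if i = 0 then Poly_Mapping.single (a + b) 1 - Poly_Mapping.single a 1 - Poly_Mapping.single b 1
     else if i = 1 then Poly_Mapping.single (a * b) 1 - Poly_Mapping.single a b -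
         Poly_Mapping.single b a
     else Poly_Mapping.single (exp a) 1 - Poly_Mapping.single a (exp a))"

definition pm_apply :: "(real \<Rightarrow> real) \<Rightarrow> (real \<Rightarrow>\<^sub>0 real) \<Rightarrow> real" where
  "pm_apply \<delta> f = (\<Sum>a\<in>Poly_Mapping.keys f. Poly_Mapping.lookup f a * \<delta> a)"

lemma pm_apply_superset:
  "finite U \<Longrightarrow> Poly_Mapping.keys f \<subseteq> U \<Longrightarrow> pm_apply \<delta> f = (\<Sum>a\<in>U. Poly_Mapping.lookup f a * \<delta> a)"
  unfolding pm_apply_def by (rule sum.mono_neutral_left) (auto simp: in_keys_iff)

lemma pm_apply_add: "pm_apply \<delta> (f + g) = pm_apply \<delta> f + pm_apply \<delta> g"
proof -
  let ?U = "Poly_Mapping.keys f \<union> Poly_Mapping.keys g"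
  show ?thesis using keys_add[of f g]
    by (simp add: pm_apply_superset[of ?U] lookup_add distrib_right sum.distrib)
qed

lemma pm_apply_single: "pm_apply \<delta> (Poly_Mapping.single a c) = c * \<delta> a"
  by (subst pm_apply_superset[of "{a}"]) auto

lemma pm_apply_scale: "pm_apply \<delta> (pm_scale c f) = c * pm_apply \<delta> f"
  by (subst pm_apply_superset[of "Poly_Mapping.keys f"])
     (auto simp: pm_apply_def lookup_pm_scale in_keys_iff sum_distrib_left mult_ac)

lemma pm_apply_diff: "pm_apply \<delta> (f - g) = pm_apply \<delta> f - pm_apply \<delta> g"
  using pm_apply_add[of \<delta> "f - g" g] by simp

lemma pm_apply_sum: "pm_apply \<delta> (sum f I) = (\<Sum>i\<in>I. pm_apply \<delta> (f i))"
  by (induction I rule: infinite_finite_induct) (auto simp: pm_apply_add pm_apply_def[of _ 0])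

text \<open>Each sum, product and exponential in \<open>T\<close> is an exponential-polynomial
  relation between entries of a finite list. A tangent vector at this list, read as the function
  sending each entry to its component, satisfies the linearised relations, and these are the rules
  for an exponential derivation.\<close>

lemma exists_partial_exp_derivation:
  fixes T :: "(real \<times> real) set"
  assumes p: "real_exp.exp_transcendental p" and "finite T"
  shows "\<exists>\<delta>. \<delta> p = 1 \<and> (\<forall>(a, b)\<in>T. \<delta> (a + b) = \<delta> a + \<delta> b \<and> \<delta> (a * b) = \<delta> a * b + a * \<delta> b \<and>
    \<delta> (exp a) = exp a * \<delta> a)"
proof -
  define U where "U = (\<Union>(a, b)\<in>T. {a, b, a + b, a * b, exp a}) - {p}"
  have "finite U" using assms by (auto simp: U_def)
  then obtain xs where xs: "set xs = U" "distinct xs" using finite_distinct_list by blast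
  \<comment> \<open>\<open>p\<close> comes first because the tangent vector is normalised at index
    0; it was removed from \<open>U\<close> to keep the list distinct.\<close>
  define us where "us = p # xs"
  define N where "N = length us"
  have us: "distinct us" "set us = insert p U" using xs by (auto simp: us_def U_def)
  have idx: "\<exists>i<N. us ! i = a" if "a \<in> insert p U" for a
    using that us(2) by (metis N_def in_set_conv_nth)
  have inj: "i = j" if "i < N" "j < N" "us ! i = us ! j" for i j
    using that us(1) by (simp add: N_def nth_eq_iff_index_eq)
  obtain v where v: "v 0 = 1" "\<And>f. f \<in> exp_polynomials N \<Longrightarrow> real_exp.exp_eval (\<lambda>i. us ! i) f = 0 \<Longrightarrow>
       (\<Sum>j<N. v j * real_exp.exp_eval (\<lambda>i. us ! i) (exp_pderiv j f)) = 0"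
    using exp_transcendental_tangent_vector[of "\<lambda>i. us ! i" N] p by (auto simp: us_def N_def)
  define \<delta> where "\<delta> a = v (THE i. i < N \<and> us ! i = a)" for a
  have \<delta>: "\<delta> (us ! i) = v i" if "i < N" for i
  proof -
    have "(THE j. j < N \<and> us ! j = us ! i) = i" using that inj by (intro the_equality) auto
    then show ?thesis by (simp add: \<delta>_def)
  qed
  let ?X = "\<lambda>i. mpoly_var (XVar i) :: exp_polynomial" and ?E = "\<lambda>i. mpoly_var (EVar i) ::
      exp_polynomial"
  let ?c = "Poly_Mapping.single 0 (-1) :: exp_polynomial"
  have grad: "real_exp.exp_eval x (exp_pderiv j (?X i)) = of_bool (i = j)"
    "real_exp.exp_eval x (exp_pderiv j (?E i)) = exp (x i) * of_bool (i = j)" for x i j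
    by (simp_all add: exp_pderiv_var real_exp.exp_eval_simps)
  have s: "(\<Sum>j<N. v j * (c * of_bool (i = j))) = c * v i" if "i < N" for i c
    using that by (simp add: of_bool_def if_distrib[of "\<lambda>t. _ * t"] cong: if_cong)
  note simps = exp_pderiv_add exp_pderiv_mult exp_pderiv_const grad real_exp.exp_eval_simps
  have "\<delta> p = 1" using \<delta>[of 0] v(1) by (simp add: us_def N_def)
  moreover have "\<delta> (a + b) = \<delta> a + \<delta> b \<and> \<delta> (a * b) = \<delta> a * b + a * \<delta> b \<and> \<delta> (exp a) = exp a * \<delta> a"
    if ab: "(a, b) \<in> T" for a b
  proof -
    have "{a, b, a + b, a * b, exp a} \<subseteq> insert p U" using ab unfolding U_def by blast
    then obtain i j k l m where ij: "i < N" "us ! i = a" "j < N" "us ! j = b" "k < N" "us ! k = a + b"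
      "l < N" "us ! l = a * b" "m < N" "us ! m = exp a"
      using idx[of a] idx[of b] idx[of "a + b"] idx[of "a * b"] idx[of "exp a"] by blast
    have D: "\<delta> a = v i" "\<delta> b = v j" "\<delta> (a + b) = v k" "\<delta> (a * b) = v l" "\<delta> (exp a) = v m"
      using \<delta> ij by metis+
    have "?X i + ?X j + ?c * ?X k \<in> exp_polynomials N" "?X i * ?X j + ?c * ?X l \<in> exp_polynomials N"
      "?E i + ?c * ?X m \<in> exp_polynomials N"
      using ij by (auto intro!: exp_polynomials_closed)
    note rel = v(2)[OF this(1)] v(2)[OF this(2)] v(2)[OF this(3)]
    have "real_exp.exp_eval ((!) us) (exp_pderiv j' (?X i + ?X j + ?c * ?X k)) =
        1 * of_bool (i = j') + 1 * of_bool (j = j') + (- 1) * of_bool (k = j')"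
      "real_exp.exp_eval ((!) us) (exp_pderiv j' (?X i * ?X j + ?c * ?X l)) =
        b * of_bool (i = j') + a * of_bool (j = j') + (- 1) * of_bool (l = j')"
      "real_exp.exp_eval ((!) us) (exp_pderiv j' (?E i + ?c * ?X m)) =
        exp a * of_bool (i = j') + (- 1) * of_bool (m = j')" for j'
      using ij by (simp_all add: simps)
    then have "1 * v i + 1 * v j + (- 1) * v k = 0" "b * v i + a * v j + (- 1) * v l = 0"
      "exp a * v i + (- 1) * v m = 0"
      using rel ij by (simp_all only: distrib_left sum.distrib s) (simp_all add:
          real_exp.exp_eval_simps)
    then show ?thesis by (simp add: D mult_ac)
  qed
  ultimately show ?thesis by (intro exI[of _ \<delta>]) auto
qed

text \<open>Compactness in linear form: if the symbol of \<open>p\<close> were a combination of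
  derivation rules, finitely many rules would be involved, and a partial derivation obeying these
  would send the symbol to both 0 and 1. A functional that kills all rules and is 1 on this symbol
  is the derivation sought.\<close>

theorem exists_exp_derivation:
  assumes p: "real_exp.exp_transcendental p"
  shows "\<exists>\<delta> :: real \<Rightarrow> real. derivation \<delta> \<and> (\<forall>a. \<delta> (exp a) = exp a * \<delta> a) \<and> \<delta> p = 1"
proof -
  define S where "S = (\<lambda>(i, ab). der_relation i ab) ` UNIV"
  have "Poly_Mapping.single p 1 \<notin> pm.span S"
  proof
    assume "Poly_Mapping.single p 1 \<in> pm.span S"
    then obtain t r where t: "finite t" "t \<subseteq> S" "(\<Sum>f\<in>t. pm_scale (r f) f) = Poly_Mapping.single p 1"
      unfolding pm.span_explicit by auto
    obtain T where T: "finite T" "t = (\<lambda>(i, ab). der_relation i ab) ` T"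
      using finite_subset_image[OF t(1) t(2)[unfolded S_def]] by (elim exE conjE)
    obtain \<delta> where \<delta>p: "\<delta> p = 1" and "\<forall>(a, b)\<in>snd ` T. \<delta> (a + b) = \<delta> a + \<delta> b \<and>
        \<delta> (a * b) = \<delta> a * b + a * \<delta> b \<and> \<delta> (exp a) = exp a * \<delta> a"
      using exists_partial_exp_derivation[OF p, of "snd ` T"] T(1) by blast
    then have \<delta>: "\<delta> (a + b) = \<delta> a + \<delta> b" "\<delta> (a * b) = \<delta> a * b + a * \<delta> b" "\<delta> (exp a) = exp a * \<delta> a"
      if "(a, b) \<in> snd ` T" for a b
      using that by auto
    have "pm_apply \<delta> f = 0" if f: "f \<in> t" for f
    proof -
      obtain i a b where "f = der_relation i (a, b)" "(a, b) \<in> snd ` T"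
      proof -
        obtain z where z: "z \<in> T" "f = (\<lambda>(i, ab). der_relation i ab) z"
          using f unfolding T(2) by (elim imageE)
        obtain i a b where "z = (i, a, b)" by (metis surj_pair)
        with z show thesis by (intro that[of i a b]) (auto intro: rev_image_eqI)
      qed
      then show ?thesis
        using \<delta>[of a b] by (simp add: der_relation_def pm_apply_diff pm_apply_add pm_apply_single
            algebra_simps)
    qed
    then have "pm_apply \<delta> (\<Sum>f\<in>t. pm_scale (r f) f) = 0" by (simp add: pm_apply_sum pm_apply_scale)
    then show False by (simp add: t(3) pm_apply_single \<delta>p)
  qed
  from pm.exists_separating_functional[OF this]
  obtain L :: "(real \<Rightarrow>\<^sub>0 real) \<Rightarrow> real" where L: "\<And>a b. L (a + b) = L a + L b" "\<And>c a. L (pm_scale c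
      a) = c * L a"
    "\<And>s. s \<in> S \<Longrightarrow> L s = 0" "L (Poly_Mapping.single p 1) = 1" by blast
  define \<delta> where "\<delta> a = L (Poly_Mapping.single a 1)" for a
  have single: "L (Poly_Mapping.single a c) = c * \<delta> a" for a c
  proof -
    have "Poly_Mapping.single a c = pm_scale c (Poly_Mapping.single a 1)"
      by (rule poly_mapping_eqI) (auto simp: lookup_pm_scale lookup_single when_def)
    then show ?thesis by (simp add: L(2) \<delta>_def)
  qed
  have diff: "L (a - b) = L a - L b" for a b using L(1)[of "a - b" b] by simp
  have S: "L (der_relation i (a, b)) = 0" for i a b
    by (rule L(3)) (auto simp: S_def intro!: image_eqI[of _ _ "(i, a, b)"])
  have "\<delta> (a + b) = \<delta> a + \<delta> b \<and> \<delta> (a * b) = \<delta> a * b + a * \<delta> b \<and> \<delta> (exp a) = exp a * \<delta> a" for a b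
    using S[of 0 a b] S[of 1 a b] S[of 2 a b]
    by (simp add: der_relation_def diff L(1) single algebra_simps)
  moreover have "\<delta> p = 1" using L(4) by (simp add: \<delta>_def)
  ultimately show ?thesis unfolding derivation_def by blast
qed

section \<open>Finite extensions of a rational function field\<close>

definition adjoin :: "'a::field set \<Rightarrow> 'a \<Rightarrow> 'a set" where
  "adjoin K t = {x / y |x y. x \<in> (\<lambda>P. poly P t) ` poly_over K \<and> y \<in> (\<lambda>P. poly P t) ` poly_over K \<and>
      y \<noteq> 0}"

lemma is_subring_poly_values:
  assumes "is_subring (K :: 'a::field set)" shows "is_subring ((\<lambda>P. poly P t) ` poly_over K)"
proof -
  let ?A = "(\<lambda>P. poly P t) ` poly_over K"
  note P = subring_closed[OF is_subring_poly_over[OF assms]]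
  have I: "x \<in> ?A" if "P \<in> poly_over K" "x = poly P t" for P x using that by blast
  have "0 \<in> ?A" "1 \<in> ?A" using I[OF P(1)] I[OF P(2)] by simp_all
  moreover have "x + y \<in> ?A \<and> x * y \<in> ?A" if xy: "x \<in> ?A" "y \<in> ?A" for x y
  proof -
    obtain p q where "p \<in> poly_over K" "q \<in> poly_over K" "x = poly p t" "y = poly q t" using xy by blast
    then show ?thesis using I[OF P(3)] I[OF P(4)] by simp
  qed
  moreover have "- x \<in> ?A" if x: "x \<in> ?A" for x
  proof -
    obtain p where "p \<in> poly_over K" "x = poly p t" using x by blast
    then show ?thesis using I[OF P(5)] by simp
  qed
  ultimately show ?thesis unfolding is_subring_def by blast
qed

lemma is_subfield_adjoin: "is_subring K \<Longrightarrow> is_subfield (adjoin K t)"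
  unfolding adjoin_def by (rule is_subfield_fractions[OF is_subring_poly_values])

lemma poly_in_adjoin:
  assumes "is_subring K" "P \<in> poly_over K" shows "poly P t \<in> adjoin K t"
  unfolding adjoin_def using assms subring_closed(2)[OF is_subring_poly_values[OF assms(1), of t]]
  by (intro CollectI exI[of _ "poly P t"] exI[of _ 1]) auto

lemma subset_adjoin: "is_subring K \<Longrightarrow> insert t K \<subseteq> adjoin K t"
  using poly_in_adjoin[of K "[:0, 1:]" t] poly_in_adjoin[OF _ poly_over_const, of K _ t]
  by (auto simp: subring_closed poly_over_pCons poly_over_const)

lemma adjoin_least:
  assumes "is_subfield L" "insert t K \<subseteq> L" shows "adjoin K t \<subseteq> L"
proof -
  have "poly P t \<in> L" if "P \<in> poly_over K" for P
    using that assms by (intro poly_in_subring subfield_subring) (auto simp: poly_over_def)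
  then show ?thesis unfolding adjoin_def using assms(1) by (auto intro: subfield_divide)
qed

lemma is_subfield_Union_chain:
  assumes "subset.chain {K. is_subfield K} \<C>" "\<C> \<noteq> {}"
  shows "is_subfield (\<Union>\<C>)"
proof -
  have K: "is_subfield K" if "K \<in> \<C>" for K using assms that by (auto simp: subset_chain_def)
  have both: "\<exists>K\<in>\<C>. x \<in> K \<and> y \<in> K" if xy: "x \<in> \<Union>\<C>" "y \<in> \<Union>\<C>" for x y
  proof -
    obtain X Y where "X \<in> \<C>" "x \<in> X" "Y \<in> \<C>" "y \<in> Y" using xy by blast
    moreover from this have "X \<subseteq> Y \<or> Y \<subseteq> X" using assms(1) by (simp add: subset_chain_def)
    ultimately show ?thesis by blast
  qed
  note R = subring_closed[OF subfield_subring[OF K]]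
  have "x + y \<in> \<Union>\<C> \<and> x * y \<in> \<Union>\<C>" if xy: "x \<in> \<Union>\<C>" "y \<in> \<Union>\<C>" for x y
  proof -
    obtain X where "X \<in> \<C>" "x \<in> X" "y \<in> X" using both[OF xy] by blast
    then show ?thesis using R(3,4) by (meson UnionI)
  qed
  moreover have "- x \<in> \<Union>\<C> \<and> inverse x \<in> \<Union>\<C>" if x: "x \<in> \<Union>\<C>" for x
  proof -
    obtain X where "X \<in> \<C>" "x \<in> X" using x by blast
    then show ?thesis using R(5) subfield_inverse[OF K] by (meson UnionI)
  qed
  moreover have "0 \<in> \<Union>\<C>" "1 \<in> \<Union>\<C>" using assms(2) R(1,2) by blast+
  ultimately show ?thesis unfolding is_subfield_def by blast
qed

text \<open>If some \<open>z\<close> were transcendental over \<open>K(t)\<close> for a maximal \<open>K\<close>, then subtracting a multiple of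
  a \<open>K(t)\<close>-derivation from a \<open>K\<close>-derivation would give one that kills \<open>K(z)\<close> but not \<open>t\<close>.\<close>
lemma exists_maximal_coefficient_field:
  fixes C :: "'a::field_char_0 set"
  assumes C: "is_subfield C" and t: "transcendental_over C t"
  shows "\<exists>K. is_subfield K \<and> C \<subseteq> K \<and> transcendental_over K t \<and>
    (\<forall>z. \<not> transcendental_over (adjoin K t) z)"
proof -
  define F where "F = {K. is_subfield K \<and> C \<subseteq> K \<and> transcendental_over K t}"
  have "\<exists>M\<in>F. \<forall>X\<in>F. M \<subseteq> X \<longrightarrow> X = M"
  proof (rule subset_Zorn_nonempty)
    show "F \<noteq> {}" using C t by (auto simp: F_def)
    fix \<C> assume ne: "\<C> \<noteq> {}" and chain: "subset.chain F \<C>"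
    have "is_subfield (\<Union>\<C>)"
      using chain ne by (intro is_subfield_Union_chain) (auto simp: subset_chain_def F_def)
    moreover have "C \<subseteq> \<Union>\<C>" using chain ne unfolding subset_chain_def F_def by fast
    moreover have "transcendental_over (\<Union>\<C>) t"
      unfolding transcendental_over_def
    proof (intro ballI impI)
      fix q assume q: "q \<in> poly_over (\<Union>\<C>)" "poly q t = 0"
      have "range (coeff q) \<subseteq> insert 0 (set (coeffs q))" using range_coeff[of q] by blast
      then have "finite (range (coeff q))" by (rule finite_subset) simp
      moreover have "range (coeff q) \<subseteq> \<Union>\<C>" using q(1) by (auto simp: poly_over_def)
      ultimately obtain K where K: "K \<in> \<C>" "range (coeff q) \<subseteq> K"
        using finite_subset_Union_chain[OF _ _ ne chain] by metis
      then have "transcendental_over K t" "q \<in> poly_over K"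
        using chain by (auto simp: subset_chain_def F_def poly_over_def)
      then show "q = 0" using q(2) by (simp add: transcendental_over_def)
    qed
    ultimately show "\<Union>\<C> \<in> F" by (simp add: F_def)
  qed
  then obtain K where "K \<in> F" and max: "\<forall>X\<in>F. K \<subseteq> X \<longrightarrow> X = K" by blast
  then have K: "is_subfield K" "C \<subseteq> K" "transcendental_over K t" by (simp_all add: F_def)
  note KR = subfield_subring[OF K(1)]
  have "\<not> transcendental_over (adjoin K t) z" for z
  proof
    assume z: "transcendental_over (adjoin K t) z"
    note ER = subfield_subring[OF is_subfield_adjoin[OF KR, of t]]
    obtain D where D: "D \<in> derivations_over (adjoin K t)" "D z = 1" using exists_derivation[OF ER
        z] by blast
    obtain D' where D': "D' \<in> derivations_over K" "D' t = 1" using exists_derivation[OF KR K(3)]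
        by blast
    have DD: "derivation D" "derivation D'" using D D' by (auto simp: derivations_over_def)
    define D2 where "D2 a = D' a - D' z * D a" for a
    have D2: "derivation D2"
      unfolding derivation_def D2_def
      by (simp add: derivation_add[OF DD(1)] derivation_add[OF DD(2)] derivation_mult[OF DD(1)]
          derivation_mult[OF DD(2)] algebra_simps)
    have "insert z K \<subseteq> {c. D2 c = 0}"
      using D D' subset_adjoin[OF KR, of t] by (auto simp: D2_def derivations_over_def)
    then have "adjoin K z \<subseteq> {c. D2 c = 0}" by (rule adjoin_least[OF is_subfield_constants[OF D2]])
    then have D2': "D2 \<in> derivations_over (adjoin K z)" using D2 by (auto simp: derivations_over_def)
    \<comment> \<open>\<open>D\<close> is a derivation over \<open>adjoin K t\<close> and kills
      \<open>t\<close>, so the correction term does not change the value at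
      \<open>t\<close>.\<close>
    have "D2 t = 1" using D D' subset_adjoin[OF KR, of t] by (simp add: D2_def derivations_over_def)
    then have "transcendental_over (adjoin K z) t"
      using derivation_algebraic[OF D2'] subfield_subring[OF is_subfield_adjoin[OF KR]] by fastforce
    then have "adjoin K z \<in> F" "K \<subseteq> adjoin K z"
      using K is_subfield_adjoin[OF KR] subset_adjoin[OF KR, of z] by (auto simp: F_def)
    then have "adjoin K z = K" using max by blast
    then have "z \<in> K" using subset_adjoin[OF KR, of z] by blast
    then have "D z = 0" using D(1) subset_adjoin[OF KR, of t] by (auto simp: derivations_over_def)
    then show False using D(2) by simp
  qed
  then show ?thesis using K by blast
qed

lemma exists_minimal_poly:
  assumes "\<not> transcendental_over E z"
  shows "\<exists>q\<in>poly_over E. q \<noteq> 0 \<and> poly q z = 0 \<and>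
    (\<forall>r\<in>poly_over E. poly r z = 0 \<longrightarrow> degree r < degree q \<longrightarrow> r = 0)"
proof -
  let ?P = "\<lambda>d. \<exists>q\<in>poly_over E. q \<noteq> 0 \<and> poly q z = 0 \<and> degree q = d"
  have "\<exists>d. ?P d" using assms by (auto simp: transcendental_over_def)
  from LeastI_ex[OF this] obtain q where "q \<in> poly_over E" "q \<noteq> 0" "poly q z = 0" "degree q =
      (LEAST d. ?P d)"
    by blast
  moreover have "(LEAST d. ?P d) \<le> degree r" if "r \<in> poly_over E" "r \<noteq> 0" "poly r z = 0" for r
    by (rule Least_le) (use that in blast)
  ultimately show ?thesis by (metis not_le)
qed

lemma poly_in_extension:
  "is_subring A \<Longrightarrow> E \<subseteq> A \<Longrightarrow> q \<in> poly_over E \<Longrightarrow> z \<in> A \<Longrightarrow> poly q z \<in> (A :: 'a::comm_ring_1 set)"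
  by (rule poly_in_subring) (auto simp: poly_over_def)

text \<open>For nonzero \<open>z\<close> the constant coefficient of a minimal polynomial is
  nonzero, since otherwise a factor \<open>z\<close> could be cancelled; the equation then expresses
  \<open>inverse z\<close> as a polynomial in \<open>z\<close>.\<close>

lemma inverse_in_algebraic_subring:
  fixes A :: "'a::field set"
  assumes E: "is_subfield E" and A: "is_subring A" "E \<subseteq> A" and z: "z \<in> A" "\<not> transcendental_over E z"
  shows "inverse z \<in> A"
proof (cases "z = 0")
  case False
  obtain q where q: "q \<in> poly_over E" "q \<noteq> 0" "poly q z = 0"
    and min: "\<And>r. r \<in> poly_over E \<Longrightarrow> poly r z = 0 \<Longrightarrow> degree r < degree q \<Longrightarrow> r = 0"
    using exists_minimal_poly[OF z(2)] by blast
  obtain c r where cr: "q = pCons c r" by (cases q)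
  then have r: "r \<in> poly_over E" "c \<in> E"
    using q(1) by (auto simp: poly_over_def coeff_pCons split: nat.splits)
  have "c \<noteq> 0"
  proof
    assume "c = 0"
    then have "poly r z = 0" "r \<noteq> 0" using q(2,3) False unfolding cr by simp_all
    moreover from this have "degree r < degree q" unfolding cr by simp
    ultimately show False using min[OF r(1)] by blast
  qed
  have "z * poly r z = - c" using q(3) unfolding cr by (simp add: eq_neg_iff_add_eq_0 add.commute)
  then have "inverse z = - inverse c * poly r z" using False \<open>c \<noteq> 0\<close> by (simp add: field_simps)
  moreover have "- inverse c \<in> A"
    using subfield_inverse[OF E r(2)] A subring_closed(5)[OF A(1)] by blast
  ultimately show ?thesis
    using poly_in_extension[OF A r(1) z(1)] subring_closed(4)[OF A(1)] by metis
qed (use subring_closed(1)[OF A(1)] in simp)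

text \<open>Differentiating a minimal equation and solving for \<open>D z\<close> divides only by
  the value of its derivative at \<open>z\<close>, which is nonzero by minimality and invertible in
  \<open>A\<close>.\<close>

lemma derivation_in_algebraic_subring:
  fixes A :: "'a::field_char_0 set"
  assumes E: "is_subfield E" and A: "is_subring A" "E \<subseteq> A" and z: "z \<in> A"
    and alg: "\<And>u. \<not> transcendental_over E u" and D: "derivation D" "\<And>c. c \<in> E \<Longrightarrow> D c \<in> E"
  shows "D z \<in> A"
proof -
  note ER = subfield_subring[OF E]
  obtain q where q: "q \<in> poly_over E" "q \<noteq> 0" "poly q z = 0"
    and min: "\<And>r. r \<in> poly_over E \<Longrightarrow> poly r z = 0 \<Longrightarrow> degree r < degree q \<Longrightarrow> r = 0"
    using exists_minimal_poly[OF alg] by blast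
  have "degree q \<noteq> 0"
  proof
    assume "degree q = 0"
    then obtain a where "q = [:a:]" by (rule degree_eq_zeroE)
    then show False using q by simp
  qed
  then have nz: "poly (pderiv q) z \<noteq> 0"
    using min[OF poly_over_pderiv[OF ER q(1)]] by (auto simp: degree_pderiv pderiv_eq_0_iff)
  have "map_poly D q \<in> poly_over E"
    using q(1) D(2) by (simp add: poly_over_def coeff_map_poly derivation_0[OF D(1)])
  then have "poly (map_poly D q) z \<in> A" using A z by (intro poly_in_extension)
  moreover have "poly (pderiv q) z \<in> A"
    by (rule poly_in_extension[OF A poly_over_pderiv[OF ER q(1)] z])
  moreover have "D z = - poly (map_poly D q) z * inverse (poly (pderiv q) z)"
    using derivation_poly[OF D(1), of q z] q(3) nz derivation_0[OF D(1)]
    by (simp add: field_simps eq_neg_iff_add_eq_0)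
  ultimately show ?thesis
    using inverse_in_algebraic_subring[OF E A _ alg] subring_closed(4,5)[OF A(1)] by metis
qed

section \<open>Linear spans over a subfield and finite extensions\<close>

definition lin_span :: "'a::field set \<Rightarrow> 'a set \<Rightarrow> 'a set" where
  "lin_span E S = {\<Sum>s\<in>S. a s * s |a. \<forall>s. a s \<in> E}"

context
  fixes E :: "'a::field set"
  assumes E: "is_subfield E"
begin

lemma lin_spanI: "(\<And>s. a s \<in> E) \<Longrightarrow> (\<Sum>s\<in>S. a s * s) \<in> lin_span E S"
  by (auto simp: lin_span_def)

lemma lin_span_add:
  assumes "x \<in> lin_span E S" "y \<in> lin_span E S" shows "x + y \<in> lin_span E S"
proof -
  from assms obtain a b where "x = (\<Sum>s\<in>S. a s * s)" "\<And>s. a s \<in> E" "y = (\<Sum>s\<in>S. b s * s)" "\<And>s. b s \<in> E"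
    unfolding lin_span_def by blast
  then show ?thesis
    using lin_spanI[of "\<lambda>s. a s + b s" S] subring_closed(3)[OF subfield_subring[OF E]]
    by (simp add: distrib_right sum.distrib)
qed

lemma lin_span_scale:
  assumes "c \<in> E" "x \<in> lin_span E S" shows "c * x \<in> lin_span E S"
proof -
  from assms(2) obtain a where "x = (\<Sum>s\<in>S. a s * s)" "\<And>s. a s \<in> E" unfolding lin_span_def by blast
  then show ?thesis
    using lin_spanI[of "\<lambda>s. c * a s" S] subring_closed(4)[OF subfield_subring[OF E] assms(1)]
    by (simp add: sum_distrib_left mult_ac)
qed

lemma lin_span_0: "0 \<in> lin_span E S"
  using lin_spanI[of "\<lambda>_. 0" S] subring_closed(1)[OF subfield_subring[OF E]] by simp

lemma lin_span_sum: "(\<And>i. i \<in> I \<Longrightarrow> f i \<in> lin_span E S) \<Longrightarrow> sum f I \<in> lin_span E S"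
  by (induction I rule: infinite_finite_induct) (auto intro: lin_span_add lin_span_0)

lemma lin_span_base:
  assumes "finite S" "s \<in> S" shows "s \<in> lin_span E S"
proof -
  have "(\<Sum>u\<in>S. (if u = s then 1 else 0) * u) = s"
    using assms by (simp add: if_distrib[of "\<lambda>t. t * _"] cong: if_cong)
  then show ?thesis
    using lin_spanI[of "\<lambda>u. if u = s then 1 else 0" S] subring_closed(1,2)[OF subfield_subring[OF
        E]] by simp
qed

lemma lin_span_least:
  assumes "is_subring A" "E \<subseteq> A" "S \<subseteq> A" shows "lin_span E S \<subseteq> A"
proof
  fix x assume "x \<in> lin_span E S"
  then obtain a where "x = (\<Sum>s\<in>S. a s * s)" "\<And>s. a s \<in> E" unfolding lin_span_def by blast
  then show "x \<in> A" using assms by (auto intro!: subring_sum subring_closed(4))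
qed

text \<open>Division with remainder by \<open>q\<close> works over the ring \<open>A\<close> because
  the leading coefficient of \<open>q\<close> is a nonzero element of the field
  \<open>E\<close>.\<close>

lemma poly_eq_poly_lower_degree:
  assumes A: "is_subring A" "E \<subseteq> A" and q: "q \<in> poly_over E" "q \<noteq> 0" "poly q y = 0"
  shows "P \<in> poly_over A \<Longrightarrow> \<exists>R\<in>poly_over A. (R = 0 \<or> degree R < degree q) \<and> poly R y = poly P y"
proof (induction "degree P" arbitrary: P rule: less_induct)
  case less
  show ?case
  proof (cases "P = 0 \<or> degree P < degree q")
    case False
    define b where "b = lead_coeff P / lead_coeff q"
    define k where "k = degree P - degree q"
    have "inverse (lead_coeff q) \<in> A" using q(1) A E by (auto simp: poly_over_def intro:
        subfield_inverse)
    then have b: "b \<in> A"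
      using less.prems subring_closed(4)[OF A(1)] by (simp add: b_def divide_inverse poly_over_def)
    note PA = subring_closed[OF is_subring_poly_over[OF A(1)]]
    define P' where "P' = P - monom b k * q"
    have P': "P' \<in> poly_over A"
      unfolding P'_def using less.prems q(1) A b subring_closed(1)[OF A(1)]
      by (intro PA(6) PA(4)) (auto simp: poly_over_def)
    have val: "poly P' y = poly P y" using q(3) by (simp add: P'_def)
    have lq: "lead_coeff q \<noteq> 0" using q(2) by simp
    have "degree P' \<le> degree P"
    proof -
      have "degree (monom b k * q) \<le> k + degree q"
        using degree_mult_le[of "monom b k" q] degree_monom_le[of b k] by linarith
      then show ?thesis unfolding P'_def using False by (intro degree_diff_le) (auto simp: k_def)
    qed
    moreover have "coeff P' (degree P) = 0"
      using False lq by (simp add: P'_def coeff_monom_mult k_def b_def)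
    ultimately consider "P' = 0" | "degree P' < degree P"
      by (metis le_neq_implies_less leading_coeff_0_iff)
    then show ?thesis
    proof cases
      case 1 then show ?thesis using P' val by (intro bexI[of _ P']) auto
    next
      case 2 then show ?thesis using less.hyps[OF 2 P'] val by simp
    qed
  qed (use less.prems in blast)
qed

text \<open>Elements are adjoined one at a time: if \<open>S\<close> spans \<open>A\<close>, the
  products of \<open>S\<close> with the powers of \<open>y\<close> below the degree of an equation
  for \<open>y\<close> span \<open>A[y]\<close>.\<close>

lemma exists_finite_extension:
  assumes "finite Y" "\<And>z. \<not> transcendental_over E z"
  shows "\<exists>A S. is_subring A \<and> E \<union> Y \<subseteq> A \<and> finite S \<and> A = lin_span E S"
  using assms(1)
proof (induction Y)
  case empty
  have "lin_span E {1} = E"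
  proof
    show "lin_span E {1} \<subseteq> E" by (auto simp: lin_span_def)
    show "E \<subseteq> lin_span E {1}" using lin_spanI[of "\<lambda>_. x" "{1}" for x] by auto
  qed
  then show ?case using subfield_subring[OF E] by (intro exI[of _ E] exI[of _ "{1}"] conjI) simp_all
next
  case (insert y Y)
  then obtain A S where A: "is_subring A" "E \<union> Y \<subseteq> A" "finite S" "A = lin_span E S" by blast
  obtain q where q: "q \<in> poly_over E" "q \<noteq> 0" "poly q y = 0"
    using assms(2)[of y] by (auto simp: transcendental_over_def)
  define A' where "A' = (\<lambda>P. poly P y) ` poly_over A"
  define S' where "S' = (\<lambda>(s, k). s * y ^ k) ` (S \<times> {..<degree q})"
  have A': "is_subring A'" unfolding A'_def by (rule is_subring_poly_values[OF A(1)])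
  have AA': "A \<subseteq> A'"
    unfolding A'_def using poly_over_const[OF subring_closed(1)[OF A(1)]] by (force intro:
        image_eqI[of _ _ "[:_:]"])
  have y: "y \<in> A'"
    unfolding A'_def using poly_over_pCons[OF subring_closed(1)[OF A(1)] poly_over_const[OF
        subring_closed(1,2)[OF A(1)]]]
    by (intro image_eqI[of _ _ "[:0, 1:]"]) auto
  have fin: "finite S'" using A(3) by (simp add: S'_def)
  have EA: "E \<subseteq> A" using A(2) by blast
  have SA: "S \<subseteq> A" using lin_span_base[OF A(3)] A(4) by blast
  have "A' = lin_span E S'"
  proof
    show "lin_span E S' \<subseteq> A'"
      using AA' EA SA y A' unfolding S'_def
      by (intro lin_span_least) (auto intro!: subring_closed(4) subring_power)
    show "A' \<subseteq> lin_span E S'"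
    proof
      fix x assume "x \<in> A'"
      then obtain P where "P \<in> poly_over A" "x = poly P y" by (auto simp: A'_def)
      then obtain R where R: "R \<in> poly_over A" "R = 0 \<or> degree R < degree q" "x = poly R y"
        using poly_eq_poly_lower_degree[OF A(1) EA q] by metis
      have "coeff R k * y ^ k \<in> lin_span E S'" if k: "k < degree q" for k
      proof -
        have "coeff R k \<in> lin_span E S" using R(1) A(4) by (simp add: poly_over_def)
        then obtain a where a: "coeff R k = (\<Sum>s\<in>S. a s * s)" "\<And>s. a s \<in> E" unfolding lin_span_def
            by blast
        have "(\<Sum>s\<in>S. a s * (s * y ^ k)) \<in> lin_span E S'"
          using k by (intro lin_span_sum lin_span_scale a lin_span_base fin) (auto simp: S'_def)
        then show ?thesis by (simp add: a(1) sum_distrib_right mult.assoc)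
      qed
      moreover have "x = (\<Sum>k\<le>degree R. coeff R k * y ^ k)" using R(3) by (simp add: poly_altdef)
      ultimately show "x \<in> lin_span E S'" using R(2) lin_span_0 by (auto intro!: lin_span_sum)
    qed
  qed
  moreover have "E \<union> insert y Y \<subseteq> A'" using A(2) AA' y by blast
  ultimately show ?case using A' fin by (intro exI[of _ A'] exI[of _ S'] conjI)
qed

text \<open>A spanning set of least cardinality is independent, since an element of a nontrivial
  relation could be dropped.\<close>

lemma exists_finite_basis:
  assumes "finite Y" "\<And>z. \<not> transcendental_over E z"
  shows "\<exists>A S. is_subring A \<and> E \<union> Y \<subseteq> A \<and> finite S \<and> A = lin_span E S \<and>
    (\<forall>a. (\<forall>s. a s \<in> E) \<longrightarrow> (\<Sum>s\<in>S. a s * s) = 0 \<longrightarrow> (\<forall>s\<in>S. a s = 0))"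
proof -
  obtain A S0 where A: "is_subring A" "E \<union> Y \<subseteq> A" "finite S0" "A = lin_span E S0"
    using exists_finite_extension[OF assms] by blast
  define d where "d = (LEAST d. \<exists>S. finite S \<and> A = lin_span E S \<and> card S = d)"
  have "\<exists>d S. finite S \<and> A = lin_span E S \<and> card S = d" using A by blast
  from LeastI_ex[OF this] obtain S where S: "finite S" "A = lin_span E S" "card S = d" unfolding
      d_def by blast
  have min: "d \<le> card T" if "finite T" "A = lin_span E T" for T
    unfolding d_def by (rule Least_le) (use that in blast)
  have "a s = 0" if a: "\<forall>s. a s \<in> E" "(\<Sum>s\<in>S. a s * s) = 0" and s: "s \<in> S" for a s
  proof (rule ccontr)
    assume nz: "a s \<noteq> 0"
    let ?T = "S - {s}"
    have fin: "finite ?T" using S by simp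
    have "(\<Sum>u\<in>S. a u * u) = a s * s + (\<Sum>u\<in>?T. a u * u)" using S(1) s by (rule sum.remove)
    then have "s = - inverse (a s) * (\<Sum>u\<in>?T. a u * u)"
      using a(2) nz by (simp add: field_simps eq_neg_iff_add_eq_0)
    moreover have "- inverse (a s) \<in> E"
      using a(1) E by (auto intro!: subring_closed(5) subfield_subring subfield_inverse)
    ultimately have sT: "s \<in> lin_span E ?T" using lin_span_scale lin_spanI[of a ?T] a(1) by metis
    have "lin_span E S \<subseteq> lin_span E ?T"
    proof
      fix x assume "x \<in> lin_span E S"
      then obtain b where b: "x = (\<Sum>u\<in>S. b u * u)" "\<And>u. b u \<in> E" unfolding lin_span_def by blast
      have "b u * u \<in> lin_span E ?T" if u: "u \<in> S" for u
      proof (rule lin_span_scale[OF b(2)])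
        show "u \<in> lin_span E ?T" using sT u lin_span_base[OF fin, of u] by (cases "u = s") auto
      qed
      then show "x \<in> lin_span E ?T" unfolding b(1) by (rule lin_span_sum)
    qed
    moreover have "lin_span E ?T \<subseteq> A"
    proof (rule lin_span_least[OF A(1)])
      show "E \<subseteq> A" using A(2) by blast
      show "?T \<subseteq> A" using S(1,2) lin_span_base by blast
    qed
    ultimately have "d \<le> card ?T" using min[OF fin] S(2) by blast
    then show False using S(1,3) s by (metis card_Diff1_less not_le)
  qed
  then show ?thesis using A(1,2) S(1,2) by (intro exI[of _ A] exI[of _ S] conjI allI impI ballI) blast+
qed

end

section \<open>Trace and norm\<close>

lemma derivation_prod:
  assumes D: "derivation (D :: 'a::field \<Rightarrow> 'a)" and "finite I"
  shows "D (prod f I) = (\<Sum>k\<in>I. D (f k) * prod f (I - {k}))"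
  using assms(2)
proof (induction I rule: finite_induct)
  case (insert i I)
  have "(\<Sum>k\<in>I. D (f k) * prod f (insert i I - {k})) = f i * (\<Sum>k\<in>I. D (f k) * prod f (I - {k}))"
    unfolding sum_distrib_left
  proof (rule sum.cong[OF refl])
    fix k assume k: "k \<in> I"
    then have "insert i I - {k} = insert i (I - {k})" using insert.hyps by blast
    then show "D (f k) * prod f (insert i I - {k}) = f i * (D (f k) * prod f (I - {k}))"
      using insert.hyps by simp
  qed
  then show ?case using insert by (simp add: derivation_mult[OF D])
qed (simp add: derivation_1[OF D])

text \<open>Jacobi's formula. Differentiating the permutation expansion gives the sum of the
  determinants of the \<open>B k\<close>, in which row \<open>k\<close> is differentiated; expansion
  along this row brings in the cofactors of \<open>A\<close>.\<close>

lemma derivation_det: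
  fixes D :: "'a::field \<Rightarrow> 'a"
  assumes D: "derivation D" and A: "A \<in> carrier_mat n n"
  shows "D (det A) = (\<Sum>i<n. \<Sum>j<n. D (A $$ (i, j)) * cofactor A i j)"
proof -
  define B where "B k = mat n n (\<lambda>(i, j). if i = k then D (A $$ (i, j)) else A $$ (i, j))" for k
  have B: "B k \<in> carrier_mat n n" for k by (simp add: B_def)
  let ?P = "{p. p permutes {0..<n}}"
  have sgn: "D (signof p) = 0" for p :: "nat \<Rightarrow> nat"
    using derivation_of_int[OF D, of "sign p"] by simp
  have "D (det A) = (\<Sum>p\<in>?P. signof p * (\<Sum>k<n. D (A $$ (k, p k)) * (\<Prod>i\<in>{0..<n} - {k}. A $$ (i, p i))))"
    unfolding det_def'[OF A] derivation_sum[OF D] derivation_mult[OF D] sgn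
    by (simp add: derivation_prod[OF D] atLeast0LessThan)
  also have "\<dots> = (\<Sum>k<n. \<Sum>p\<in>?P. signof p * (D (A $$ (k, p k)) * (\<Prod>i\<in>{0..<n} - {k}. A $$ (i, p i))))"
    unfolding sum_distrib_left by (rule sum.swap)
  also have "\<dots> = (\<Sum>k<n. det (B k))"
  proof (rule sum.cong[OF refl])
    fix k assume k: "k \<in> {..<n}"
    have "D (A $$ (k, p k)) * (\<Prod>i\<in>{0..<n} - {k}. A $$ (i, p i)) = (\<Prod>i = 0..<n. B k $$ (i, p i))"
      if "p permutes {0..<n}" for p
    proof -
      have p: "p i < n" if "i < n" for i using permutes_in_image[OF \<open>p permutes _\<close>, of i] that by simp
      have "(\<Prod>i = 0..<n. B k $$ (i, p i)) = B k $$ (k, p k) * (\<Prod>i\<in>{0..<n} - {k}. B k $$ (i, p i))"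
        using k by (intro prod.remove) auto
      also have "(\<Prod>i\<in>{0..<n} - {k}. B k $$ (i, p i)) = (\<Prod>i\<in>{0..<n} - {k}. A $$ (i, p i))"
        using p by (intro prod.cong) (auto simp: B_def)
      finally show ?thesis using k p by (simp add: B_def)
    qed
    then show "(\<Sum>p\<in>?P. signof p * (D (A $$ (k, p k)) * (\<Prod>i\<in>{0..<n} - {k}. A $$ (i, p i)))) = det (B k)"
      unfolding det_def'[OF B] by (intro sum.cong) auto
  qed
  also have "\<dots> = (\<Sum>k<n. \<Sum>j<n. D (A $$ (k, j)) * cofactor A k j)"
  proof (intro sum.cong refl)
    fix k assume k: "k \<in> {..<n}"
    have "mat_delete (B k) k j = mat_delete A k j" if "j < n" for j
      using A k that by (auto simp: mat_delete_def B_def intro!: eq_matI)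
    then show "det (B k) = (\<Sum>j<n. D (A $$ (k, j)) * cofactor A k j)"
      using k unfolding laplace_expansion_row[OF B, of k k, OF k[simplified]] cofactor_def
      by (intro sum.cong refl) (auto simp: B_def)
  qed
  finally show ?thesis .
qed

definition mat_trace :: "'a::comm_ring_1 mat \<Rightarrow> 'a" where
  "mat_trace A = (\<Sum>i<dim_row A. A $$ (i, i))"

lemma mat_trace_mult:
  assumes "A \<in> carrier_mat n n" "B \<in> carrier_mat n n"
  shows "mat_trace (A * B) = (\<Sum>i<n. \<Sum>j<n. A $$ (i, j) * B $$ (j, i))"
  using assms unfolding mat_trace_def by (auto simp: scalar_prod_def atLeast0LessThan intro!: sum.cong)

lemma mat_trace_comm:
  assumes "A \<in> carrier_mat n n" "B \<in> carrier_mat n n"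
  shows "mat_trace (A * B) = mat_trace (B * A)"
  unfolding mat_trace_mult[OF assms] mat_trace_mult[OF assms(2,1)]
  by (subst sum.swap) (simp add: mult.commute)

text \<open>A finite field extension \<open>A\<close> of \<open>E\<close> with basis
  \<open>e\<close>, and a derivation preserving both fields. Trace and norm of the multiplication
  maps carry identities between logarithmic derivatives from \<open>A\<close> down to
  \<open>E\<close>.\<close>

locale regular_representation =
  fixes E A :: "'a::field_char_0 set" and d :: nat and e :: "nat \<Rightarrow> 'a" and D :: "'a \<Rightarrow> 'a"
  assumes E: "is_subfield E" and A: "is_subring A" and EA: "E \<subseteq> A"
    and e: "\<And>i. i < d \<Longrightarrow> e i \<in> A"
    and spans: "\<And>x. x \<in> A \<Longrightarrow> \<exists>a. (\<forall>j. a j \<in> E) \<and> x = (\<Sum>j<d. a j * e j)"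
    and indep: "\<And>a. (\<And>j. a j \<in> E) \<Longrightarrow> (\<Sum>j<d. a j * e j) = 0 \<Longrightarrow> (\<And>j. j < d \<Longrightarrow> a j = 0)"
    and inverse_A: "\<And>x. x \<in> A \<Longrightarrow> inverse x \<in> A"
    and D: "derivation D" and D_E: "\<And>x. x \<in> E \<Longrightarrow> D x \<in> E" and D_A: "\<And>x. x \<in> A \<Longrightarrow> D x \<in> A"
begin

lemmas E_closed = subring_closed[OF subfield_subring[OF E]]
lemmas A_closed = subring_closed[OF A]

definition coord :: "'a \<Rightarrow> nat \<Rightarrow> 'a" where
  "coord x = (SOME a. (\<forall>j. a j \<in> E) \<and> x = (\<Sum>j<d. a j * e j))"

lemma coord:
  assumes "x \<in> A" shows "coord x j \<in> E" "(\<Sum>j<d. coord x j * e j) = x"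
proof -
  have *: "(\<forall>j. coord x j \<in> E) \<and> x = (\<Sum>j<d. coord x j * e j)"
    unfolding coord_def by (rule someI_ex[OF spans[OF assms]])
  show "coord x j \<in> E" using * by blast
  show "(\<Sum>j<d. coord x j * e j) = x" by (rule conjunct2[OF *, symmetric])
qed

lemma coord_unique:
  assumes "\<And>j. j < d \<Longrightarrow> a j \<in> E" "x \<in> A" "x = (\<Sum>j<d. a j * e j)" "j < d"
  shows "coord x j = a j"
proof -
  let ?b = "\<lambda>j. if j < d then coord x j - a j else 0"
  have "(\<Sum>j<d. ?b j * e j) = (\<Sum>j<d. coord x j * e j) - (\<Sum>j<d. a j * e j)"
    by (simp add: left_diff_distrib sum_subtractf)
  also have "\<dots> = 0" by (simp only: coord(2)[OF assms(2)] assms(3)[symmetric] diff_self)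
  finally have "?b j = 0"
    by (rule indep[rotated]) (use assms(1,2,4) coord(1) in \<open>simp_all add: E_closed\<close>)
  then show ?thesis using assms(4) by simp
qed

text \<open>Row \<open>i\<close> holds the coordinates of \<open>z * e i\<close>, so products are
  represented in reverse order.\<close>

definition rep :: "'a \<Rightarrow> 'a mat" where
  "rep z = mat d d (\<lambda>(i, j). coord (z * e i) j)"

lemma rep_carrier [simp]: "rep z \<in> carrier_mat d d" "dim_row (rep z) = d" "dim_col (rep z) = d"
  by (simp_all add: rep_def)

lemma rep_entry: "z \<in> A \<Longrightarrow> i < d \<Longrightarrow> j < d \<Longrightarrow> rep z $$ (i, j) \<in> E"
  by (simp add: rep_def coord(1) A_closed e)

lemma rep_expand: "z \<in> A \<Longrightarrow> i < d \<Longrightarrow> (\<Sum>j<d. rep z $$ (i, j) * e j) = z * e i"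
  using coord(2)[of "z * e i"] by (simp add: rep_def A_closed e)

lemma rep_unique:
  assumes "z \<in> A" "M \<in> carrier_mat d d" "\<And>i j. i < d \<Longrightarrow> j < d \<Longrightarrow> M $$ (i, j) \<in> E"
    and "\<And>i. i < d \<Longrightarrow> (\<Sum>j<d. M $$ (i, j) * e j) = z * e i"
  shows "rep z = M"
proof (rule eq_matI)
  fix i j assume "i < dim_row M" "j < dim_col M"
  then have ij: "i < d" "j < d" using assms(2) by auto
  have "coord (z * e i) j = M $$ (i, j)"
    by (rule coord_unique[where a = "\<lambda>j. M $$ (i, j)", OF assms(3)[OF ij(1)] _ assms(4)[OF ij(1),
        symmetric] ij(2)])
       (simp_all add: assms(1) A_closed e ij)
  then show "rep z $$ (i, j) = M $$ (i, j)" using ij by (simp add: rep_def)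
qed (use assms in auto)

lemma rep_mult:
  assumes "z \<in> A" "w \<in> A" shows "rep (z * w) = rep w * rep z"
proof (rule rep_unique)
  show "(rep w * rep z) $$ (i, j) \<in> E" if "i < d" "j < d" for i j
    using that assms by (auto simp: scalar_prod_def intro!: subring_sum subfield_subring E
        E_closed rep_entry)
  show "(\<Sum>j<d. (rep w * rep z) $$ (i, j) * e j) = z * w * e i" if i: "i < d" for i
  proof -
    have "(\<Sum>j<d. (rep w * rep z) $$ (i, j) * e j) = (\<Sum>j<d. (\<Sum>k<d. rep w $$ (i, k) * rep z $$ (k,
        j)) * e j)"
      using i by (intro sum.cong) (auto simp: scalar_prod_def atLeast0LessThan)
    also have "\<dots> = (\<Sum>k<d. rep w $$ (i, k) * (\<Sum>j<d. rep z $$ (k, j) * e j))"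
      unfolding sum_distrib_right sum_distrib_left by (subst sum.swap) (simp add: mult.assoc)
    also have "\<dots> = (\<Sum>k<d. rep w $$ (i, k) * (z * e k))"
      using assms by (intro sum.cong) (auto simp: rep_expand)
    also have "\<dots> = z * (\<Sum>k<d. rep w $$ (i, k) * e k)" by (simp add: sum_distrib_left mult_ac)
    finally show ?thesis using rep_expand[OF assms(2) i] by (simp add: mult.assoc)
  qed
qed (use assms A_closed in \<open>auto intro: mult_carrier_mat[of _ d d _ d]\<close>)

lemma rep_scalar:
  assumes "c \<in> E" shows "rep c = c \<cdot>\<^sub>m 1\<^sub>m d"
proof (rule rep_unique)
  show "(\<Sum>j<d. (c \<cdot>\<^sub>m 1\<^sub>m d) $$ (i, j) * e j) = c * e i" if "i < d" for i
    using that by (simp add: if_distrib[of "\<lambda>t. _ * t"] if_distrib[of "\<lambda>t. t * _"] cong: if_cong)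
qed (use assms EA E_closed in auto)

lemma rep_add:
  assumes "z \<in> A" "w \<in> A" shows "rep (z + w) = rep z + rep w"
  by (rule rep_unique) (use assms A_closed E_closed in
    \<open>auto simp: rep_entry distrib_right sum.distrib rep_expand intro: add_carrier_mat[of _ d d]\<close>)

definition reg_trace :: "'a \<Rightarrow> 'a" where "reg_trace z = mat_trace (rep z)"
definition reg_norm :: "'a \<Rightarrow> 'a" where "reg_norm z = det (rep z)"

lemma reg_trace_in: "z \<in> A \<Longrightarrow> reg_trace z \<in> E"
  by (auto simp: reg_trace_def mat_trace_def intro!: subring_sum subfield_subring E rep_entry)

lemma reg_norm_in:
  assumes "z \<in> A" shows "reg_norm z \<in> E"
proof -
  have "signof p \<in> E" for p :: "nat \<Rightarrow> nat" using E_closed(2,5) by (auto simp: sign_def)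
  moreover have "rep z $$ (i, p i) \<in> E" if "p permutes {0..<d}" "i < d" for p i
    using assms permutes_in_image[OF that(1), of i] that(2) by (intro rep_entry) auto
  ultimately show ?thesis
    unfolding reg_norm_def det_def'[OF rep_carrier(1)]
    by (auto intro!: subring_sum subring_prod subfield_subring E E_closed)
qed

lemma reg_norm_mult: "z \<in> A \<Longrightarrow> w \<in> A \<Longrightarrow> reg_norm (z * w) = reg_norm z * reg_norm w"
  by (simp add: reg_norm_def rep_mult det_mult[of _ d] mult.commute)

lemma reg_norm_scalar: "c \<in> E \<Longrightarrow> reg_norm c = c ^ d"
  by (simp add: reg_norm_def rep_scalar)

lemma reg_norm_nonzero:
  assumes "z \<in> A" "z \<noteq> 0" shows "reg_norm z \<noteq> 0"
proof -
  have "reg_norm z * reg_norm (inverse z) = 1"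
    using assms reg_norm_mult[of z "inverse z"] reg_norm_scalar[of 1] E_closed(2) inverse_A by simp
  then show ?thesis by auto
qed

lemma reg_trace_add: "z \<in> A \<Longrightarrow> w \<in> A \<Longrightarrow> reg_trace (z + w) = reg_trace z + reg_trace w"
  by (simp add: reg_trace_def rep_add mat_trace_def sum.distrib)

lemma reg_trace_scale: "c \<in> E \<Longrightarrow> z \<in> A \<Longrightarrow> reg_trace (c * z) = c * reg_trace z"
  using EA by (simp add: reg_trace_def rep_mult[of c] rep_scalar subsetD mat_trace_def
      mult_smult_distrib[OF rep_carrier(1) one_carrier_mat] sum_distrib_left)

text \<open>The basis need not be constant under \<open>D\<close>; its derivatives are recorded
  here, as in the matrix of a connection.\<close>

definition D_rep :: "'a mat" where "D_rep = mat d d (\<lambda>(i, j). coord (D (e i)) j)"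

text \<open>Applying \<open>D\<close> to the expansion of \<open>z * e i\<close> and subtracting
  \<open>z * D (e i)\<close> differentiates the entries and adds a commutator with
  \<open>D_rep\<close>, whose trace is 0.\<close>

lemma rep_D:
  assumes z: "z \<in> A"
  shows "rep (D z) = map_mat D (rep z) + (rep z * D_rep - D_rep * rep z)"
proof (rule rep_unique)
  have De: "D (e i) \<in> A" if "i < d" for i using that by (simp add: D_A e)
  have DR: "D_rep \<in> carrier_mat d d" by (simp add: D_rep_def)
  have DRe: "D_rep $$ (i, j) \<in> E" if "i < d" "j < d" for i j using that De coord(1) by (simp add:
      D_rep_def)
  have DRx: "(\<Sum>j<d. D_rep $$ (i, j) * e j) = D (e i)" if "i < d" for i
    using coord(2)[OF De[OF that]] that by (simp add: D_rep_def)
  let ?M = "map_mat D (rep z) + (rep z * D_rep - D_rep * rep z)"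
  have entry: "?M $$ (i, j) = D (rep z $$ (i, j)) + ((\<Sum>k<d. rep z $$ (i, k) * D_rep $$ (k, j))
      - (\<Sum>k<d. D_rep $$ (i, k) * rep z $$ (k, j)))" if "i < d" "j < d" for i j
    using that DR by (simp add: scalar_prod_def atLeast0LessThan)
  show "D z \<in> A" using z by (rule D_A)
  show "?M \<in> carrier_mat d d" using DR by auto
  show "?M $$ (i, j) \<in> E" if "i < d" "j < d" for i j
    unfolding entry[OF that] using that z DRe
    by (auto intro!: E_closed subring_sum subfield_subring E D_E rep_entry)
  show "(\<Sum>j<d. ?M $$ (i, j) * e j) = D z * e i" if i: "i < d" for i
  proof -
    have "(\<Sum>j<d. ?M $$ (i, j) * e j) = (\<Sum>j<d. D (rep z $$ (i, j)) * e j)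
        + ((\<Sum>j<d. (\<Sum>k<d. rep z $$ (i, k) * D_rep $$ (k, j)) * e j)
           - (\<Sum>j<d. (\<Sum>k<d. D_rep $$ (i, k) * rep z $$ (k, j)) * e j))"
      using i by (simp add: entry algebra_simps sum.distrib sum_subtractf)
    also have "(\<Sum>j<d. (\<Sum>k<d. rep z $$ (i, k) * D_rep $$ (k, j)) * e j) = (\<Sum>k<d. rep z $$ (i, k) *
        D (e k))"
    proof -
      have "(\<Sum>j<d. (\<Sum>k<d. rep z $$ (i, k) * D_rep $$ (k, j)) * e j) =
          (\<Sum>k<d. rep z $$ (i, k) * (\<Sum>j<d. D_rep $$ (k, j) * e j))"
        unfolding sum_distrib_right sum_distrib_left by (subst sum.swap) (simp add: mult.assoc)
      then show ?thesis by (simp add: DRx)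
    qed
    also have "(\<Sum>j<d. (\<Sum>k<d. D_rep $$ (i, k) * rep z $$ (k, j)) * e j) = z * D (e i)"
    proof -
      have "(\<Sum>j<d. (\<Sum>k<d. D_rep $$ (i, k) * rep z $$ (k, j)) * e j) =
          (\<Sum>k<d. D_rep $$ (i, k) * (\<Sum>j<d. rep z $$ (k, j) * e j))"
        unfolding sum_distrib_right sum_distrib_left by (subst sum.swap) (simp add: mult.assoc)
      also have "\<dots> = (\<Sum>k<d. D_rep $$ (i, k) * (z * e k))"
        by (intro sum.cong) (auto simp: rep_expand[OF z])
      also have "\<dots> = z * (\<Sum>k<d. D_rep $$ (i, k) * e k)"
        by (simp add: sum_distrib_left mult_ac)
      finally show ?thesis by (simp add: DRx i)
    qed
    also have "(\<Sum>j<d. D (rep z $$ (i, j)) * e j) = D (z * e i) - (\<Sum>k<d. rep z $$ (i, k) * D (e k))"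
      unfolding rep_expand[OF z i, symmetric]
      by (simp add: derivation_sum[OF D] derivation_mult[OF D] sum.distrib)
    finally show ?thesis by (simp add: derivation_mult[OF D])
  qed
qed

lemma D_rep_carrier [simp]: "D_rep \<in> carrier_mat d d"
  by (simp add: D_rep_def)

lemma mat_trace_add: "X \<in> carrier_mat d d \<Longrightarrow> Y \<in> carrier_mat d d \<Longrightarrow> mat_trace (X + Y) = mat_trace X
    + mat_trace Y"
  by (auto simp: mat_trace_def sum.distrib)

lemma mat_trace_diff: "X \<in> carrier_mat d d \<Longrightarrow> Y \<in> carrier_mat d d \<Longrightarrow> mat_trace (X - Y) = mat_trace X
    - mat_trace Y"
  by (auto simp: mat_trace_def sum_subtractf)

lemma reg_trace_D: "z \<in> A \<Longrightarrow> reg_trace (D z) = D (reg_trace z)"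
proof -
  assume z: "z \<in> A"
  have c: "rep z * D_rep \<in> carrier_mat d d" "D_rep * rep z \<in> carrier_mat d d"
    by (auto intro: mult_carrier_mat[of _ d d _ d])
  have "reg_trace (D z) = mat_trace (map_mat D (rep z)) + (mat_trace (rep z * D_rep) - mat_trace
      (D_rep * rep z))"
    unfolding reg_trace_def rep_D[OF z] using c by (simp add: mat_trace_add mat_trace_diff
        minus_carrier_mat)
  also have "\<dots> = mat_trace (map_mat D (rep z))" using mat_trace_comm[of "rep z" d D_rep] by simp
  also have "\<dots> = D (reg_trace z)" by (simp add: mat_trace_def reg_trace_def derivation_sum[OF D])
  finally show ?thesis .
qed

text \<open>In the trace of \<open>rep (inverse z) * rep (D z)\<close> the commutator part cancels,
  because conjugation by \<open>rep z\<close> preserves the trace of \<open>D_rep\<close>. The rest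
  is the inverse matrix times the differentiated one, whose trace is the logarithmic derivative of
  the determinant by Jacobi's formula and the adjugate.\<close>

lemma reg_trace_log_derivative:
  assumes z: "z \<in> A" "z \<noteq> 0"
  shows "reg_trace (D z / z) = D (reg_norm z) / reg_norm z"
proof -
  let ?M = "rep z" and ?N = "rep (inverse z)" and ?B = D_rep
  have iz: "inverse z \<in> A" using z inverse_A by blast
  have c: "?M \<in> carrier_mat d d" "?N \<in> carrier_mat d d" "?B \<in> carrier_mat d d" "map_mat D ?M \<in>
      carrier_mat d d" by auto
  have one: "rep 1 = 1\<^sub>m d" using rep_scalar[OF E_closed(2)] by auto
  have MN: "?N * ?M = 1\<^sub>m d" "?M * ?N = 1\<^sub>m d"
    using rep_mult[OF z(1) iz] rep_mult[OF iz z(1)] z(2) one by simp_all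
  have "?N * (?M * ?B) = ?N * ?M * ?B" by (rule assoc_mult_mat[of _ d d _ d _ d, symmetric]) (use
      c in auto)
  also have "\<dots> = ?B" unfolding MN(1) by (rule left_mult_one_mat[of _ d d]) (use c in auto)
  finally have 1: "?N * (?M * ?B) = ?B" .
  have "mat_trace (?N * (?B * ?M)) = mat_trace (?B * ?M * ?N)"
    by (rule mat_trace_comm[where n = d]) (use c in \<open>auto intro: mult_carrier_mat[of _ d d _ d]\<close>)
  also have "?B * ?M * ?N = ?B * (?M * ?N)" by (rule assoc_mult_mat[of _ d d _ d _ d]) (use c in auto)
  also have "\<dots> = ?B" unfolding MN(2) by (rule right_mult_one_mat[of _ d d]) (use c in auto)
  finally have 2: "mat_trace (?N * (?B * ?M)) = mat_trace ?B" .
  have "D z / z = D z * inverse z" by (simp add: divide_inverse)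
  then have "reg_trace (D z / z) = mat_trace (?N * rep (D z))"
    unfolding reg_trace_def using rep_mult[OF D_A[OF z(1)] iz] by simp
  also have "?N * rep (D z) = ?N * map_mat D ?M + (?N * (?M * ?B) - ?N * (?B * ?M))"
  proof -
    have p: "?M * ?B \<in> carrier_mat d d" "?B * ?M \<in> carrier_mat d d" using c by (auto intro:
        mult_carrier_mat[of _ d d _ d])
    have "?N * (map_mat D ?M + (?M * ?B - ?B * ?M)) = ?N * map_mat D ?M + ?N * (?M * ?B - ?B * ?M)"
      by (rule mult_add_distrib_mat[OF c(2,4) minus_carrier_mat[OF p(2)]])
    then show ?thesis unfolding rep_D[OF z(1)] mult_minus_distrib_mat[OF c(2) p] .
  qed
  also have "mat_trace \<dots> = mat_trace (?N * map_mat D ?M) + (mat_trace (?N * (?M * ?B)) - mat_trace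
      (?N * (?B * ?M)))"
    using c by (simp add: mat_trace_add mat_trace_diff mult_carrier_mat[of _ d d _ d] minus_carrier_mat)
  also have "\<dots> = mat_trace (?N * map_mat D ?M)" by (simp add: 1 2)
  finally have tr: "reg_trace (D z / z) = mat_trace (?N * map_mat D ?M)" .
  have adj: "adj_mat ?M = reg_norm z \<cdot>\<^sub>m ?N"
  proof -
    have "adj_mat ?M = adj_mat ?M * (?M * ?N)"
      unfolding MN(2) using adj_mat(1)[OF c(1)] by simp
    also have "\<dots> = adj_mat ?M * ?M * ?N" by (rule assoc_mult_mat[of _ d d _ d _ d, symmetric])
        (use c adj_mat(1)[OF c(1)] in auto)
    also have "\<dots> = reg_norm z \<cdot>\<^sub>m ?N"
      unfolding adj_mat(3)[OF c(1)] reg_norm_def mult_smult_assoc_mat[OF one_carrier_mat c(2)]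
        left_mult_one_mat[OF c(2)] ..
    finally show ?thesis .
  qed
  have "D (reg_norm z) = (\<Sum>i<d. \<Sum>j<d. D (?M $$ (i, j)) * cofactor ?M i j)"
    unfolding reg_norm_def by (rule derivation_det[OF D c(1)])
  also have "\<dots> = (\<Sum>i<d. \<Sum>j<d. reg_norm z * (?N $$ (j, i) * D (?M $$ (i, j))))"
  proof (intro sum.cong refl)
    fix i j assume ij: "i \<in> {..<d}" "j \<in> {..<d}"
    have "cofactor ?M i j = adj_mat ?M $$ (j, i)" using ij by (simp add: adj_mat_def)
    then show "D (?M $$ (i, j)) * cofactor ?M i j = reg_norm z * (?N $$ (j, i) * D (?M $$ (i, j)))"
      using ij by (simp add: adj mult_ac)
  qed
  also have "\<dots> = reg_norm z * mat_trace (?N * map_mat D ?M)"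
    unfolding mat_trace_mult[OF c(2,4)] by (subst sum.swap) (auto simp: sum_distrib_left intro!:
        sum.cong)
  finally show ?thesis using tr reg_norm_nonzero[OF z] by simp
qed

end

section \<open>Orders and residues\<close>

definition fls_of_poly :: "'a::field_char_0 poly \<Rightarrow> 'a fls" where
  "fls_of_poly P = fps_to_fls (fps_of_poly P)"

lemma fls_of_poly_simps:
  "fls_of_poly (P + Q) = fls_of_poly P + fls_of_poly Q"
  "fls_of_poly (P * Q) = fls_of_poly P * fls_of_poly Q"
  "fls_of_poly P = 0 \<longleftrightarrow> P = 0"
  "fls_of_poly (pderiv P) = fls_deriv (fls_of_poly P)"
  "fls_of_poly 1 = 1" "fls_of_poly [:c:] = fls_const c" "fls_of_poly [:0, 1:] = fls_X"
  by (simp_all add: fls_of_poly_def fps_of_poly_add fps_of_poly_mult fls_times_fps_to_fls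
      fps_of_poly_pderiv fls_deriv_fps_to_fls fps_of_poly_const)

context
  fixes K :: "'a::field_char_0 set" and t :: 'a
  assumes K: "is_subring K" and t: "transcendental_over K t"
begin

text \<open>The Laurent expansion at 0 of a rational function, with the transcendental
  \<open>t\<close> read as the indeterminate. The choice of numerator and denominator does not
  matter because \<open>t\<close> satisfies no equation over \<open>K\<close>.\<close>

definition expansion :: "'a \<Rightarrow> 'a fls" where
  "expansion u = (THE f. \<exists>P\<in>poly_over K. \<exists>Q\<in>poly_over K.
     poly Q t \<noteq> 0 \<and> u = poly P t / poly Q t \<and> f = fls_of_poly P / fls_of_poly Q)"

lemma expansion_quotient:
  assumes "P \<in> poly_over K" "Q \<in> poly_over K" "poly Q t \<noteq> 0"
  shows "expansion (poly P t / poly Q t) = fls_of_poly P / fls_of_poly Q"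
  unfolding expansion_def
proof (rule the_equality)
  fix f assume "\<exists>P'\<in>poly_over K. \<exists>Q'\<in>poly_over K. poly Q' t \<noteq> 0 \<and>
    poly P t / poly Q t = poly P' t / poly Q' t \<and> f = fls_of_poly P' / fls_of_poly Q'"
  then obtain P' Q' where *: "P' \<in> poly_over K" "Q' \<in> poly_over K" "poly Q' t \<noteq> 0"
    "poly P t / poly Q t = poly P' t / poly Q' t" "f = fls_of_poly P' / fls_of_poly Q'" by blast
  note PK = subring_closed[OF is_subring_poly_over[OF K]]
  have "P' * Q - P * Q' \<in> poly_over K" using * assms by (intro PK)
  moreover have "poly (P' * Q - P * Q') t = 0" using * assms by (simp add: field_simps)
  ultimately have "P' * Q - P * Q' = 0" using t unfolding transcendental_over_def by blast
  then have "fls_of_poly P' * fls_of_poly Q = fls_of_poly P * fls_of_poly Q'"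
    by (simp flip: fls_of_poly_simps(2))
  moreover have "Q \<noteq> 0" "Q' \<noteq> 0" using assms * by auto
  ultimately show "f = fls_of_poly P / fls_of_poly Q"
    using *(5) by (simp add: frac_eq_eq fls_of_poly_simps(3))
qed (use assms in blast)

lemma adjoin_cases:
  assumes "u \<in> adjoin K t"
  obtains P Q where "P \<in> poly_over K" "Q \<in> poly_over K" "poly Q t \<noteq> 0" "u = poly P t / poly Q t"
  using assms unfolding adjoin_def by blast

lemma expansion_poly: "P \<in> poly_over K \<Longrightarrow> expansion (poly P t) = fls_of_poly P"
  using expansion_quotient[of P 1] subring_closed(2)[OF is_subring_poly_over[OF K]]
  by (simp add: fls_of_poly_simps)

lemma expansion_add:
  assumes "u \<in> adjoin K t" "v \<in> adjoin K t" shows "expansion (u + v) = expansion u + expansion v"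
proof -
  obtain P Q where 1: "P \<in> poly_over K" "Q \<in> poly_over K" "poly Q t \<noteq> 0" "u = poly P t / poly Q t"
    by (rule adjoin_cases[OF assms(1)])
  obtain R S where 2: "R \<in> poly_over K" "S \<in> poly_over K" "poly S t \<noteq> 0" "v = poly R t / poly S t"
    by (rule adjoin_cases[OF assms(2)])
  note PK = subring_closed[OF is_subring_poly_over[OF K]]
  have "u + v = poly (P * S + R * Q) t / poly (Q * S) t" using 1 2 by (simp add: add_frac_eq)
  also have "expansion \<dots> = fls_of_poly (P * S + R * Q) / fls_of_poly (Q * S)"
    using 1 2 by (intro expansion_quotient PK) auto
  also have "\<dots> = fls_of_poly P / fls_of_poly Q + fls_of_poly R / fls_of_poly S"
  proof -
    have "Q \<noteq> 0" "S \<noteq> 0" using 1 2 by auto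
    then show ?thesis by (simp add: fls_of_poly_simps(1-3) add_frac_eq)
  qed
  finally show ?thesis using 1 2 by (simp add: expansion_quotient)
qed

lemma expansion_mult:
  assumes "u \<in> adjoin K t" "v \<in> adjoin K t" shows "expansion (u * v) = expansion u * expansion v"
proof -
  obtain P Q where 1: "P \<in> poly_over K" "Q \<in> poly_over K" "poly Q t \<noteq> 0" "u = poly P t / poly Q t"
    by (rule adjoin_cases[OF assms(1)])
  obtain R S where 2: "R \<in> poly_over K" "S \<in> poly_over K" "poly S t \<noteq> 0" "v = poly R t / poly S t"
    by (rule adjoin_cases[OF assms(2)])
  note PK = subring_closed[OF is_subring_poly_over[OF K]]
  have "u * v = poly (P * R) t / poly (Q * S) t" using 1 2 by simp
  also have "expansion \<dots> = fls_of_poly (P * R) / fls_of_poly (Q * S)"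
    using 1 2 by (intro expansion_quotient PK) auto
  finally show ?thesis using 1 2 by (simp add: expansion_quotient fls_of_poly_simps(2))
qed

lemma expansion_const: "c \<in> K \<Longrightarrow> expansion c = fls_const c"
  using expansion_poly[OF poly_over_const[OF subring_closed(1)[OF K]]] by (simp add: fls_of_poly_simps)

lemma expansion_nonzero:
  assumes "u \<in> adjoin K t" "u \<noteq> 0" shows "expansion u \<noteq> 0"
  using expansion_mult[OF assms(1) subfield_inverse[OF is_subfield_adjoin[OF K] assms(1)]]
    expansion_const[OF subring_closed(2)[OF K]] assms(2) by auto

lemma expansion_generator: "expansion t = fls_X"
  using expansion_poly[OF poly_over_pCons[OF subring_closed(1)[OF K] poly_over_const[OF
      subring_closed(1,2)[OF K]]]]
  by (simp add: fls_of_poly_simps)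

context
  fixes D :: "'a \<Rightarrow> 'a"
  assumes D: "D \<in> derivations_over K" and Dt: "D t = 1"
begin

lemma derivation_poly_generator: "P \<in> poly_over K \<Longrightarrow> D (poly P t) = poly (pderiv P) t"
proof -
  assume P: "P \<in> poly_over K"
  have D': "derivation D" "\<And>c. c \<in> K \<Longrightarrow> D c = 0" using D by (auto simp: derivations_over_def)
  have "map_poly D P = 0"
    using P D'(2) by (intro poly_eqI) (simp add: poly_over_def coeff_map_poly derivation_0[OF D'(1)])
  then show ?thesis using derivation_poly[OF D'(1), of P t] Dt by simp
qed

text \<open>Under the expansion \<open>D\<close> becomes formal differentiation: both are applied to
  \<open>u * Q = P\<close>, and the resulting equations determine the two derivatives of
  \<open>u\<close> in the same way.\<close>

lemma expansion_derivation:
  assumes "u \<in> adjoin K t"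
  shows "D u \<in> adjoin K t" "expansion (D u) = fls_deriv (expansion u)"
proof -
  obtain P Q where *: "P \<in> poly_over K" "Q \<in> poly_over K" "poly Q t \<noteq> 0" "u = poly P t / poly Q t"
    by (rule adjoin_cases[OF assms])
  have D': "derivation D" using D by (auto simp: derivations_over_def)
  note F = is_subfield_adjoin[OF K, of t]
  note FR = subring_closed[OF subfield_subring[OF F]]
  note in_E = poly_in_adjoin[OF K, of _ t]
  note pd = poly_over_pderiv[OF K]
  have uQ: "u * poly Q t = poly P t" using * by simp
  then have eq: "D u * poly Q t + u * poly (pderiv Q) t = poly (pderiv P) t"
    using derivation_mult[OF D', of u "poly Q t"] * by (simp add: derivation_poly_generator)
  have "D u = (poly (pderiv P) t - u * poly (pderiv Q) t) / poly Q t"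
    using eq *(3) by (simp add: field_simps)
  also have "\<dots> \<in> adjoin K t"
    by (intro subfield_divide[OF F] FR(6) FR(4) in_E pd assms *(1,2))
  finally show Du: "D u \<in> adjoin K t" .
  have "expansion (D u) * fls_of_poly Q + expansion u * fls_of_poly (pderiv Q) = fls_of_poly (pderiv P)"
    using arg_cong[OF eq, of expansion] *(1-3) assms Du in_E pd FR
    by (simp add: expansion_add expansion_mult expansion_poly)
  moreover have "fls_deriv (expansion u) * fls_of_poly Q + expansion u * fls_of_poly (pderiv Q) =
      fls_of_poly (pderiv P)"
  proof -
    have "expansion u * fls_of_poly Q = fls_of_poly P"
      using arg_cong[OF uQ, of expansion] *(1-3) assms in_E by (simp add: expansion_mult expansion_poly)
    from arg_cong[OF this, of fls_deriv] show ?thesis by (simp add: fls_of_poly_simps(4) add.commute)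
  qed
  moreover have "fls_of_poly Q \<noteq> 0" using *(3) by (auto simp: fls_of_poly_simps(3))
  ultimately show "expansion (D u) = fls_deriv (expansion u)"
    by (metis add_right_cancel mult_right_cancel)
qed

end

end

text \<open>\<open>ord y\<close> is the order of vanishing at \<open>t = 0\<close> of the norm of \<open>y\<close> down to \<open>K(t)\<close>, where \<open>K\<close> is
  maximal such that \<open>t\<close> is transcendental over it; the relation follows by taking the residue of
  the trace.\<close>
theorem exists_order_function:
  fixes C :: "'a::field_char_0 set"
  assumes C: "is_subfield C" and t: "transcendental_over C t" and Y: "finite Y"
  shows "\<exists>D\<in>derivations_over C. \<exists>A ord. is_subfield A \<and> insert t Y \<subseteq> A \<and>
    (\<forall>a\<in>A. \<forall>b\<in>A. a \<noteq> 0 \<longrightarrow> b \<noteq> 0 \<longrightarrow> ord (a * b) = ord a + ord b) \<and> ord t \<noteq> (0 :: int) \<and>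
    (\<forall>(M :: nat) c y h. (\<forall>j<M. c j \<in> C \<and> y j \<in> A \<and> y j \<noteq> 0) \<longrightarrow> h \<in> A \<longrightarrow>
       (\<Sum>j<M. c j * (D (y j) / y j)) = D h \<longrightarrow> (\<Sum>j<M. c j * of_int (ord (y j))) = 0)"
proof -
  obtain K where K: "is_subfield K" "C \<subseteq> K" "transcendental_over K t"
    and alg: "\<And>z. \<not> transcendental_over (adjoin K t) z"
    using exists_maximal_coefficient_field[OF C t] by blast
  note KR = subfield_subring[OF K(1)]
  obtain D where der: "D \<in> derivations_over K" "D t = 1" using exists_derivation[OF KR K(3)] by blast
  have D': "derivation D" using der by (auto simp: derivations_over_def)
  define E where "E = adjoin K t"
  have E: "is_subfield E" unfolding E_def by (rule is_subfield_adjoin[OF KR])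
  note ex = expansion_derivation[OF KR K(3) der, folded E_def]
  note alg = alg[folded E_def]
  have KE: "insert t K \<subseteq> E" unfolding E_def by (rule subset_adjoin[OF KR])
  obtain A S where ring: "is_subring A" "E \<union> Y \<subseteq> A" "finite S" "A = lin_span E S"
    and ind: "\<And>a. \<forall>s. a s \<in> E \<Longrightarrow> (\<Sum>s\<in>S. a s * s) = 0 \<Longrightarrow> \<forall>s\<in>S. a s = 0"
    using exists_finite_basis[OF E Y alg] by blast
  obtain e where e: "bij_betw e {..<card S} S"
    using ex_bij_betw_nat_finite[OF ring(3)] by (auto simp: atLeast0LessThan)
  define d where "d = card S"
  note e = e[folded d_def]
  have EA: "E \<subseteq> A" using ring(2) by blast
  have inv: "inverse x \<in> A" if "x \<in> A" for x
    by (rule inverse_in_algebraic_subring[OF E ring(1) EA that alg])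
  have reidx: "(\<Sum>j<d. f (e j) * e j) = (\<Sum>s\<in>S. f s * s)" for f
    by (rule sum.reindex_bij_betw[OF e])
  interpret regular_representation E A d e D
  proof
    show "e i \<in> A" if "i < d" for i
      using bij_betwE[OF e] that lin_span_base[OF E ring(3)] ring(4) by blast
    show "\<exists>a. (\<forall>j. a j \<in> E) \<and> x = (\<Sum>j<d. a j * e j)" if x: "x \<in> A" for x
    proof -
      obtain f where "x = (\<Sum>s\<in>S. f s * s)" "\<And>s. f s \<in> E" using x ring(4) unfolding lin_span_def by blast
      then show ?thesis using reidx[of f] by (intro exI[of _ "\<lambda>j. f (e j)"]) simp
    qed
    show "a j = 0" if a: "\<And>j. a j \<in> E" "(\<Sum>j<d. a j * e j) = 0" and j: "j < d" for a j
    proof -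
      define f where "f s = a (inv_into {..<d} e s)" for s
      have fe: "f (e i) = a i" if "i < d" for i
        using bij_betw_imp_inj_on[OF e] that by (simp add: f_def)
      have "(\<Sum>s\<in>S. f s * s) = (\<Sum>j<d. a j * e j)"
        unfolding reidx[of f, symmetric] by (intro sum.cong) (auto simp: fe)
      then have "\<forall>s\<in>S. f s = 0" using a by (intro ind) (auto simp: f_def)
      then show ?thesis using fe[OF j] bij_betwE[OF e] j by auto
    qed
    show "D x \<in> A" if "x \<in> A" for x
      by (rule derivation_in_algebraic_subring[OF E ring(1) EA that alg D' ex(1)])
  qed (use E ring(1) EA inv D' ex(1) in auto)
  define \<psi> where "\<psi> = expansion K t"
  define ord where "ord a = fls_subdegree (\<psi> (reg_norm a))" for a
  define \<rho> where "\<rho> a = fls_residue (\<psi> (reg_trace a))" for a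
  note \<psi>_add = expansion_add[OF KR K(3), folded \<psi>_def E_def]
  note \<psi>_mult = expansion_mult[OF KR K(3), folded \<psi>_def E_def]
  note \<psi>_nonzero = expansion_nonzero[OF KR K(3), folded \<psi>_def E_def]
  note \<psi>_const = expansion_const[OF KR K(3), folded \<psi>_def]
  note \<psi>_D = ex(2)[folded \<psi>_def]
  have "is_subfield A"
    using ring(1) inv by (auto simp: is_subfield_def is_subring_def)
  moreover have "insert t Y \<subseteq> A" using ring(2) KE by blast
  moreover have "ord (a * b) = ord a + ord b" if "a \<in> A" "b \<in> A" "a \<noteq> 0" "b \<noteq> 0" for a b
    using that by (simp add: ord_def reg_norm_mult \<psi>_mult reg_norm_in \<psi>_nonzero reg_norm_nonzero)
  moreover have "ord t \<noteq> 0"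
  proof -
    have tE: "t \<in> E" using KE by blast
    have "d \<noteq> 0"
      using coord(2)[of 1] A_closed(2) by (metis lessThan_0 sum.empty zero_neq_one)
    have "\<psi> (t ^ n) = fls_X ^ n" for n
    proof (induction n)
      case 0
      then show ?case using \<psi>_const[OF subring_closed(2)[OF KR]] by simp
    next
      case (Suc n)
      have "\<psi> (t ^ Suc n) = \<psi> t * \<psi> (t ^ n)"
        using tE by (simp add: \<psi>_mult subring_power[OF subfield_subring[OF E]])
      then show ?case using Suc expansion_generator[OF KR K(3)] by (simp add: \<psi>_def)
    qed
    \<comment> \<open>As an element of the base field, \<open>t\<close> has norm
      \<open>t ^ d\<close>, whose order is the degree \<open>d\<close> of the extension.\<close>
    then have "ord t = int d" using tE by (simp add: ord_def reg_norm_scalar)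
    then show ?thesis using \<open>d \<noteq> 0\<close> by simp
  qed
  moreover have "(\<Sum>j<M. c j * of_int (ord (y j))) = 0"
    if c: "\<forall>j<M. c j \<in> C \<and> y j \<in> A \<and> y j \<noteq> 0" and h: "h \<in> A"
      and eq: "(\<Sum>j<M. c j * (D (y j) / y j)) = D h" for M :: nat and c y h
  proof -
    have \<rho>_add: "\<rho> (a + b) = \<rho> a + \<rho> b" if "a \<in> A" "b \<in> A" for a b
      using that by (simp add: \<rho>_def reg_trace_add \<psi>_add reg_trace_in)
    have \<rho>_scale: "\<rho> (c * a) = c * \<rho> a" if "c \<in> K" "a \<in> A" for c a
      using that KE by (simp add: \<rho>_def reg_trace_scale \<psi>_mult reg_trace_in \<psi>_const subset_iff)
    \<comment> \<open>The trace of a logarithmic derivative is the logarithmic derivative of the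
      norm, and the residue of that is the order of the norm.\<close>
    have \<rho>_log: "\<rho> (D a / a) = of_int (ord a)" if "a \<in> A" "a \<noteq> 0" for a
    proof -
      have nE: "reg_norm a \<in> E" "reg_norm a \<noteq> 0" using that by (auto simp: reg_norm_in reg_norm_nonzero)
      have "\<psi> (D (reg_norm a) / reg_norm a) * \<psi> (reg_norm a) = fls_deriv (\<psi> (reg_norm a))"
        using nE \<psi>_mult[of "D (reg_norm a) / reg_norm a" "reg_norm a"] ex(1) subfield_divide[OF E]
        by (simp add: \<psi>_D)
      then have "\<psi> (D (reg_norm a) / reg_norm a) = fls_deriv (\<psi> (reg_norm a)) * inverse (\<psi>
          (reg_norm a))"
        using \<psi>_nonzero[OF nE] by (metis mult.assoc right_inverse mult.right_neutral)
      then show ?thesis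
        unfolding \<rho>_def reg_trace_log_derivative[OF that] ord_def
        by (simp only: fls_residue_deriv_times_inverse_eq_subdegree)
    qed
    have in_A: "c j * (D (y j) / y j) \<in> A" if "j < M" for j
      using c that K(2) KE EA D_A inv A_closed(4) by (metis divide_inverse insert_subset subset_iff)
    have \<rho>_0: "\<rho> 0 = 0" using \<rho>_add[of 0 0] A_closed(1) by simp
    have \<rho>_sum: "\<rho> (\<Sum>j<N. f j) = (\<Sum>j<N. \<rho> (f j))" if "\<And>j. j < N \<Longrightarrow> f j \<in> A" for f and N :: nat
      using that
    proof (induction N)
      case (Suc N)
      have "(\<Sum>j<N. f j) \<in> A" using Suc.prems by (intro subring_sum ring(1)) auto
      then show ?case using Suc by (simp add: \<rho>_add)
    qed (simp add: \<rho>_0)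
    have "\<rho> (\<Sum>j<M. c j * (D (y j) / y j)) = (\<Sum>j<M. \<rho> (c j * (D (y j) / y j)))"
      by (rule \<rho>_sum) (rule in_A)
    also have "\<dots> = (\<Sum>j<M. c j * of_int (ord (y j)))"
    proof (rule sum.cong[OF refl])
      fix j assume "j \<in> {..<M}"
      then have j: "c j \<in> K" "y j \<in> A" "y j \<noteq> 0" using c K(2) by auto
      then have "D (y j) / y j \<in> A" using D_A inv A_closed(4) by (simp add: divide_inverse)
      from \<rho>_scale[OF j(1) this] show "\<rho> (c j * (D (y j) / y j)) = c j * of_int (ord (y j))"
        unfolding \<rho>_log[OF j(2,3)] .
    qed
    \<comment> \<open>The trace commutes with \<open>D\<close>, and a derivative has residue
      0.\<close>
    also have "\<rho> (\<Sum>j<M. c j * (D (y j) / y j)) = 0"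
      unfolding eq \<rho>_def using h by (simp add: reg_trace_D \<psi>_D reg_trace_in)
    finally show ?thesis by simp
  qed
  moreover have "D \<in> derivations_over C" using der K(2) by (auto simp: derivations_over_def)
  ultimately show ?thesis
    by (intro bexI[of _ D] exI[of _ A] exI[of _ ord] conjI allI ballI impI)
qed

section \<open>Ax's theorem\<close>

interpretation rat_real: vector_space "\<lambda>(q :: rat) (x :: real). of_rat q * x"
  by unfold_locales (simp_all add: algebra_simps of_rat_add of_rat_mult)

text \<open>The rational dual of the quotient of \<real> by \<open>C\<close>.\<close>

definition rat_functionals :: "real set \<Rightarrow> (real \<Rightarrow> rat) set" where
  "rat_functionals C = {\<phi>. (\<forall>x y. \<phi> (x + y) = \<phi> x + \<phi> y) \<and> (\<forall>q x. \<phi> (of_rat q * x) = q * \<phi> x) \<and>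
     (\<forall>c\<in>C. \<phi> c = 0)}"

lemma rat_functional_sum: "\<phi> \<in> rat_functionals C \<Longrightarrow> \<phi> (\<Sum>i\<in>I. of_rat (q i) * x i) = (\<Sum>i\<in>I. q i * \<phi> (x i))"
proof -
  assume "\<phi> \<in> rat_functionals C"
  then have \<phi>: "\<phi> (x + y) = \<phi> x + \<phi> y" "\<phi> (of_rat q * x) = q * \<phi> x" for q x y
    by (auto simp: rat_functionals_def)
  have "\<phi> 0 = 0" using \<phi>(2)[of 0 0] by simp
  then show ?thesis by (induction I rule: infinite_finite_induct) (auto simp: \<phi>)
qed

lemma Rats_in_subfield:
  assumes "is_subfield (C :: real set)" shows "\<rat> \<subseteq> C"
proof
  fix x :: real assume "x \<in> \<rat>"
  then obtain a b where "x = of_int a / of_int b" by (rule Rats_cases') 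
  then show "x \<in> C"
    using subring_of_int[OF subfield_subring[OF assms]] subfield_divide[OF assms] by metis
qed

lemma in_subfield_of_rat_functionals:
  assumes C: "is_subfield C" and "\<And>\<phi>. \<phi> \<in> rat_functionals C \<Longrightarrow> \<phi> x = 0"
  shows "x \<in> C"
proof (rule ccontr)
  assume x: "x \<notin> C"
  note R = subring_closed[OF subfield_subring[OF C]]
  have "rat_real.subspace C"
    unfolding rat_real.subspace_def using R Rats_in_subfield[OF C] by (auto intro!: R(4))
  then have "x \<notin> rat_real.span C" using x rat_real.span_minimal[OF order_refl] by blast
  from rat_real.exists_separating_functional[OF this]
  obtain \<phi> :: "real \<Rightarrow> rat" where "\<phi> \<in> rat_functionals C" "\<phi> x = 1"
    unfolding rat_functionals_def by blast
  then show False using assms(2) by force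
qed

lemma is_subfield_Rats: "is_subfield (\<rat> :: real set)"
  by (auto simp: is_subfield_def)

lemma is_subring_Ints: "is_subring (\<int> :: real set)"
  by (auto simp: is_subring_def)

lemma Rats_as_quotient: "x \<in> \<rat> \<Longrightarrow> \<exists>a\<in>\<int>. \<exists>b\<in>\<int>. b \<noteq> 0 \<and> (x :: real) = a / b"
  by (elim Rats_cases') (auto intro!: bexI[of _ "of_int _"])

locale exp_derivation =
  fixes \<delta> :: "real \<Rightarrow> real"
  assumes \<delta>: "derivation \<delta>" and \<delta>_exp: "\<delta> (exp z) = exp z * \<delta> z"
begin

definition C :: "real set" where "C = {c. \<delta> c = 0}"

lemma C_subfield: "is_subfield C"
  unfolding C_def by (rule is_subfield_constants[OF \<delta>])

lemmas C_closed = subring_closed[OF subfield_subring[OF C_subfield]]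

lemma \<delta>_in: "\<delta> \<in> derivations_over C"
  using \<delta> by (simp add: derivations_over_def C_def)

lemma transcendental_over_constants: "z \<notin> C \<Longrightarrow> transcendental_over C z"
  using derivation_algebraic[OF \<delta>_in subfield_subring[OF C_subfield]] by (auto simp: C_def)

text \<open>The form \<open>d(exp z) / exp z - dz\<close> evaluated at \<open>D\<close>: the failure
  of \<open>D\<close> to respect \<open>exp\<close> at \<open>z\<close>.\<close>

definition \<omega> :: "real \<Rightarrow> (real \<Rightarrow> real) \<Rightarrow> real" where
  "\<omega> z D = D (exp z) / exp z - D z"

definition bracket :: "(real \<Rightarrow> real) \<Rightarrow> real \<Rightarrow> real" where
  "bracket D a = \<delta> (D a) - D (\<delta> a)"

lemma bracket_in:
  assumes "D \<in> derivations_over C" shows "bracket D \<in> derivations_over C"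
proof -
  have D: "derivation D" "\<And>c. c \<in> C \<Longrightarrow> D c = 0" using assms by (auto simp: derivations_over_def)
  have "derivation (bracket D)"
    unfolding derivation_def bracket_def
    by (simp add: derivation_add[OF \<delta>] derivation_add[OF D(1)] derivation_mult[OF \<delta>]
        derivation_mult[OF D(1)]
        algebra_simps)
  then show ?thesis
    using D by (auto simp: derivations_over_def bracket_def C_def derivation_0[OF \<delta>]
        derivation_0[OF D(1)])
qed

text \<open>The Lie derivative along \<open>\<delta>\<close> of the closed form \<open>\<omega> z\<close> vanishes because \<open>\<omega> z \<delta> = 0\<close>.\<close>
lemma \<delta>_\<omega>:
  assumes "D \<in> derivations_over C" shows "\<delta> (\<omega> z D) = \<omega> z (bracket D)"
proof -
  have D: "derivation D" using assms by (auto simp: derivations_over_def)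
  have "\<delta> (D (exp z) / exp z) = \<delta> (D (exp z)) / exp z - D (exp z) * \<delta> z / exp z"
    by (subst derivation_divide[OF \<delta>]) (simp_all add: \<delta>_exp power2_eq_square field_simps)
  moreover have "D (\<delta> (exp z)) = D (exp z) * \<delta> z + exp z * D (\<delta> z)"
    unfolding \<delta>_exp by (rule derivation_mult[OF D])
  ultimately show ?thesis
    by (simp add: \<omega>_def bracket_def derivation_diff[OF \<delta>] diff_divide_distrib add_divide_distrib)
qed

text \<open>If the value were nonzero, an integral combination \<zeta> of the \<open>z j\<close>
  would have nonzero value under \<phi>, with weights annihilating every rational relation among the
  \<open>c j\<close>. Then \<open>exp \<zeta>\<close> is not in \<open>C\<close>, and an order
  function can be chosen that is nonzero on it. Residues show that the orders of the
  \<open>exp (z j)\<close> form such a rational relation, so the order of \<open>exp \<zeta>\<close>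
  is 0 after all.\<close>

lemma constant_combination:
  fixes M :: nat
  assumes c: "\<And>j. j < M \<Longrightarrow> c j \<in> C" and rel: "\<And>D. D \<in> derivations_over C \<Longrightarrow> (\<Sum>j<M. c j * \<omega> (z j) D) = 0"
    and \<phi>: "\<phi> \<in> rat_functionals C"
  shows "(\<Sum>j<M. c j * of_rat (\<phi> (z j))) = 0"
proof (rule ccontr)
  assume nz: "(\<Sum>j<M. c j * of_rat (\<phi> (z j))) \<noteq> 0"
  define W :: "(nat \<Rightarrow> real) set" where "W = {w. (\<forall>i. w i \<in> \<rat>) \<and> (\<Sum>j<M. c j * w j) = 0}"
  have "(\<exists>w\<in>W. \<forall>i<M. w i = of_rat (\<phi> (z i))) \<or>
    (\<exists>v. (\<forall>i. v i \<in> \<rat>) \<and> (\<forall>w\<in>W. (\<Sum>i<M. w i * v i) = 0) \<and> (\<Sum>i<M. of_rat (\<phi> (z i)) * v i) = 1)"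
  proof (rule in_subspace_or_separated)
    show "(\<lambda>i. k * w i) \<in> W" if "k \<in> \<rat>" "w \<in> W" for k w
    proof -
      have "(\<Sum>j<M. c j * (k * w j)) = k * (\<Sum>j<M. c j * w j)" by (simp add: sum_distrib_left mult_ac)
      then show ?thesis using that by (simp add: W_def)
    qed
  qed (auto simp: W_def is_subfield_Rats distrib_left sum.distrib)
  moreover have False if "w \<in> W" "\<forall>i<M. w i = of_rat (\<phi> (z i))" for w
    using that nz by (simp add: W_def)
  ultimately obtain v where v: "\<And>i. v i \<in> \<rat>" "\<And>w. w \<in> W \<Longrightarrow> (\<Sum>i<M. w i * v i) = 0"
    "(\<Sum>i<M. of_rat (\<phi> (z i)) * v i) = 1" by blast
  obtain b where b: "b \<noteq> 0" "\<And>j. j < M \<Longrightarrow> v j * b \<in> \<int>"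
    using common_denominator[OF is_subring_Ints, of M v] Rats_as_quotient[OF v(1)] by blast
  then have "\<forall>j. \<exists>k. j < M \<longrightarrow> v j * b = of_int k" by (auto elim: Ints_cases)
  then obtain \<tau> where \<tau>: "\<And>j. j < M \<Longrightarrow> v j * b = of_int (\<tau> j)" by metis
  define \<zeta> where "\<zeta> = (\<Sum>j<M. of_int (\<tau> j) * z j)"
  have "\<phi> \<zeta> = (\<Sum>j<M. of_int (\<tau> j) * \<phi> (z j))"
    using rat_functional_sum[OF \<phi>, of "\<lambda>j. of_int (\<tau> j)" z "{..<M}"] by (simp add: \<zeta>_def)
  then have "of_rat (\<phi> \<zeta>) = (\<Sum>j<M. of_int (\<tau> j) * (of_rat (\<phi> (z j)) :: real))"
    by (simp add: of_rat_sum of_rat_mult)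
  also have "\<dots> = (\<Sum>j<M. b * (of_rat (\<phi> (z j)) * v j))"
    using \<tau> by (intro sum.cong) (auto simp flip: \<tau>)
  also have "\<dots> = b" using v(3) by (simp flip: sum_distrib_left)
  finally have "\<phi> \<zeta> \<noteq> 0" using b(1) by auto
  then have "\<zeta> \<notin> C" using \<phi> by (auto simp: rat_functionals_def)
  then have "exp \<zeta> \<notin> C" by (simp add: C_def \<delta>_exp)
  \<comment> \<open>The \<open>c j\<close> are constants for \<open>D\<close> too, so the terms
    \<open>c j * D (z j)\<close> add up to an exact derivative, which has no residue.\<close>
  define h where "h = (\<Sum>j<M. c j * z j)"
  define Y where "Y = insert h ((\<lambda>j. exp (z j)) ` {..<M})"
  have Y: "finite Y" by (simp add: Y_def)
  obtain D A ord where D: "D \<in> derivations_over C" and A: "is_subfield A" "insert (exp \<zeta>) Y \<subseteq> A"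
    and ord: "\<forall>a\<in>A. \<forall>b\<in>A. a \<noteq> 0 \<longrightarrow> b \<noteq> 0 \<longrightarrow> ord (a * b) = ord a + ord b" "ord (exp \<zeta>) \<noteq> (0 :: int)"
    and res: "\<forall>(M :: nat) c y h. (\<forall>j<M. c j \<in> C \<and> y j \<in> A \<and> y j \<noteq> 0) \<longrightarrow> h \<in> A \<longrightarrow>
       (\<Sum>j<M. c j * (D (y j) / y j)) = D h \<longrightarrow> (\<Sum>j<M. c j * of_int (ord (y j))) = 0"
    using exists_order_function[OF C_subfield transcendental_over_constants[OF \<open>exp \<zeta> \<notin> C\<close>] Y] by blast
  note AR = subring_closed[OF subfield_subring[OF A(1)]]
  have D': "derivation D" "\<And>c. c \<in> C \<Longrightarrow> D c = 0" using D by (auto simp: derivations_over_def)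
  have zA: "exp (z j) \<in> A" if "j < M" for j using A(2) that by (auto simp: Y_def)
  have "D h = (\<Sum>j<M. c j * D (z j))"
    unfolding h_def derivation_sum[OF D'(1)] using c
    by (intro sum.cong) (auto simp: derivation_mult[OF D'(1)] D'(2))
  then have "(\<Sum>j<M. c j * (D (exp (z j)) / exp (z j))) = D h"
    using rel[OF D] by (simp add: \<omega>_def right_diff_distrib sum_subtractf)
  moreover have "h \<in> A" using A(2) by (simp add: Y_def)
  moreover have "\<forall>j<M. c j \<in> C \<and> exp (z j) \<in> A \<and> exp (z j) \<noteq> 0" using c zA by simp
  ultimately have "(\<Sum>j<M. c j * of_int (ord (exp (z j)))) = 0"
    using res[THEN spec[of _ M], THEN spec[of _ c], THEN spec[of _ "\<lambda>j. exp (z j)"], THEN spec[of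
        _ h]] by simp
  then have "(\<lambda>j. of_int (ord (exp (z j)))) \<in> W" by (simp add: W_def)
  from v(2)[OF this] have "0 = (\<Sum>j<M. of_int (ord (exp (z j))) * v j) * b" by simp
  also have "\<dots> = (\<Sum>j<M. of_int (ord (exp (z j))) * of_int (\<tau> j))"
    using \<tau> by (simp add: sum_distrib_right mult.assoc)
  also have "\<dots> = of_int (\<Sum>j<M. ord (exp (z j)) * \<tau> j)" by simp
  finally have sum0: "(\<Sum>j<M. ord (exp (z j)) * \<tau> j) = 0" using of_int_eq_0_iff by metis
  have ord1: "ord 1 = 0" using ord(1)[rule_format, of 1 1] AR(2) by simp
  have ord_mult: "ord (a * b) = ord a + ord b" if "a \<in> A" "b \<in> A" "a \<noteq> 0" "b \<noteq> 0" for a b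
    using ord(1) that by blast
  have pw: "ord (x ^ k) = int k * ord x" if "x \<in> A" "x \<noteq> 0" for x k
    using that
    by (induction k) (auto simp: ord1 ord_mult subring_power subfield_subring A(1) algebra_simps)
  have pwi: "ord (x powi k) = k * ord x \<and> x powi k \<in> A" if x: "x \<in> A" "x \<noteq> 0" for x k
  proof -
    have "ord (inverse x) = - ord x"
      using ord_mult[of x "inverse x"] x subfield_inverse[OF A(1)] ord1 by simp
    then show ?thesis
      using x pw[of x] pw[of "inverse x"] subfield_inverse[OF A(1) x(1)] subring_power[OF
          subfield_subring[OF A(1)]]
      by (auto simp: power_int_def)
  qed
  have "ord (\<Prod>j\<in>I. exp (z j) powi \<tau> j) = (\<Sum>j\<in>I. \<tau> j * ord (exp (z j))) \<and> (\<Prod>j\<in>I. exp (z j) powi \<tau> j) \<in> A"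
    if "I \<subseteq> {..<M}" for I
    using finite_subset[OF that finite_lessThan] that
  proof (induction I rule: finite_induct)
    case (insert i I)
    then have "exp (z i) \<in> A" using zA by auto
    from pwi[OF this, of "\<tau> i"] insert show ?case
      by (auto simp: ord_mult AR)
  qed (simp add: ord1 AR)
  moreover have "exp \<zeta> = (\<Prod>j<M. exp (z j) powi \<tau> j)"
    unfolding \<zeta>_def by (simp add: exp_sum exp_power_int)
  ultimately have "ord (exp \<zeta>) = (\<Sum>j<M. \<tau> j * ord (exp (z j)))" by auto
  then show False using sum0 ord(2) by (simp add: mult.commute)
qed

text \<open>Ax's theorem in dual form. A shortest relation with normalised value under \<open>\<phi>\<close> has constant
  coefficients, since otherwise subtracting a multiple of its derivative would shorten it.\<close>
theorem ax_independence:
  fixes M :: nat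
  assumes "\<And>D. D \<in> derivations_over C \<Longrightarrow> (\<Sum>j<M. f j * \<omega> (z j) D) = 0"
    and \<phi>: "\<phi> \<in> rat_functionals C"
  shows "(\<Sum>j<M. f j * of_rat (\<phi> (z j))) = 0"
  using assms(1)
proof (induction "card {j. j < M \<and> f j \<noteq> 0}" arbitrary: f rule: less_induct)
  case less
  define q :: "nat \<Rightarrow> real" where "q j = of_rat (\<phi> (z j))" for j
  have \<delta>q: "\<delta> (q j) = 0" for j
  proof -
    have "q j \<in> C" using Rats_in_subfield[OF C_subfield] Rats_of_rat unfolding q_def by blast
    then show ?thesis by (simp add: C_def)
  qed
  show ?case
  proof (rule ccontr)
    assume "(\<Sum>j<M. f j * of_rat (\<phi> (z j))) \<noteq> 0"
    then have nz: "(\<Sum>j<M. f j * q j) \<noteq> 0" by (simp add: q_def)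
    define g where "g j = f j / (\<Sum>j<M. f j * q j)" for j
    have g1: "(\<Sum>j<M. g j * q j) = 1"
      using nz by (simp add: g_def flip: sum_divide_distrib)
    have g0: "g j = 0 \<longleftrightarrow> f j = 0" for j using nz by (simp add: g_def)
    have gL: "(\<Sum>j<M. g j * \<omega> (z j) D) = 0" if "D \<in> derivations_over C" for D
      using less.prems[OF that] by (simp add: g_def flip: sum_divide_distrib)
    have g'1: "(\<Sum>j<M. \<delta> (g j) * q j) = 0"
    proof -
      have "0 = \<delta> (\<Sum>j<M. g j * q j)" by (simp add: g1 derivation_1[OF \<delta>])
      also have "\<dots> = (\<Sum>j<M. \<delta> (g j) * q j)"
        by (simp add: derivation_sum[OF \<delta>] derivation_mult[OF \<delta>] \<delta>q)
      finally show ?thesis by simp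
    qed
    \<comment> \<open>Applying \<delta> differentiates either the coefficients or the forms; the
      second group is the original relation evaluated at \<open>bracket D\<close>, again a
      derivation over \<open>C\<close>.\<close>
    have g'L: "(\<Sum>j<M. \<delta> (g j) * \<omega> (z j) D) = 0" if D: "D \<in> derivations_over C" for D
    proof -
      have "0 = \<delta> (\<Sum>j<M. g j * \<omega> (z j) D)" by (simp add: gL[OF D] derivation_0[OF \<delta>])
      also have "\<dots> = (\<Sum>j<M. \<delta> (g j) * \<omega> (z j) D) + (\<Sum>j<M. g j * \<omega> (z j) (bracket D))"
        by (simp add: derivation_sum[OF \<delta>] derivation_mult[OF \<delta>] \<delta>_\<omega>[OF D] sum.distrib)
      finally show ?thesis using gL[OF bracket_in[OF D]] by simp
    qed
    show False
    proof (cases "\<forall>j<M. \<delta> (g j) = 0")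
      case True
      then have "(\<Sum>j<M. g j * of_rat (\<phi> (z j))) = 0"
        using gL by (intro constant_combination \<phi>) (auto simp: C_def)
      then show False using g1 by (simp add: q_def)
    next
      case False
      then obtain i where i: "i < M" "\<delta> (g i) \<noteq> 0" by blast
      \<comment> \<open>Chosen to cancel coefficient \<open>i\<close>. The value under \<phi> stays
        1, because the differentiated relation has value 0.\<close>
      define r where "r = g i / \<delta> (g i)"
      define g2 where "g2 j = g j - r * \<delta> (g j)" for j
      have "g i \<noteq> 0" using i derivation_0[OF \<delta>] by auto
      have "g2 j = 0" if "f j = 0" for j
        using g0[of j] that by (simp add: g2_def derivation_0[OF \<delta>])
      moreover have "g2 i = 0" using i(2) by (simp add: g2_def r_def)
      ultimately have "{j. j < M \<and> g2 j \<noteq> 0} \<subseteq> {j. j < M \<and> f j \<noteq> 0} - {i}" by auto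
      also have "\<dots> \<subset> {j. j < M \<and> f j \<noteq> 0}" using i(1) \<open>g i \<noteq> 0\<close> g0 by auto
      finally have "card {j. j < M \<and> g2 j \<noteq> 0} < card {j. j < M \<and> f j \<noteq> 0}"
        by (intro psubset_card_mono) auto
      moreover have "(\<Sum>j<M. g2 j * \<omega> (z j) D) = 0" if D: "D \<in> derivations_over C" for D
      proof -
        have "(\<Sum>j<M. g2 j * \<omega> (z j) D) = (\<Sum>j<M. g j * \<omega> (z j) D) - r * (\<Sum>j<M. \<delta> (g j) * \<omega> (z j) D)"
          by (simp add: g2_def left_diff_distrib sum_subtractf sum_distrib_left mult.assoc)
        then show ?thesis using gL[OF D] g'L[OF D] by simp
      qed
      ultimately have "(\<Sum>j<M. g2 j * of_rat (\<phi> (z j))) = 0" by (rule less.hyps)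
      moreover have "(\<Sum>j<M. g2 j * q j) = (\<Sum>j<M. g j * q j) - r * (\<Sum>j<M. \<delta> (g j) * q j)"
        by (simp add: g2_def left_diff_distrib sum_subtractf sum_distrib_left mult.assoc)
      ultimately show False using g1 g'1 by (simp add: q_def)
    qed
  qed
qed

end

section \<open>Powers with exponentially transcendental exponent\<close>

context exp_derivation
begin

text \<open>Subtracting \<open>D p\<close> times \<open>\<delta>\<close> from a derivation \<open>D\<close> makes it kill \<open>p\<close> without changing \<open>\<omega> z D\<close>.\<close>
lemma power_relation:
  fixes n :: nat
  assumes p: "\<delta> p = 1"
    and rel: "\<And>D. D \<in> derivations_over C \<Longrightarrow> D p = 0 \<Longrightarrow>
      (\<Sum>i<n. f i * (D (exp (p * a i)) / exp (p * a i) - p * (D (exp (a i)) / exp (a i)))) = 0"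
    and \<phi>: "\<phi> \<in> rat_functionals C"
  shows "(\<Sum>i<n. f i * (of_rat (\<phi> (p * a i)) - p * of_rat (\<phi> (a i)))) = 0"
proof -
  have split: "(\<Sum>j<n + m. g j) = (\<Sum>j<n. g j) + (\<Sum>j<m. g (n + j))" for g :: "nat \<Rightarrow> real" and m
    by (induction m) (auto simp: add.assoc)
  \<comment> \<open>The relation is read as one between \<open>n + n\<close> forms, those at
    \<open>p * a i\<close> and those at \<open>a i\<close>, the latter with weights
    \<open>- p * f i\<close>.\<close>
  define z where "z j = (if j < n then p * a j else a (j - n))" for j
  define c where "c j = (if j < n then f j else - p * f (j - n))" for j
  have "(\<Sum>j<n + n. c j * \<omega> (z j) D) = 0" if D: "D \<in> derivations_over C" for D
  proof -
    define D0 where "D0 u = D u - D p * \<delta> u" for u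
    have D': "derivation D" using D by (auto simp: derivations_over_def)
    have "derivation D0"
      unfolding derivation_def D0_def
      by (simp add: derivation_add[OF \<delta>] derivation_add[OF D'] derivation_mult[OF \<delta>]
          derivation_mult[OF D']
          algebra_simps)
    moreover have "D0 u = 0" if "u \<in> C" for u
      using that D by (simp add: D0_def C_def derivations_over_def)
    ultimately have D0: "D0 \<in> derivations_over C" "derivation D0" by (auto simp: derivations_over_def)
    have D0p: "D0 p = 0" by (simp add: D0_def p)
    have \<omega>: "\<omega> u D0 = \<omega> u D" for u
      by (simp add: \<omega>_def D0_def \<delta>_exp diff_divide_distrib algebra_simps)
    have "(\<Sum>j<n + n. c j * \<omega> (z j) D) = (\<Sum>j<n. f j * \<omega> (p * a j) D0) + (\<Sum>j<n. - p * f j * \<omega> (a j) D0)"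
      unfolding split by (simp add: c_def z_def \<omega>)
    \<comment> \<open>From \<open>D0 p = 0\<close> comes \<open>D0 (p * a i) = p * D0 (a i)\<close>,
      so the parts without exponentials cancel.\<close>
    also have "\<dots> = (\<Sum>i<n. f i * (D0 (exp (p * a i)) / exp (p * a i) - p * (D0 (exp (a i)) / exp (a
        i))))"
      unfolding sum.distrib[symmetric]
      by (intro sum.cong refl) (simp add: \<omega>_def derivation_mult[OF D0(2)] D0p algebra_simps)
    also have "\<dots> = 0" using rel[OF D0(1) D0p] .
    finally show ?thesis .
  qed
  from ax_independence[OF this \<phi>]
  have "(\<Sum>j<n. f j * of_rat (\<phi> (p * a j))) + (\<Sum>j<n. - p * f j * of_rat (\<phi> (a j))) = 0"
    unfolding split by (simp add: c_def z_def)
  then show ?thesis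
    unfolding sum.distrib[symmetric] by (simp add: algebra_simps)
qed

text \<open>Over the field \<open>\<rat>(p)\<close> the relation acquires polynomial coefficients; comparing the coefficients of
  each power of \<open>p\<close> gives \<open>p * u j - u (j - 1) \<in> C\<close> for rational combinations \<open>u j\<close> of the \<open>a i\<close>, and a
  telescoping sum turns this into an algebraic relation for \<open>p\<close> over \<open>C\<close>.\<close>
lemma no_power_relation:
  fixes n :: nat
  assumes p: "\<delta> p = 1" and k: "k < n" "f k \<noteq> 0"
    and rel: "\<And>\<phi>. \<phi> \<in> rat_functionals C \<Longrightarrow>
      (\<Sum>i<n. f i * (of_rat (\<phi> (p * a i)) - p * of_rat (\<phi> (a i)))) = 0"
    and ind: "\<And>q i. (\<And>i. q i \<in> \<rat>) \<Longrightarrow> (\<Sum>i<n. q i * a i) = 0 \<Longrightarrow> i < n \<Longrightarrow> q i = 0"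
  shows False
proof -
  have pC: "transcendental_over C p" using p by (intro transcendental_over_constants) (simp add: C_def)
  note QR = subfield_subring[OF is_subfield_Rats]
  have polyC: "poly_over \<rat> \<subseteq> poly_over C" using Rats_in_subfield[OF C_subfield] by (auto simp:
      poly_over_def)
  define K where "K = adjoin \<rat> p"
  have K: "is_subfield K" unfolding K_def by (rule is_subfield_adjoin[OF QR])
  note KR = subring_closed[OF subfield_subring[OF K]]
  have QK: "insert p \<rat> \<subseteq> K" unfolding K_def by (rule subset_adjoin[OF QR])
  \<comment> \<open>The entries of \<open>f\<close> are arbitrary reals. The unit vector at
    \<open>k\<close> is not among the vectors over \<open>K\<close> orthogonal to \<open>f\<close>,
    so some \<open>v\<close> over \<open>K\<close> with \<open>v k = 1\<close> annihilates all of
    these and can stand in for \<open>f\<close>.\<close>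
  define W where "W = {w. (\<forall>i. w i \<in> K) \<and> (\<Sum>i<n. f i * w i) = 0}"
  have "(\<exists>w\<in>W. \<forall>i<n. w i = of_bool (i = k)) \<or>
    (\<exists>v. (\<forall>i. v i \<in> K) \<and> (\<forall>w\<in>W. (\<Sum>i<n. w i * v i) = 0) \<and> (\<Sum>i<n. of_bool (i = k) * v i) = 1)"
  proof (rule in_subspace_or_separated[OF K])
    show "(\<lambda>i. c * w i) \<in> W" if "c \<in> K" "w \<in> W" for c w
    proof -
      have "(\<Sum>j<n. f j * (c * w j)) = c * (\<Sum>j<n. f j * w j)" by (simp add: sum_distrib_left mult_ac)
      then show ?thesis using that KR by (simp add: W_def)
    qed
  qed (use KR in \<open>auto simp: W_def distrib_left sum.distrib\<close>)
  moreover have False if w: "w \<in> W" "\<forall>i<n. w i = of_bool (i = k)" for w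
  proof -
    have "(\<Sum>i<n. f i * w i) = (\<Sum>i<n. if i = k then f k else 0)" using w(2) by (intro sum.cong) auto
    then show False using w(1) k by (simp add: W_def)
  qed
  ultimately obtain v where v: "\<And>i. v i \<in> K" "\<And>w. w \<in> W \<Longrightarrow> (\<Sum>i<n. w i * v i) = 0"
    "(\<Sum>i<n. of_bool (i = k) * v i) = 1" by blast
  have vk: "v k = 1" using v(3) k(1) by (simp add: of_bool_def if_distrib[of "\<lambda>t. t * _"] cong: if_cong)
  have "\<exists>x\<in>(\<lambda>P. poly P p) ` poly_over \<rat>. \<exists>y\<in>(\<lambda>P. poly P p) ` poly_over \<rat>. y \<noteq> 0 \<and> v j = x / y" for j
    using v(1)[of j] unfolding K_def adjoin_def by blast
  then obtain b where b: "b \<noteq> 0" "\<And>j. j < n \<Longrightarrow> v j * b \<in> (\<lambda>P. poly P p) ` poly_over \<rat>"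
    using common_denominator[OF is_subring_poly_values[OF QR, of p], of n v] by blast
  then have "\<forall>j. \<exists>P. j < n \<longrightarrow> P \<in> poly_over \<rat> \<and> poly P p = v j * b" by force
  then obtain V where V: "\<And>j. j < n \<Longrightarrow> V j \<in> poly_over \<rat>" "\<And>j. j < n \<Longrightarrow> poly (V j) p = v j * b" by metis
  have Vk: "V k \<noteq> 0" using V(2)[OF k(1)] vk b(1) by auto
  have rat: "coeff (V i) j \<in> \<rat>" if "i < n" for i j using V(1)[OF that] by (simp add: poly_over_def)
  \<comment> \<open>The coefficient of the \<open>j\<close>-th power in the sum of the
    \<open>V i\<close> times \<open>a i\<close>; in \<open>u'\<close> it is shifted by one place, as
    multiplication by \<open>p\<close> shifts powers.\<close>
  define u where "u j = (\<Sum>i<n. coeff (V i) j * a i)" for j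
  define u' where "u' j = (case j of 0 \<Rightarrow> 0 | Suc j \<Rightarrow> u j)" for j
  have in_C: "p * u j - u' j \<in> C" for j
  proof (rule in_subfield_of_rat_functionals[OF C_subfield])
    fix \<phi> assume \<phi>: "\<phi> \<in> rat_functionals C"
    \<comment> \<open>The relation for \<phi> with an indeterminate in place of \<open>p\<close>.
      Its coefficients are rational and \<open>p\<close> is transcendental over \<open>C\<close>, so
      it vanishes identically.\<close>
    define R where "R = (\<Sum>i<n. V i * [:of_rat (\<phi> (p * a i)), - of_rat (\<phi> (a i)):])"
    have "(\<lambda>i. of_rat (\<phi> (p * a i)) - p * of_rat (\<phi> (a i))) \<in> W"
      using rel[OF \<phi>] QK by (auto simp: W_def intro!: KR)
    from v(2)[OF this]
    have "(\<Sum>i<n. b * ((of_rat (\<phi> (p * a i)) - p * of_rat (\<phi> (a i))) * v i)) = 0"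
      unfolding sum_distrib_left[symmetric] by simp
    also have "(\<Sum>i<n. b * ((of_rat (\<phi> (p * a i)) - p * of_rat (\<phi> (a i))) * v i)) = poly R p"
      unfolding R_def poly_sum using V(2) by (intro sum.cong) (auto simp: algebra_simps)
    finally have "poly R p = 0" .
    moreover have "R \<in> poly_over C"
      unfolding R_def using V(1) polyC Rats_in_subfield[OF C_subfield] C_closed
      by (intro subring_sum is_subring_poly_over subfield_subring C_subfield
          subring_closed(4)[OF is_subring_poly_over[OF subfield_subring[OF C_subfield]]]
              poly_over_pCons poly_over_const)
         (auto intro!: C_closed)
    ultimately have "R = 0" using pC by (simp add: transcendental_over_def)
    have qr: "\<exists>q. x = of_rat q" if "x \<in> \<rat>" for x :: real using that by (auto elim: Rats_cases)
    then have "\<forall>i j. \<exists>q. i < n \<longrightarrow> coeff (V i) j = of_rat q" using rat by blast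
    then obtain q where q: "\<And>i j. i < n \<Longrightarrow> coeff (V i) j = of_rat (q i j)" by metis
    have \<phi>_add: "\<phi> (x + y) = \<phi> x + \<phi> y" for x y using \<phi> by (simp add: rat_functionals_def)
    have \<phi>_diff: "\<phi> (x - y) = \<phi> x - \<phi> y" for x y using \<phi>_add[of "x - y" y] by simp
    have \<phi>_0: "\<phi> 0 = 0" using \<phi>_add[of 0 0] by simp
    have \<phi>pu: "\<phi> (p * u j) = (\<Sum>i<n. q i j * \<phi> (p * a i))"
    proof -
      have "p * u j = (\<Sum>i<n. of_rat (q i j) * (p * a i))"
        by (auto simp: u_def sum_distrib_left q intro!: sum.cong)
      then show ?thesis using rat_functional_sum[OF \<phi>] by simp
    qed
    have \<phi>u: "\<phi> (u j) = (\<Sum>i<n. q i j * \<phi> (a i))" for j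
      using rat_functional_sum[OF \<phi>, of "\<lambda>i. q i j" a "{..<n}"] by (simp add: u_def q)
    have "0 = coeff R j" using \<open>R = 0\<close> by simp
    also have "\<dots> = (\<Sum>i<n. coeff (V i) j * of_rat (\<phi> (p * a i))) -
        (case j of 0 \<Rightarrow> 0 | Suc j \<Rightarrow> (\<Sum>i<n. coeff (V i) j * of_rat (\<phi> (a i))))"
      unfolding R_def coeff_sum
      by (cases j) (simp_all add: mult_pCons_right coeff_pCons sum_subtractf mult.commute sum_negf)
    also have "\<dots> = of_rat (\<phi> (p * u j) - \<phi> (u' j))"
      unfolding u'_def using \<phi>pu \<phi>u \<phi>_0
      by (cases j) (simp_all add: q of_rat_sum of_rat_mult of_rat_diff)
    finally show "\<phi> (p * u j - u' j) = 0" by (simp add: \<phi>_diff)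
  qed
  define d where "d = Suc (Max (insert 0 ((\<lambda>i. degree (V i)) ` {..<n})))"
  have deg: "degree (V i) < d" if "i < n" for i
    using that unfolding d_def less_Suc_eq_le by (intro Max_ge) auto
  have u_high: "u j = 0" if "j \<ge> d" for j
  proof -
    have "coeff (V i) j = 0" if "i < n" for i
      using deg[OF that] \<open>d \<le> j\<close> by (intro coeff_eq_0) simp
    then show ?thesis by (simp add: u_def)
  qed
  have pnz: "p \<noteq> 0" using p derivation_0[OF \<delta>] by auto
  have cj: "p * u j - u' j = 0" for j
  proof (cases "j \<le> d")
    case True
    \<comment> \<open>Weighted by powers of \<open>p\<close>, these elements telescope to a multiple
      of \<open>u d\<close>, which is 0. As they lie in \<open>C\<close>, the transcendence of
      \<open>p\<close> makes each of them 0.\<close>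
    define S where "S = (\<Sum>j\<le>d. monom (p * u j - u' j) j)"
    have telescope: "(\<Sum>j\<le>m. (p * u j - u' j) * p ^ j) = p ^ Suc m * u m" for m
      by (induction m) (auto simp: u'_def algebra_simps)
    have "poly S p = p ^ Suc d * u d"
      unfolding S_def poly_sum poly_monom by (rule telescope)
    then have "poly S p = 0" by (simp add: u_high)
    moreover have coeff: "coeff S i = (if i \<le> d then p * u i - u' i else 0)" for i
      unfolding S_def coeff_sum by (simp add: if_distrib sum.delta cong: if_cong)
    then have "S \<in> poly_over C" using in_C C_closed(1) by (simp add: poly_over_def)
    ultimately have "S = 0" using pC by (simp add: transcendental_over_def)
    then show ?thesis using coeff[of j] True by simp
  next
    case False
    then show ?thesis using u_high[of j] u_high[of "j - 1"] by (cases j) (auto simp: u'_def)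
  qed
  have u0: "u j = 0" for j
  proof (induction j)
    case 0 show ?case using cj[of 0] pnz by (simp add: u'_def)
  next
    case (Suc j) then show ?case using cj[of "Suc j"] pnz by (simp add: u'_def)
  qed
  have "coeff (V k) j = 0" for j
  proof -
    define q where "q i = (if i < n then coeff (V i) j else 0)" for i
    have "q k = 0"
    proof (rule ind)
      show "q i \<in> \<rat>" for i using rat by (simp add: q_def)
      show "(\<Sum>i<n. q i * a i) = 0" using u0[of j] by (simp add: u_def q_def)
    qed (rule k(1))
    then show ?thesis using k(1) by (simp add: q_def)
  qed
  then show False using Vk by (simp add: poly_eq_iff)
qed

end

lemma underdetermined_system:
  fixes g :: "'i \<Rightarrow> 'b \<Rightarrow> 'a::field"
  assumes "finite B" "finite I" "card B < card I"
  shows "\<exists>r. (\<exists>k\<in>I. r k \<noteq> 0) \<and> (\<forall>b\<in>B. (\<Sum>k\<in>I. r k * g k b) = 0)"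
  using assms
proof (induction B arbitrary: I g rule: finite_induct)
  case empty
  then have "I \<noteq> {}" by auto
  then show ?case by (intro exI[of _ "\<lambda>_. 1"]) auto
next
  case (insert b B)
  show ?case
  proof (cases "\<forall>k\<in>I. g k b = 0")
    case True
    obtain r where "\<exists>k\<in>I. r k \<noteq> 0" "\<forall>b\<in>B. (\<Sum>k\<in>I. r k * g k b) = 0"
      using insert.IH[of I g] insert.prems insert.hyps by auto
    then show ?thesis using True by (intro exI[of _ r]) auto
  next
    case False
    then obtain k0 where k0: "k0 \<in> I" "g k0 b \<noteq> 0" by blast
    let ?I = "I - {k0}"
    define g' where "g' k c = g k c - g k b / g k0 b * g k0 c" for k c
    have "card B < card ?I" using insert.prems insert.hyps k0 by (simp add: card_Diff_singleton)
    then obtain r where r: "\<exists>k\<in>?I. r k \<noteq> 0" "\<And>c. c \<in> B \<Longrightarrow> (\<Sum>k\<in>?I. r k * g' k c) = 0"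
      using insert.IH[of ?I g'] insert.prems by auto
    define s where "s = (\<Sum>k\<in>?I. r k * (g k b / g k0 b))"
    define r' where "r' k = (if k = k0 then - s else r k)" for k
    have sum: "(\<Sum>k\<in>I. r' k * g k c) = (\<Sum>k\<in>?I. r k * g' k c)" for c
    proof -
      have "(\<Sum>k\<in>I. r' k * g k c) = r' k0 * g k0 c + (\<Sum>k\<in>?I. r' k * g k c)"
        using insert.prems(1) k0(1) by (rule sum.remove)
      also have "\<dots> = (\<Sum>k\<in>?I. r k * g k c) - s * g k0 c"
        by (simp add: r'_def)
      also have "\<dots> = (\<Sum>k\<in>?I. r k * g' k c)"
        by (simp add: s_def g'_def right_diff_distrib sum_subtractf sum_distrib_right mult.assoc)
      finally show ?thesis .
    qed
    have "(\<Sum>k\<in>?I. r k * g' k b) = 0" using k0(2) by (simp add: g'_def)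
    then have "\<forall>c\<in>insert b B. (\<Sum>k\<in>I. r' k * g k c) = 0" using r(2) by (simp add: sum)
    moreover have "\<exists>k\<in>I. r' k \<noteq> 0" using r(1) by (auto simp: r'_def)
    ultimately show ?thesis by blast
  qed
qed

section \<open>Algebraic dependence seen through derivations\<close>

lemma alg_indep_over_empty: "alg_indep_over K {}"
  unfolding alg_indep_over_def
proof (intro allI impI)
  fix P :: "('a, 'a) mpolynomial"
  assume P: "(\<forall>m. Poly_Mapping.lookup P m \<in> K) \<and> mpoly_vars P \<subseteq> {} \<and> mpoly_eval (\<lambda>c. c) (\<lambda>b. b) P = 0"
  have "m = 0" if "m \<in> Poly_Mapping.keys P" for m using P that by (auto simp: mpoly_vars_def)
  then have "Poly_Mapping.keys P \<subseteq> {0}" by blast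
  then have "mpoly_eval (\<lambda>c. c) (\<lambda>b. b) P = Poly_Mapping.lookup P 0"
    by (subst mpoly_eval_superset[of "{0}"]) (auto simp: monomial_eval_def)
  then have "0 \<notin> Poly_Mapping.keys P" using P by (simp add: in_keys_iff)
  then show "P = 0" using \<open>Poly_Mapping.keys P \<subseteq> {0}\<close> by (metis keys_eq_empty subset_singletonD
      singletonI)
qed

text \<open>An algebraic relation, read as a polynomial in \<open>x\<close>, has coefficients killed by \<open>D\<close>; one of them
  is nonzero because \<open>B\<close> is algebraically independent.\<close>
lemma derivation_algebraically_dependent:
  fixes D :: "'a::field_char_0 \<Rightarrow> 'a"
  assumes K: "is_subring K" and B: "alg_indep_over K B" and x: "\<not> alg_indep_over K (insert x B)"
    and D: "derivation D" "\<And>c. c \<in> K \<union> B \<Longrightarrow> D c = 0"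
  shows "D x = 0"
proof -
  define G where "G = {c. D c = 0}"
  have GR: "is_subring G" unfolding G_def by (rule subfield_subring[OF is_subfield_constants[OF D(1)]])
  note G_closed = subring_closed[OF GR]
  obtain P :: "('a, 'a) mpolynomial" where P: "\<And>m. Poly_Mapping.lookup P m \<in> K" "mpoly_vars P \<subseteq>
      insert x B"
    "mpoly_eval (\<lambda>c. c) (\<lambda>b. b) P = 0" "P \<noteq> 0"
    using x unfolding alg_indep_over_def by blast
  \<comment> \<open>The monomial \<open>m\<close> without its power of \<open>x\<close>; collecting
    by that power turns \<open>P\<close> into the polynomial \<open>q\<close>.\<close>
  define \<mu> where "\<mu> m = m - Poly_Mapping.single x (Poly_Mapping.lookup m x)" for m :: "'a \<Rightarrow>\<^sub>0 nat"
  define C where "C m = Poly_Mapping.lookup P m * monomial_eval (\<lambda>b. b) (\<mu> m)" for m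
  define q where "q = (\<Sum>m\<in>Poly_Mapping.keys P. monom (C m) (Poly_Mapping.lookup m x))"
  have \<mu>_split: "\<mu> m + Poly_Mapping.single x (Poly_Mapping.lookup m x) = m" for m
    by (rule poly_mapping_eqI) (auto simp: \<mu>_def lookup_add lookup_minus lookup_single when_def)
  have \<mu>_keys: "Poly_Mapping.keys (\<mu> m) \<subseteq> B" if "m \<in> Poly_Mapping.keys P" for m
  proof
    fix v assume v: "v \<in> Poly_Mapping.keys (\<mu> m)"
    then have "v \<noteq> x" "v \<in> Poly_Mapping.keys m"
      by (auto simp: \<mu>_def in_keys_iff lookup_minus lookup_single when_def split: if_splits)
    then show "v \<in> B" using P(2) that by (auto simp: mpoly_vars_def)
  qed
  have C_G: "C m \<in> G" if "m \<in> Poly_Mapping.keys P" for m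
  proof -
    have "monomial_eval (\<lambda>b. b) (\<mu> m) \<in> G"
      unfolding monomial_eval_def
      using \<mu>_keys[OF that] D(2) by (intro subring_prod subring_power GR) (auto simp: G_def)
    then show ?thesis using P(1) D(2) G_closed(4) by (simp add: C_def G_def)
  qed
  have "q \<in> poly_over G"
    unfolding q_def using C_G G_closed(1)
    by (intro subring_sum is_subring_poly_over GR) (auto simp: poly_over_def)
  moreover have "poly q x = 0"
  proof -
    have "Poly_Mapping.lookup P m * monomial_eval (\<lambda>b. b) m = C m * x ^ Poly_Mapping.lookup m x" for m
    proof -
      have "monomial_eval (\<lambda>b. b) (Poly_Mapping.single x k) = x ^ k" for k
        by (subst monomial_eval_superset[of "{x}"]) auto
      then have "monomial_eval (\<lambda>b. b) m = monomial_eval (\<lambda>b. b) (\<mu> m) * x ^ Poly_Mapping.lookup m x"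
        using monomial_eval_add[of "\<lambda>b. b" "\<mu> m" "Poly_Mapping.single x (Poly_Mapping.lookup m x)"]
        by (simp only: \<mu>_split)
      then show ?thesis by (simp add: C_def)
    qed
    then show ?thesis
      using P(3) mpoly_eval_superset[of "Poly_Mapping.keys P" P "\<lambda>c. c" "\<lambda>b. b"]
      by (simp add: q_def poly_sum poly_monom)
  qed
  moreover have "q \<noteq> 0"
  proof -
    obtain m0 where m0: "m0 \<in> Poly_Mapping.keys P" using P(4) by (metis keys_eq_empty ex_in_conv)
    let ?k = "Poly_Mapping.lookup m0 x"
    let ?M = "{m \<in> Poly_Mapping.keys P. Poly_Mapping.lookup m x = ?k}"
    \<comment> \<open>The part of \<open>P\<close> with one fixed power of \<open>x\<close>, that
      power dropped. There \<open>\<mu>\<close> is injective, so no coefficients merge and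
      \<open>R\<close> is nonzero.\<close>
    define R where "R = (\<Sum>m\<in>?M. Poly_Mapping.single (\<mu> m) (Poly_Mapping.lookup P m))"
    have inj: "m = m'" if "m \<in> ?M" "m' \<in> ?M" "\<mu> m = \<mu> m'" for m m'
      using that \<mu>_split[of m] \<mu>_split[of m'] by simp
    have "coeff q ?k = (\<Sum>m\<in>?M. C m)"
      unfolding q_def coeff_sum coeff_monom
      by (subst sum.inter_filter[symmetric]) (auto intro!: sum.cong)
    also have "\<dots> = mpoly_eval (\<lambda>c. c) (\<lambda>b. b) R"
    proof -
      have "mpoly_eval (\<lambda>c. c) (\<lambda>b. b) (sum F S) = (\<Sum>m\<in>S. mpoly_eval (\<lambda>c. c) (\<lambda>b. b) (F m))"
        for F :: "('a \<Rightarrow>\<^sub>0 nat) \<Rightarrow> ('a, 'a) mpolynomial" and S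
        by (induction S rule: infinite_finite_induct)
           (auto simp: mpoly_eval_add mpoly_eval_def[of _ _ 0])
      then show ?thesis by (simp add: R_def mpoly_eval_single C_def)
    qed
    finally have eq: "coeff q ?k = mpoly_eval (\<lambda>c. c) (\<lambda>b. b) R" .
    have lookup_R: "Poly_Mapping.lookup R l = (\<Sum>m\<in>?M. Poly_Mapping.lookup P m when \<mu> m = l)" for l
      unfolding R_def lookup_sum lookup_single ..
    have "Poly_Mapping.lookup R (\<mu> m0) = (\<Sum>m\<in>?M. if m = m0 then Poly_Mapping.lookup P m0 else 0)"
      unfolding lookup_R using inj m0 by (intro sum.cong) (auto simp: when_def)
    also have "\<dots> = Poly_Mapping.lookup P m0" using m0 by simp
    finally have "R \<noteq> 0" using m0 by (auto simp: in_keys_iff)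
    moreover have "Poly_Mapping.lookup R l \<in> K" for l
      unfolding lookup_R using P(1) subring_closed(1)[OF K] by (intro subring_sum K) (auto simp:
          when_def)
    moreover have "mpoly_vars R \<subseteq> B"
      unfolding R_def using \<mu>_keys by (intro mpoly_vars_sum order_trans[OF mpoly_vars_single]) auto
    ultimately have "mpoly_eval (\<lambda>c. c) (\<lambda>b. b) R \<noteq> 0" using B unfolding alg_indep_over_def by blast
    then show ?thesis using eq by auto
  qed
  ultimately have "\<not> transcendental_over G x" by (auto simp: transcendental_over_def)
  moreover have "D \<in> derivations_over G" using D(1) by (simp add: derivations_over_def G_def)
  ultimately show ?thesis by (intro derivation_algebraic[OF _ GR])
qed

lemma rat_adjoin_least: "is_subfield K \<Longrightarrow> S \<subseteq> K \<Longrightarrow> rat_adjoin S \<subseteq> K"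
  by (auto simp: rat_adjoin_def)

lemma subset_rat_adjoin: "S \<subseteq> rat_adjoin S"
  by (auto simp: rat_adjoin_def)

lemma is_subfield_rat_adjoin: "is_subfield (rat_adjoin S)"
  by (auto simp: rat_adjoin_def is_subfield_def)

text \<open>An independent subset of \<open>X\<close> has at most \<open>td X Y\<close> elements, so
  a maximal one, \<open>B\<close>, has fewer than \<open>n\<close>. Every other member of
  \<open>X\<close> is algebraically dependent on \<open>B\<close>, hence killed by the derivations
  that kill \<open>Y\<close> and \<open>B\<close>.\<close>

lemma exists_algebraic_basis:
  fixes X Y :: "'a::field_char_0 set"
  assumes X: "finite X" and td: "\<not> enat n \<le> td X Y"
  shows "\<exists>B\<subseteq>X. card B < n \<and> (\<forall>D. derivation D \<longrightarrow> (\<forall>c\<in>Y \<union> B. D c = 0) \<longrightarrow> (\<forall>x\<in>X. D x = 0))"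
proof -
  define F where "F = {B. B \<subseteq> X \<and> alg_indep_over (rat_adjoin Y) B}"
  have "finite F" using X by (auto simp: F_def intro: finite_subset[of _ "Pow X"])
  moreover have "{} \<in> F" by (simp add: F_def alg_indep_over_empty)
  ultimately obtain B where B: "B \<in> F" "\<And>B'. B' \<in> F \<Longrightarrow> B \<subseteq> B' \<Longrightarrow> B = B'"
    using finite_has_maximal[of F] by blast
  have BX: "B \<subseteq> X" "alg_indep_over (rat_adjoin Y) B" using B(1) by (auto simp: F_def)
  have fin: "finite B" using BX(1) X by (rule finite_subset)
  have "card B < n"
  proof (rule ccontr)
    assume "\<not> card B < n"
    have "B \<subseteq> rat_adjoin (X \<union> Y)" using BX(1) subset_rat_adjoin[of "X \<union> Y"] by blast
    then have "enat (card B) \<le> td X Y"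
      unfolding td_def transcendence_degree_def using fin BX(2) by (intro SUP_upper) auto
    then show False using \<open>\<not> card B < n\<close> td by (meson enat_ord_simps(1) not_less order_trans)
  qed
  moreover have "D x = 0" if D: "derivation D" "\<forall>c\<in>Y \<union> B. D c = 0" and x: "x \<in> X" for D x
  proof (cases "x \<in> B")
    case False
    then have "insert x B \<notin> F" using B(2)[of "insert x B"] by blast
    then have "\<not> alg_indep_over (rat_adjoin Y) (insert x B)" using x BX(1) by (simp add: F_def)
    moreover have "rat_adjoin Y \<subseteq> {c. D c = 0}"
      using D by (intro rat_adjoin_least is_subfield_constants) auto
    ultimately show ?thesis
      using D BX(2) by (intro derivation_algebraically_dependent[of "rat_adjoin Y" B x D]
          subfield_subring is_subfield_rat_adjoin) auto
  qed (use D in blast)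
  ultimately show ?thesis using BX(1) by blast
qed

context exp_derivation
begin

text \<open>Without a relation, derivations over \<open>C\<close> killing \<open>p\<close> would
  attain every unit vector under \<open>\<eta>\<close>. Fewer than \<open>n\<close> conditions let a
  nontrivial combination of them kill \<open>B\<close>, hence all the exponentials and its own image
  under \<open>\<eta>\<close>; but that image has the coefficients of the combination as
  entries.\<close>

lemma exists_relation_of_small_td:
  fixes n :: nat
  assumes p: "\<delta> p = 1"
    and td: "\<not> enat n \<le> td ((\<lambda>i. exp (a i)) ` {..<n} \<union> (\<lambda>i. exp (p * a i)) ` {..<n}) {p}"
  shows "\<exists>f. (\<exists>k<n. f k \<noteq> 0) \<and> (\<forall>D\<in>derivations_over C. D p = 0 \<longrightarrow>
     (\<Sum>i<n. f i * (D (exp (p * a i)) / exp (p * a i) - p * (D (exp (a i)) / exp (a i)))) = 0)"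
proof -
  let ?X = "(\<lambda>i. exp (a i)) ` {..<n} \<union> (\<lambda>i. exp (p * a i)) ` {..<n}"
  obtain B where B: "B \<subseteq> ?X" "card B < n"
    and kills: "\<forall>D. derivation D \<longrightarrow> (\<forall>c\<in>{p} \<union> B. D c = 0) \<longrightarrow> (\<forall>x\<in>?X. D x = 0)"
    using exists_algebraic_basis[OF _ td] by auto
  have fin: "finite B" using B(1) by (rule finite_subset) simp
  define \<D> where "\<D> = {D \<in> derivations_over C. D p = 0}"
  define \<eta> where "\<eta> D i = D (exp (p * a i)) / exp (p * a i) - p * (D (exp (a i)) / exp (a i))" for D i
  define W where "W = \<eta> ` \<D>"
  have lin: "(\<lambda>x. \<Sum>k\<in>I. r k * F k x) \<in> \<D>" if F: "\<And>k. k \<in> I \<Longrightarrow> F k \<in> \<D>" for I and r :: "nat \<Rightarrow> real" and F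
  proof -
    have F': "derivation (F k)" "\<And>c. c \<in> C \<Longrightarrow> F k c = 0" "F k p = 0" if "k \<in> I" for k
      using F[OF that] by (auto simp: \<D>_def derivations_over_def)
    have "derivation (\<lambda>x. \<Sum>k\<in>I. r k * F k x)"
      unfolding derivation_def
      by (auto simp: derivation_add[OF F'(1)] derivation_mult[OF F'(1)] distrib_left sum.distrib
          sum_distrib_left sum_distrib_right mult_ac intro!: sum.cong)
    then show ?thesis using F' by (auto simp: \<D>_def derivations_over_def intro!: sum.neutral)
  qed
  have \<eta>_lin: "\<eta> (\<lambda>x. \<Sum>k\<in>I. r k * F k x) i = (\<Sum>k\<in>I. r k * \<eta> (F k) i)" for I and r :: "nat \<Rightarrow> real"
      and F i
    by (simp add: \<eta>_def right_diff_distrib sum_subtractf sum_divide_distrib sum_distrib_left mult_ac)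
  show ?thesis
  proof (cases "\<forall>k<n. \<exists>w\<in>W. \<forall>i<n. w i = of_bool (i = k)")
    case True
    then have "\<forall>k. \<exists>D. k < n \<longrightarrow> D \<in> \<D> \<and> (\<forall>i<n. \<eta> D i = of_bool (i = k))" unfolding W_def by blast
    then obtain F where F: "\<And>k. k < n \<Longrightarrow> F k \<in> \<D>" "\<And>k i. k < n \<Longrightarrow> i < n \<Longrightarrow> \<eta> (F k) i = of_bool (i = k)"
      by metis
    obtain r where r: "\<exists>k\<in>{..<n}. r k \<noteq> 0" "\<forall>b\<in>B. (\<Sum>k<n. r k * F k b) = 0"
      using underdetermined_system[OF fin, of "{..<n}" F] B(2) by auto
    define D where "D = (\<lambda>x. \<Sum>k<n. r k * F k x)"
    have D: "D \<in> \<D>" unfolding D_def using F(1) by (intro lin) auto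
    then have "derivation D" "\<forall>c\<in>{p} \<union> B. D c = 0"
      using r(2) by (auto simp: \<D>_def derivations_over_def D_def)
    then have "\<forall>x\<in>?X. D x = 0" using kills by blast
    then have "D (exp (a i)) = 0" "D (exp (p * a i)) = 0" if "i < n" for i using that by blast+
    then have "\<eta> D i = 0" if "i < n" for i using that by (simp add: \<eta>_def)
    moreover have "\<eta> D i = r i" if "i < n" for i
    proof -
      have "\<eta> D i = (\<Sum>k<n. if k = i then r i else 0)"
        unfolding D_def \<eta>_lin using F(2) that by (intro sum.cong) auto
      then show ?thesis using that by simp
    qed
    ultimately show ?thesis using r(1) by auto
  next
    case False
    \<comment> \<open>A unit vector that is not attained is separated from all attained ones; the
      separating vector is the relation, with entry 1 at \<open>k\<close>.\<close>
    then obtain k where k: "k < n" "\<not> (\<exists>w\<in>W. \<forall>i<n. w i = of_bool (i = k))" by blast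
    have "(\<exists>w\<in>W. \<forall>i<n. w i = of_bool (i = k)) \<or> (\<exists>v. (\<forall>i. v i \<in> UNIV) \<and>
      (\<forall>w\<in>W. (\<Sum>i<n. w i * v i) = 0) \<and> (\<Sum>i<n. of_bool (i = k) * v i) = 1)"
    proof (rule in_subspace_or_separated[OF is_subfield_UNIV])
      have I: "(\<lambda>i. \<Sum>k\<in>J. r k * \<eta> (F k) i) \<in> W" if "\<And>k. k \<in> J \<Longrightarrow> F k \<in> \<D>" for J and r :: "nat \<Rightarrow>
          real" and F
      proof -
        have "(\<lambda>i. \<Sum>k\<in>J. r k * \<eta> (F k) i) = \<eta> (\<lambda>x. \<Sum>k\<in>J. r k * F k x)"
          by (rule ext) (rule \<eta>_lin[symmetric])
        moreover have "(\<lambda>x. \<Sum>k\<in>J. r k * F k x) \<in> \<D>" by (rule lin) (rule that)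
        ultimately show ?thesis unfolding W_def by (rule image_eqI)
      qed
      show "(\<lambda>_. 0) \<in> W" using I[of "{}"] by simp
      show "(\<lambda>i. u i + w i) \<in> W" if "u \<in> W" "w \<in> W" for u w
      proof -
        obtain F G where "F \<in> \<D>" "u = \<eta> F" "G \<in> \<D>" "w = \<eta> G" using \<open>u \<in> W\<close> \<open>w \<in> W\<close> unfolding W_def
            by blast
        then show ?thesis using I[of "{0, 1}" "\<lambda>k. if k = 0 then F else G" "\<lambda>_. 1"] by simp
      qed
      show "(\<lambda>i. c * w i) \<in> W" if "w \<in> W" for c w
      proof -
        obtain F where "F \<in> \<D>" "w = \<eta> F" using \<open>w \<in> W\<close> unfolding W_def by blast
        then show ?thesis using I[of "{0}" "\<lambda>_. F" "\<lambda>_. c"] by simp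
      qed
    qed auto
    then obtain v where v: "\<And>w. w \<in> W \<Longrightarrow> (\<Sum>i<n. w i * v i) = 0" "(\<Sum>i<n. of_bool (i = k) * v i) = 1"
      using k(2) by blast
    have "v k \<noteq> 0" using v(2) k(1) by (auto simp: of_bool_def if_distrib[of "\<lambda>t. t * _"] cong: if_cong)
    moreover have "(\<Sum>i<n. v i * \<eta> D i) = 0" if "D \<in> \<D>" for D
      using v(1)[of "\<eta> D"] that by (simp add: W_def mult.commute)
    ultimately show ?thesis using k(1) unfolding \<D>_def \<eta>_def by blast
  qed
qed

end

theorem theorem1p1:
  fixes p :: real and n :: nat and y :: "nat \<Rightarrow> real"
  assumes "exponential_field.exp_transcendental (exp :: real \<Rightarrow> real) p"
    and "\<And>i. i < n \<Longrightarrow> y i > 0"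
    and "mult_indep n y"
  shows "td (y ` {..<n} \<union> (\<lambda>i. y i powr p) ` {..<n}) {p} \<ge> enat n"
proof (rule ccontr)
  assume td: "\<not> enat n \<le> td (y ` {..<n} \<union> (\<lambda>i. y i powr p) ` {..<n}) {p}"
  \<comment> \<open>Logarithms turn \<open>y i powr p\<close> into \<open>exp (p * a i)\<close> and
    multiplicative into linear independence.\<close>
  define a where "a i = ln (y i)" for i
  have y: "y i = exp (a i)" "y i powr p = exp (p * a i)" if "i < n" for i
    using assms(2)[OF that] by (simp_all add: a_def powr_def)
  have images: "y ` {..<n} = (\<lambda>i. exp (a i)) ` {..<n}"
    "(\<lambda>i. y i powr p) ` {..<n} = (\<lambda>i. exp (p * a i)) ` {..<n}"
    using y by (auto intro!: image_cong)
  obtain \<delta> :: "real \<Rightarrow> real" where der: "derivation \<delta>" "\<And>z. \<delta> (exp z) = exp z * \<delta> z" "\<delta> p = 1"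
    using exists_exp_derivation[OF assms(1)] by blast
  interpret exp_derivation \<delta> by unfold_locales (use der in auto)
  obtain f k where f: "k < n" "f k \<noteq> 0" "\<And>D. D \<in> derivations_over C \<Longrightarrow> D p = 0 \<Longrightarrow>
      (\<Sum>i<n. f i * (D (exp (p * a i)) / exp (p * a i) - p * (D (exp (a i)) / exp (a i)))) = 0"
    using exists_relation_of_small_td[OF der(3) td[unfolded images]] by blast
  show False
  proof (rule no_power_relation[where f = f and a = a, OF der(3) f(1,2)])
    show "(\<Sum>i<n. f i * (of_rat (\<phi> (p * a i)) - p * of_rat (\<phi> (a i)))) = 0" if "\<phi> \<in> rat_functionals
        C" for \<phi>
      using f(3) that by (rule power_relation[OF der(3)])
    show "q i = 0" if q: "\<And>i. q i \<in> \<rat>" "(\<Sum>i<n. q i * a i) = 0" and i: "i < n" for q i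
    proof -
      \<comment> \<open>Multiplicative independence concerns integer exponents, so the rational
        relation is cleared of denominators.\<close>
      obtain b where b: "b \<noteq> 0" "\<And>j. j < n \<Longrightarrow> q j * b \<in> \<int>"
        using common_denominator[OF is_subring_Ints, of n q] Rats_as_quotient[OF q(1)] by blast
      then have "\<forall>j. \<exists>m. j < n \<longrightarrow> q j * b = of_int m" by (auto elim: Ints_cases)
      then obtain m where m: "\<And>j. j < n \<Longrightarrow> q j * b = of_int (m j)" by metis
      have "(\<Sum>j<n. of_int (m j) * a j) = (\<Sum>j<n. b * (q j * a j))"
        using m by (intro sum.cong) (auto simp flip: m)
      also have "\<dots> = 0" using q(2) by (simp flip: sum_distrib_left)
      finally have "(\<Prod>j<n. y j powi m j) = 1"
        using y(1) by (simp add: exp_power_int flip: exp_sum)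
      then have "m i = 0" using assms(3) i unfolding mult_indep_def by blast
      then show ?thesis using m[OF i] b(1) by simp
    qed
  qed
qed

end
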